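(* Let $\mathcal A$ be a unital algebra over $\mathbb C$, $\sigma\in\mathrm{Aut}(\mathcal A)$, and $\mathcal B\subset\mathcal A$ a subalgebra such that $\sigma$ restricts to an automorphism of $\mathcal B$. For every $n\in\mathbb N$, the twisted Hochschild boundary $b_\sigma:\mathcal A^{\otimes(n+1)}\to\mathcal A^{\otimes n}$ descends to a map $$b_\sigma:C_n^\lambda(\mathcal A/\mathcal B,\sigma)\to C_{n-1}^\lambda(\mathcal A/\mathcal B,\sigma).$$ In particular, the reduced twisted cyclic chains together with the twisted Hochschild boundary form a chain complex.
   Context: The vector space quotient $\mathcal A/\mathcal B$ is a $\mathcal B$-bimodule; $(\mathcal A/\mathcal B)^{\otimes_{\mathcal B}(n+1)}$ is its $(n+1)$-fold tensor power over $\mathcal B$, again a $\mathcal B$-bimodule, for $n\in\mathbb N\cup\{0\}$. Let $[(\mathcal A/\mathcal B)^{\otimes_{\mathcal B}(n+1)},\mathcal B]_\sigma$ be the linear span of all twisted commutators $\omega\cdot b-\sigma(b)\cdot\omega$, and $C_n(\mathcal A/\mathcal B):=(\mathcal A/\mathcal B)^{\otimes_{\mathcal B}(n+1)}/[(\mathcal A/\mathcal B)^{\otimes_{\mathcal B}(n+1)},\mathcal B]_\sigma$. The twisted cyclic operator $\lambda(a_0\otimes\cdots\otimes a_n)=(-1)^n\sigma(a_n)\otimes a_0\otimes\cdots\otimes a_{n-1}$ on $\mathcal A^{\otimes(n+1)}$ descends to $C_n(\mathcal A/\mathcal B)$. The $\mathcal B$-reduced $\sigma$-twisted cyclic $n$-chains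 are $C_n^\lambda(\mathcal A/\mathcal B,\sigma):=C_n(\mathcal A/\mathcal B)/\mathrm{Im}(1-\lambda)$. The twisted Hochschild boundary is $$b_\sigma(a_0\otimes\cdots\otimes a_n)=\sum_{i=0}^{n-1}(-1)^ia_0\otimes\cdots\otimes a_ia_{i+1}\otimes\cdots\otimes a_n+(-1)^n\sigma(a_n)a_0\otimes a_1\otimes\cdots\otimes a_{n-1}.$$ *)

theory Defs
  imports "HOL-Algebra.Algebraic_Closure_Type"
begin

section \<open>Complex vector spaces and algebras with carriers\<close>

text \<open>A complex vector space is a \<open>module\<close> over the ring of complex numbers.\<close>

abbreviation CC :: "complex ring" where
  "CC \<equiv> ring_of_type_algebra"

text \<open>
  The library locale \<open>algebra\<close> describes commutative algebras only. The algebras here are unital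
  and associative, not necessarily commutative, and possibly zero.
\<close>

locale complex_algebra = module CC A + ring A for A (structure) +
  assumes smult_mult_left:
      "\<lbrakk>a \<in> carrier A; a' \<in> carrier A\<rbrakk> \<Longrightarrow> (c \<odot> a) \<otimes> a' = c \<odot> (a \<otimes> a')"
    and smult_mult_right:
      "\<lbrakk>a \<in> carrier A; a' \<in> carrier A\<rbrakk> \<Longrightarrow> a \<otimes> (c \<odot> a') = c \<odot> (a \<otimes> a')"

text \<open>A subalgebra is not required to contain the unit.\<close>

definition complex_subalgebra :: "'a set \<Rightarrow> (complex, 'a, 'm) module_scheme \<Rightarrow> bool" where
  "complex_subalgebra B A \<longleftrightarrow> submodule B CC A \<and> (\<forall>b\<in>B. \<forall>b'\<in>B. b \<otimes>\<^bsub>A\<^esub> b' \<in> B)"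

definition algebra_aut :: "(complex, 'a, 'm) module_scheme \<Rightarrow> ('a \<Rightarrow> 'a) set" where
  "algebra_aut A = {\<sigma> \<in> ring_iso A A. \<forall>c. \<forall>a\<in>carrier A. \<sigma> (c \<odot>\<^bsub>A\<^esub> a) = c \<odot>\<^bsub>A\<^esub> \<sigma> a}"

definition lin :: "(complex, 'v, 'm) module_scheme \<Rightarrow> (complex, 'w, 'n) module_scheme \<Rightarrow> ('v \<Rightarrow> 'w) set"
  where "lin V W = {h \<in> carrier V \<rightarrow>\<^sub>E carrier W.
    (\<forall>x\<in>carrier V. \<forall>y\<in>carrier V. h (x \<oplus>\<^bsub>V\<^esub> y) = h x \<oplus>\<^bsub>W\<^esub> h y) \<and>
    (\<forall>c. \<forall>x\<in>carrier V. h (c \<odot>\<^bsub>V\<^esub> x) = c \<odot>\<^bsub>W\<^esub> h x)}"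

text \<open>
  The linear map sending \<open>f i\<close> to \<open>g i\<close> for all \<open>i \<in> I\<close>. It is used only where the \<open>f i\<close> span \<open>V\<close>
  and where the prescription respects all linear relations between the \<open>f i\<close>.
\<close>

definition lin_ext :: "(complex, 'v, 'm) module_scheme \<Rightarrow> (complex, 'w, 'n) module_scheme
    \<Rightarrow> 'i set \<Rightarrow> ('i \<Rightarrow> 'v) \<Rightarrow> ('i \<Rightarrow> 'w) \<Rightarrow> ('v \<Rightarrow> 'w)" where
  "lin_ext V W I f g = (THE h. h \<in> lin V W \<and> (\<forall>i\<in>I. h (f i) = g i))"

definition lin_span :: "(complex, 'v, 'm) module_scheme \<Rightarrow> 'v set \<Rightarrow> 'v set" where
  "lin_span V S = \<Inter>{W. submodule W CC V \<and> S \<subseteq> W}"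

text \<open>
  The record type \<open>module\<close> extends \<open>ring\<close>; the two multiplicative fields play no role for a
  vector space and are left unspecified.
\<close>

definition quot :: "(complex, 'v, 'm) module_scheme \<Rightarrow> 'v set \<Rightarrow> (complex, 'v set) module" where
  "quot V W = \<lparr>carrier = a_rcosets\<^bsub>V\<^esub> W, monoid.mult = undefined, one = undefined,
     zero = W, add = set_add V, module.smult = (\<lambda>c Y. \<Union>x\<in>Y. W +>\<^bsub>V\<^esub> (c \<odot>\<^bsub>V\<^esub> x))\<rparr>"


section \<open>Tensor powers\<close>

definition tuples :: "(complex, 'v, 'm) module_scheme \<Rightarrow> nat \<Rightarrow> 'v list set" where
  "tuples V n = {vs. length vs = n \<and> set vs \<subseteq> carrier V}"

text \<open>The vector space with basis \<open>Y\<close>: finitely supported functions on \<open>Y\<close>, extended by zero.\<close>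

definition free_space :: "'x set \<Rightarrow> (complex, 'x \<Rightarrow> complex) module" where
  "free_space Y = \<lparr>carrier = {f. finite {x. f x \<noteq> 0} \<and> {x. f x \<noteq> 0} \<subseteq> Y},
     monoid.mult = undefined, one = undefined,
     zero = (\<lambda>_. 0), add = (\<lambda>f g x. f x + g x), module.smult = (\<lambda>c f x. c * f x)\<rparr>"

definition delta :: "'x \<Rightarrow> 'x \<Rightarrow> complex" where
  "delta x = (\<lambda>y. if y = x then 1 else 0)"

definition multilinear_rels :: "(complex, 'v, 'm) module_scheme \<Rightarrow> nat \<Rightarrow> ('v list \<Rightarrow> complex) set" where
  "multilinear_rels V n =
     {delta (us @ (v \<oplus>\<^bsub>V\<^esub> w) # vs) \<ominus>\<^bsub>F\<^esub> (delta (us @ v # vs) \<oplus>\<^bsub>F\<^esub> delta (us @ w # vs)) | F us v w vs.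
        F = free_space (tuples V n) \<and> us @ v # vs \<in> tuples V n \<and> us @ w # vs \<in> tuples V n} \<union>
     {delta (us @ (c \<odot>\<^bsub>V\<^esub> v) # vs) \<ominus>\<^bsub>F\<^esub> c \<odot>\<^bsub>F\<^esub> delta (us @ v # vs) | F us c v vs.
        F = free_space (tuples V n) \<and> us @ v # vs \<in> tuples V n}"

text \<open>
  \<open>tensor_power\<close> is taken over the complex numbers; \<open>pure V n [v\<^sub>1, \<dots>, v\<^sub>n]\<close> is the elementary
  tensor \<open>v\<^sub>1 \<otimes> \<dots> \<otimes> v\<^sub>n\<close>.
\<close>

definition tensor_null :: "(complex, 'v, 'm) module_scheme \<Rightarrow> nat \<Rightarrow> ('v list \<Rightarrow> complex) set" where
  "tensor_null V n = lin_span (free_space (tuples V n)) (multilinear_rels V n)"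

definition tensor_power ::
    "(complex, 'v, 'm) module_scheme \<Rightarrow> nat \<Rightarrow> (complex, ('v list \<Rightarrow> complex) set) module" where
  "tensor_power V n = quot (free_space (tuples V n)) (tensor_null V n)"

definition pure :: "(complex, 'v, 'm) module_scheme \<Rightarrow> nat \<Rightarrow> 'v list \<Rightarrow> ('v list \<Rightarrow> complex) set" where
  "pure V n vs = tensor_null V n +>\<^bsub>free_space (tuples V n)\<^esub> delta vs"

text \<open>
  The acting algebra \<open>B\<close> of a bimodule is not part of the record: the actions are only
  meaningful for scalars in \<open>B\<close>.
\<close>

record ('v, 'b) bimodule = "(complex, 'v) module" +
  lact :: "'b \<Rightarrow> 'v \<Rightarrow> 'v"
  ract :: "'v \<Rightarrow> 'b \<Rightarrow> 'v"

text \<open>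
  The \<open>n\<close>-fold tensor power over \<open>B\<close> of a \<open>B\<close>-bimodule: besides multilinearity one imposes
  \<open>\<dots> \<otimes> v\<cdot>b \<otimes> w \<otimes> \<dots> = \<dots> \<otimes> v \<otimes> b\<cdot>w \<otimes> \<dots>\<close>.
\<close>

definition balanced_rels ::
    "'b set \<Rightarrow> ('v, 'b, 'm) bimodule_scheme \<Rightarrow> nat \<Rightarrow> ('v list \<Rightarrow> complex) set" where
  "balanced_rels B V n =
     {delta (us @ ract V v b # w # vs) \<ominus>\<^bsub>F\<^esub> delta (us @ v # lact V b w # vs) | F us v b w vs.
        F = free_space (tuples V n) \<and> b \<in> B \<and> us @ v # w # vs \<in> tuples V n}"

definition btensor_null ::
    "'b set \<Rightarrow> ('v, 'b, 'm) bimodule_scheme \<Rightarrow> nat \<Rightarrow> ('v list \<Rightarrow> complex) set" where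
  "btensor_null B V n =
     lin_span (free_space (tuples V n)) (multilinear_rels V n \<union> balanced_rels B V n)"

definition bpure ::
    "'b set \<Rightarrow> ('v, 'b, 'm) bimodule_scheme \<Rightarrow> nat \<Rightarrow> 'v list \<Rightarrow> ('v list \<Rightarrow> complex) set" where
  "bpure B V n vs = btensor_null B V n +>\<^bsub>free_space (tuples V n)\<^esub> delta vs"

text \<open>\<open>B\<close> acts from the left on the first and from the right on the last tensor factor (\<open>n \<ge> 1\<close>).\<close>

definition btensor_power ::
    "'b set \<Rightarrow> ('v, 'b, 'm) bimodule_scheme \<Rightarrow> nat \<Rightarrow> (('v list \<Rightarrow> complex) set, 'b) bimodule" where
  "btensor_power B V n =
     (let T = quot (free_space (tuples V n)) (btensor_null B V n) in
      module.extend T (bimodule.fields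
        (\<lambda>b. lin_ext T T (tuples V n) (bpure B V n)
               (\<lambda>vs. bpure B V n (lact V b (hd vs) # tl vs)))
        (\<lambda>\<omega> b. lin_ext T T (tuples V n) (bpure B V n)
               (\<lambda>vs. bpure B V n (butlast vs @ [ract V (last vs) b])) \<omega>)))"


section \<open>The twisted Hochschild boundary and the twisted cyclic operator\<close>

text \<open>\<open>hochschild A \<sigma> n\<close> maps the \<open>(n+1)\<close>-fold to the \<open>n\<close>-fold tensor power of \<open>A\<close>, for \<open>n \<ge> 1\<close>.\<close>

definition hochschild :: "(complex, 'a, 'm) module_scheme \<Rightarrow> ('a \<Rightarrow> 'a) \<Rightarrow> nat
    \<Rightarrow> ('a list \<Rightarrow> complex) set \<Rightarrow> ('a list \<Rightarrow> complex) set" where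
  "hochschild A \<sigma> n =
     lin_ext (tensor_power A (n + 1)) (tensor_power A n) (tuples A (n + 1)) (pure A (n + 1))
       (\<lambda>as. (\<Oplus>\<^bsub>tensor_power A n\<^esub> i\<in>{..<n}. (-1) ^ i \<odot>\<^bsub>tensor_power A n\<^esub>
                pure A n (take i as @ (as ! i \<otimes>\<^bsub>A\<^esub> as ! (i + 1)) # drop (i + 2) as))
             \<oplus>\<^bsub>tensor_power A n\<^esub> (-1) ^ n \<odot>\<^bsub>tensor_power A n\<^esub>
                pure A n ((\<sigma> (last as) \<otimes>\<^bsub>A\<^esub> hd as) # butlast (tl as)))"

definition cyclic_op :: "(complex, 'a, 'm) module_scheme \<Rightarrow> ('a \<Rightarrow> 'a) \<Rightarrow> nat
    \<Rightarrow> ('a list \<Rightarrow> complex) set \<Rightarrow> ('a list \<Rightarrow> complex) set" where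
  "cyclic_op A \<sigma> n =
     lin_ext (tensor_power A (n + 1)) (tensor_power A (n + 1)) (tuples A (n + 1)) (pure A (n + 1))
       (\<lambda>as. (-1) ^ n \<odot>\<^bsub>tensor_power A (n + 1)\<^esub> pure A (n + 1) (\<sigma> (last as) # butlast as))"


section \<open>Reduced twisted cyclic chains\<close>

definition quot_bimodule :: "(complex, 'a, 'm) module_scheme \<Rightarrow> 'a set \<Rightarrow> ('a set, 'a) bimodule" where
  "quot_bimodule A B =
     module.extend (quot A B) (bimodule.fields
       (\<lambda>b. lin_ext (quot A B) (quot A B) (carrier A) (\<lambda>a. B +>\<^bsub>A\<^esub> a) (\<lambda>a. B +>\<^bsub>A\<^esub> (b \<otimes>\<^bsub>A\<^esub> a)))
       (\<lambda>x b. lin_ext (quot A B) (quot A B) (carrier A) (\<lambda>a. B +>\<^bsub>A\<^esub> a) (\<lambda>a. B +>\<^bsub>A\<^esub> (a \<otimes>\<^bsub>A\<^esub> b)) x))"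

definition reduced_tensors :: "(complex, 'a, 'm) module_scheme \<Rightarrow> 'a set \<Rightarrow> nat
    \<Rightarrow> (('a set list \<Rightarrow> complex) set, 'a) bimodule" where
  "reduced_tensors A B n = btensor_power B (quot_bimodule A B) (n + 1)"

definition twisted_commutators :: "(complex, 'a, 'm) module_scheme \<Rightarrow> 'a set \<Rightarrow> ('a \<Rightarrow> 'a) \<Rightarrow> nat
    \<Rightarrow> ('a set list \<Rightarrow> complex) set set" where
  "twisted_commutators A B \<sigma> n = lin_span (reduced_tensors A B n)
     {ract (reduced_tensors A B n) \<omega> b \<ominus>\<^bsub>reduced_tensors A B n\<^esub> lact (reduced_tensors A B n) (\<sigma> b) \<omega>
      | \<omega> b. \<omega> \<in> carrier (reduced_tensors A B n) \<and> b \<in> B}"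

text \<open>The space \<open>C\<^sub>n(A/B)\<close>, with the projection from the \<open>(n+1)\<close>-fold tensor power of \<open>A\<close>.\<close>

definition reduced_chains :: "(complex, 'a, 'm) module_scheme \<Rightarrow> 'a set \<Rightarrow> ('a \<Rightarrow> 'a) \<Rightarrow> nat
    \<Rightarrow> (complex, ('a set list \<Rightarrow> complex) set set) module" where
  "reduced_chains A B \<sigma> n = quot (reduced_tensors A B n) (twisted_commutators A B \<sigma> n)"

definition reduced_proj :: "(complex, 'a, 'm) module_scheme \<Rightarrow> 'a set \<Rightarrow> ('a \<Rightarrow> 'a) \<Rightarrow> nat
    \<Rightarrow> ('a list \<Rightarrow> complex) set \<Rightarrow> ('a set list \<Rightarrow> complex) set set" where
  "reduced_proj A B \<sigma> n =
     lin_ext (tensor_power A (n + 1)) (reduced_chains A B \<sigma> n) (tuples A (n + 1)) (pure A (n + 1))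
       (\<lambda>as. twisted_commutators A B \<sigma> n +>\<^bsub>reduced_tensors A B n\<^esub>
               bpure B (quot_bimodule A B) (n + 1) (map (\<lambda>a. B +>\<^bsub>A\<^esub> a) as))"

definition reduced_cyclic_op :: "(complex, 'a, 'm) module_scheme \<Rightarrow> 'a set \<Rightarrow> ('a \<Rightarrow> 'a) \<Rightarrow> nat
    \<Rightarrow> ('a set list \<Rightarrow> complex) set set \<Rightarrow> ('a set list \<Rightarrow> complex) set set" where
  "reduced_cyclic_op A B \<sigma> n =
     lin_ext (reduced_chains A B \<sigma> n) (reduced_chains A B \<sigma> n) (carrier (tensor_power A (n + 1)))
       (reduced_proj A B \<sigma> n) (\<lambda>\<omega>. reduced_proj A B \<sigma> n (cyclic_op A \<sigma> n \<omega>))"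

definition cyclic_coboundaries :: "(complex, 'a, 'm) module_scheme \<Rightarrow> 'a set \<Rightarrow> ('a \<Rightarrow> 'a) \<Rightarrow> nat
    \<Rightarrow> ('a set list \<Rightarrow> complex) set set set" where
  "cyclic_coboundaries A B \<sigma> n =
     (\<lambda>x. x \<ominus>\<^bsub>reduced_chains A B \<sigma> n\<^esub> reduced_cyclic_op A B \<sigma> n x) ` carrier (reduced_chains A B \<sigma> n)"

text \<open>The space of reduced twisted cyclic chains, with the projection from the tensor power of \<open>A\<close>.\<close>

definition cyclic_chains :: "(complex, 'a, 'm) module_scheme \<Rightarrow> 'a set \<Rightarrow> ('a \<Rightarrow> 'a) \<Rightarrow> nat
    \<Rightarrow> (complex, ('a set list \<Rightarrow> complex) set set set) module" where
  "cyclic_chains A B \<sigma> n = quot (reduced_chains A B \<sigma> n) (cyclic_coboundaries A B \<sigma> n)"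

definition cyclic_proj :: "(complex, 'a, 'm) module_scheme \<Rightarrow> 'a set \<Rightarrow> ('a \<Rightarrow> 'a) \<Rightarrow> nat
    \<Rightarrow> ('a list \<Rightarrow> complex) set \<Rightarrow> ('a set list \<Rightarrow> complex) set set set" where
  "cyclic_proj A B \<sigma> n \<omega> =
     cyclic_coboundaries A B \<sigma> n +>\<^bsub>reduced_chains A B \<sigma> n\<^esub> reduced_proj A B \<sigma> n \<omega>"

definition cyclic_boundary :: "(complex, 'a, 'm) module_scheme \<Rightarrow> 'a set \<Rightarrow> ('a \<Rightarrow> 'a) \<Rightarrow> nat
    \<Rightarrow> ('a set list \<Rightarrow> complex) set set set \<Rightarrow> ('a set list \<Rightarrow> complex) set set set" where
  "cyclic_boundary A B \<sigma> n =
     lin_ext (cyclic_chains A B \<sigma> n) (cyclic_chains A B \<sigma> (n - 1)) (carrier (tensor_power A (n + 1)))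
       (cyclic_proj A B \<sigma> n) (\<lambda>\<omega>. cyclic_proj A B \<sigma> (n - 1) (hochschild A \<sigma> n \<omega>))"

definition chain_complex :: "(nat \<Rightarrow> (complex, 'v, 'm) module_scheme) \<Rightarrow> (nat \<Rightarrow> 'v \<Rightarrow> 'v) \<Rightarrow> bool" where
  "chain_complex Y d \<longleftrightarrow>
     (\<forall>n. module CC (Y n)) \<and>
     (\<forall>n\<ge>1. d n \<in> lin (Y n) (Y (n - 1))) \<and>
     (\<forall>n\<ge>1. \<forall>x\<in>carrier (Y (n + 1)). d n (d (n + 1) x) = \<zero>\<^bsub>Y (n - 1)\<^esub>)"

end

(*
  Dualise: a linear map out of a space of reduced (cyclic) chains is a multilinear map phi on tuples
  of elements of A that vanishes on tuples with an entry in B and respects the defining relations.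
  So it suffices to show that the coboundary (cobd phi)(a) = sum_i (-1)^i phi(d_i a) inherits these
  properties from phi. Cyclic invariance of cobd phi is the usual computation with the faces. Given it,
  one can rotate the entry in B to the last position, where only two faces survive and cancel by
  the twisted commutator relation. That relation for cobd phi comes from cobd (cobd phi) = 0 evaluated
  at a tuple with an element of B appended, and rotating it gives the B-balancedness.
*)
theory Submission
  imports Defs
begin

section \<open>Complex vector spaces\<close>

text \<open>A single face does not pass to the quotient by \<open>B\<close>: changing an entry by b
  in \<open>B\<close> changes its product with the next entry a by b a, which need not lie in
  \<open>B\<close>. The contributions of b have to cancel between neighbouring faces, so the
  boundary can only be treated as a whole. The maps \<phi> are not scalar functionals. They take
  values in an arbitrary space W, and the theorem is the case where W is the space of reduced cyclic
  (n-1)-chains and \<phi> sends a tuple to its class. Its coboundary then satisfies all relations of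
  degree n, hence factors through the n-chains, and the factor is the descended boundary. Since
  \<open>lin_ext\<close> is a definite description, no operator in the definitions can be computed
  with until it is matched with a map known to exist. Hence the recurring pattern: each stage of the
  construction of the chains gets a canonical map from tuples, a proof that its values span, and a
  universal property. Existence comes from the property, uniqueness from the spanning.\<close>

lemma CC_simps [simp]:
  "carrier CC = UNIV" "x \<otimes>\<^bsub>CC\<^esub> y = x * y" "x \<oplus>\<^bsub>CC\<^esub> y = x + y"
  "\<one>\<^bsub>CC\<^esub> = 1" "\<zero>\<^bsub>CC\<^esub> = 0"
  by (simp_all add: ring_of_type_algebra_def)

text \<open>Over \<open>CC\<close> every scalar lies in the carrier and the ring operations are
  those of the type, so the module laws can be restated without side conditions on scalars.\<close>

locale vspace = module CC V for V (structure)
begin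

lemma smult_mem [simp, intro]: "x \<in> carrier V \<Longrightarrow> c \<odot> x \<in> carrier V"
  using smult_closed by simp

lemma smult_add_left: "x \<in> carrier V \<Longrightarrow> (c + d) \<odot> x = c \<odot> x \<oplus> d \<odot> x"
  using smult_l_distr[of c d x] by simp

lemma smult_add_right:
  "x \<in> carrier V \<Longrightarrow> y \<in> carrier V \<Longrightarrow> c \<odot> (x \<oplus> y) = c \<odot> x \<oplus> c \<odot> y"
  using smult_r_distr[of c x y] by simp

lemma smult_smult: "x \<in> carrier V \<Longrightarrow> c \<odot> (d \<odot> x) = (c * d) \<odot> x"
  using smult_assoc1[of c d x] by simp

lemma one_smult [simp]: "x \<in> carrier V \<Longrightarrow> 1 \<odot> x = x"
  using smult_one by simp

lemma zero_smult [simp]: "x \<in> carrier V \<Longrightarrow> 0 \<odot> x = \<zero>"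
  using smult_l_null by simp

lemma smult_zero [simp]: "c \<odot> \<zero> = \<zero>"
  using smult_r_null by simp

lemma neg_eq_smult: "x \<in> carrier V \<Longrightarrow> \<ominus> x = (-1) \<odot> x"
  using smult_add_left[of x "-1" 1] by (simp add: M.minus_equality)

lemma minus_eq_smult: "x \<in> carrier V \<Longrightarrow> y \<in> carrier V \<Longrightarrow> x \<ominus> y = x \<oplus> (-1) \<odot> y"
  by (simp add: a_minus_def neg_eq_smult)

lemma minus_self: "x \<in> carrier V \<Longrightarrow> x \<ominus> x = \<zero>"
  by (simp add: a_minus_def M.r_neg)

lemma minus_eq_zero_iff:
  assumes "x \<in> carrier V" "y \<in> carrier V"
  shows "x \<ominus> y = \<zero> \<longleftrightarrow> x = y"
  using assms by (metis M.add.inv_closed M.minus_equality M.minus_minus a_minus_def minus_self)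

lemma finsum_smult:
  "finite I \<Longrightarrow> f \<in> I \<rightarrow> carrier V \<Longrightarrow> c \<odot> (\<Oplus>i\<in>I. f i) = (\<Oplus>i\<in>I. c \<odot> f i)"
  using finsum_smult_ldistr[of I c f] by simp

lemma submoduleI':
  assumes "H \<subseteq> carrier V" "\<zero> \<in> H" "\<And>x y. x \<in> H \<Longrightarrow> y \<in> H \<Longrightarrow> x \<oplus> y \<in> H"
    "\<And>c x. x \<in> H \<Longrightarrow> c \<odot> x \<in> H"
  shows "submodule H CC V"
  using assms by (intro submoduleI) (auto simp: neg_eq_smult subset_iff)

end

lemma vspace_iff: "vspace V \<longleftrightarrow> module CC V"
  by (simp add: vspace_def)

text \<open>Additive inverses are not assumed: \<open>(-1) \<odot> x\<close> is one, by
  distributivity together with the laws for the scalars 1 and 0. What remains to check are closure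
  and identities, which suits cosets and functions.\<close>

lemma vspaceI:
  fixes V (structure)
  assumes "\<And>x y. x \<in> carrier V \<Longrightarrow> y \<in> carrier V \<Longrightarrow> x \<oplus> y \<in> carrier V"
    and "\<zero> \<in> carrier V"
    and "\<And>c x. x \<in> carrier V \<Longrightarrow> c \<odot> x \<in> carrier V"
    and "\<And>x y z. x \<in> carrier V \<Longrightarrow> y \<in> carrier V \<Longrightarrow> z \<in> carrier V \<Longrightarrow>
      (x \<oplus> y) \<oplus> z = x \<oplus> (y \<oplus> z)"
    and "\<And>x y. x \<in> carrier V \<Longrightarrow> y \<in> carrier V \<Longrightarrow> x \<oplus> y = y \<oplus> x"
    and "\<And>x. x \<in> carrier V \<Longrightarrow> \<zero> \<oplus> x = x"
    and "\<And>c d x. x \<in> carrier V \<Longrightarrow> (c + d) \<odot> x = c \<odot> x \<oplus> d \<odot> x"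
    and "\<And>c x y. x \<in> carrier V \<Longrightarrow> y \<in> carrier V \<Longrightarrow> c \<odot> (x \<oplus> y) = c \<odot> x \<oplus> c \<odot> y"
    and "\<And>c d x. x \<in> carrier V \<Longrightarrow> (c * d) \<odot> x = c \<odot> (d \<odot> x)"
    and "\<And>x. x \<in> carrier V \<Longrightarrow> 1 \<odot> x = x"
    and "\<And>x. x \<in> carrier V \<Longrightarrow> 0 \<odot> x = \<zero>"
  shows "vspace V"
  unfolding vspace_iff
proof (rule moduleI)
  show "cring CC" by (rule cring_from_type_algebra)
  show "abelian_group V"
  proof (rule abelian_groupI)
    fix x assume x: "x \<in> carrier V"
    have "(-1) \<odot> x \<oplus> x = \<zero>"
      using assms(7)[OF x, of "-1" 1] assms(10,11)[OF x] by simp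
    with x show "\<exists>y\<in>carrier V. y \<oplus> x = \<zero>" using assms(3) by blast
  qed (use assms in auto)
qed (use assms in auto)

text \<open>The bimodule records extend a quotient by two actions; this carries the vector space
  structure over to them.\<close>

lemma vspace_cong:
  assumes "vspace V" "carrier W = carrier V" "add W = add V" "zero W = zero V"
    "module.smult W = module.smult V"
  shows "vspace W"
proof -
  interpret vspace V by fact
  show ?thesis
    by (rule vspaceI) (simp_all add: assms(2-5) M.a_ac smult_add_left smult_add_right smult_smult)
qed


subsection \<open>Linear maps\<close>

lemma lin_closed: "h \<in> lin V W \<Longrightarrow> x \<in> carrier V \<Longrightarrow> h x \<in> carrier W"
  by (auto simp: lin_def)

lemma lin_add: "h \<in> lin V W \<Longrightarrow> x \<in> carrier V \<Longrightarrow> y \<in> carrier V \<Longrightarrow> h (x \<oplus>\<^bsub>V\<^esub> y) = h x \<oplus>\<^bsub>W\<^esub> h y"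
  by (auto simp: lin_def)

lemma lin_smult: "h \<in> lin V W \<Longrightarrow> x \<in> carrier V \<Longrightarrow> h (c \<odot>\<^bsub>V\<^esub> x) = c \<odot>\<^bsub>W\<^esub> h x"
  by (auto simp: lin_def)

text \<open>Members of \<open>lin\<close> are extensional, so a map given by a formula is cut off
  outside the carrier. Maps that agree on the carrier are then equal as functions, on which the
  uniqueness in \<open>lin_ext\<close> rests.\<close>

lemma lin_restrictI:
  assumes "\<And>x. x \<in> carrier V \<Longrightarrow> h x \<in> carrier W"
    "\<And>x y. x \<in> carrier V \<Longrightarrow> y \<in> carrier V \<Longrightarrow> h (x \<oplus>\<^bsub>V\<^esub> y) = h x \<oplus>\<^bsub>W\<^esub> h y"
    "\<And>c x. x \<in> carrier V \<Longrightarrow> h (c \<odot>\<^bsub>V\<^esub> x) = c \<odot>\<^bsub>W\<^esub> h x"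
    "vspace V"
  shows "restrict h (carrier V) \<in> lin V W"
proof -
  interpret vspace V by fact
  show ?thesis using assms by (auto simp: lin_def)
qed

lemma lin_compose:
  assumes "h \<in> lin U V" "k \<in> lin V W" "vspace U"
  shows "compose (carrier U) k h \<in> lin U W"
  unfolding compose_def
  by (rule lin_restrictI) (use assms in \<open>auto simp: lin_add lin_smult lin_closed\<close>)

lemma lin_zero:
  assumes "h \<in> lin V W" "vspace V" "vspace W"
  shows "h \<zero>\<^bsub>V\<^esub> = \<zero>\<^bsub>W\<^esub>"
proof -
  interpret V: vspace V by fact
  interpret W: vspace W by fact
  show ?thesis
    using lin_smult[OF assms(1), of "\<zero>\<^bsub>V\<^esub>" 0] lin_closed[OF assms(1), of "\<zero>\<^bsub>V\<^esub>"] by simp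
qed

lemma lin_minus:
  assumes "h \<in> lin V W" "vspace V" "vspace W" "x \<in> carrier V" "y \<in> carrier V"
  shows "h (x \<ominus>\<^bsub>V\<^esub> y) = h x \<ominus>\<^bsub>W\<^esub> h y"
proof -
  interpret V: vspace V by fact
  interpret W: vspace W by fact
  show ?thesis
    using assms by (simp add: V.minus_eq_smult W.minus_eq_smult lin_add lin_smult lin_closed)
qed

lemma lin_finsum:
  assumes "h \<in> lin V W" "vspace V" "vspace W" "finite I" "f \<in> I \<rightarrow> carrier V"
  shows "h (finsum V f I) = finsum W (\<lambda>i. h (f i)) I"
proof -
  interpret V: vspace V by fact
  interpret W: vspace W by fact
  show ?thesis
    using assms(4,5)
  proof (induct I)
    case (insert i I)
    have "(\<lambda>i. h (f i)) \<in> I \<rightarrow> carrier W" "h (f i) \<in> carrier W"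
      using insert.prems lin_closed[OF assms(1)] by auto
    with insert show ?case by (simp add: Pi_iff lin_add[OF assms(1)])
  qed (simp add: lin_zero[OF assms(1-3)])
qed

lemma lin_eqI:
  "h \<in> lin V W \<Longrightarrow> k \<in> lin V W \<Longrightarrow> (\<And>x. x \<in> carrier V \<Longrightarrow> h x = k x) \<Longrightarrow> h = k"
  by (rule extensionalityI[of _ "carrier V"]) (auto simp: lin_def PiE_def)


subsection \<open>Spans\<close>

lemma lin_span_superset: "S \<subseteq> lin_span V S"
  by (auto simp: lin_span_def)

lemma lin_span_least: "submodule W CC V \<Longrightarrow> S \<subseteq> W \<Longrightarrow> lin_span V S \<subseteq> W"
  by (auto simp: lin_span_def)

lemma (in vspace) lin_span_subset: "S \<subseteq> carrier V \<Longrightarrow> lin_span V S \<subseteq> carrier V"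
  using lin_span_least[OF carrier_is_submodule] .

lemma (in vspace) lin_span_submodule:
  assumes "S \<subseteq> carrier V"
  shows "submodule (lin_span V S) CC V"
proof (rule submoduleI')
  show "lin_span V S \<subseteq> carrier V" by (rule lin_span_subset[OF assms])
  show "\<zero> \<in> lin_span V S"
    by (auto simp: lin_span_def submodule_def dest: subgroup.one_closed)
  show "x \<oplus> y \<in> lin_span V S" if "x \<in> lin_span V S" "y \<in> lin_span V S" for x y
    using that submoduleE(5) by (auto simp: lin_span_def)
  show "c \<odot> x \<in> lin_span V S" if "x \<in> lin_span V S" for c x
    using that submodule.smult_closed[where R=CC] by (fastforce simp: lin_span_def)
qed

definition spans :: "(complex, 'v, 'm) module_scheme \<Rightarrow> 'v set \<Rightarrow> bool" where
  "spans V S \<longleftrightarrow> S \<subseteq> carrier V \<and> carrier V \<subseteq> lin_span V S"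

lemma equalizer_submodule:
  assumes "h \<in> lin V W" "k \<in> lin V W" "vspace V" "vspace W"
  shows "submodule {x \<in> carrier V. h x = k x} CC V"
proof -
  interpret V: vspace V by fact
  show ?thesis
    by (rule V.submoduleI')
      (use assms in \<open>auto simp: lin_zero[OF _ assms(3,4)] lin_add lin_smult\<close>)
qed

lemma lin_eq_on_span:
  assumes "h \<in> lin V W" "k \<in> lin V W" "vspace V" "vspace W" "S \<subseteq> carrier V"
    "\<And>x. x \<in> S \<Longrightarrow> h x = k x" "x \<in> lin_span V S"
  shows "h x = k x"
  using lin_span_least[OF equalizer_submodule[OF assms(1-4)], of S] assms(5-) by blast

lemma lin_vanish_on_span:
  assumes "h \<in> lin V W" "vspace V" "vspace W" "S \<subseteq> carrier V"
    "\<And>x. x \<in> S \<Longrightarrow> h x = \<zero>\<^bsub>W\<^esub>" "x \<in> lin_span V S"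
  shows "h x = \<zero>\<^bsub>W\<^esub>"
proof -
  interpret V: vspace V by fact
  interpret W: vspace W by fact
  have "(\<lambda>x\<in>carrier V. \<zero>\<^bsub>W\<^esub>) \<in> lin V W" by (rule lin_restrictI) (use assms in auto)
  from lin_eq_on_span[OF assms(1) this assms(2-4) _ assms(6)] assms(4-) V.lin_span_subset
  show ?thesis by (auto simp: subset_iff)
qed

lemma lin_eq_spans:
  assumes "h \<in> lin V W" "k \<in> lin V W" "vspace V" "vspace W" "spans V S"
    "\<And>x. x \<in> S \<Longrightarrow> h x = k x"
  shows "h = k"
  by (rule lin_eqI[OF assms(1,2)], rule lin_eq_on_span[OF assms(1-4), of S])
    (use assms(5,6) in \<open>auto simp: spans_def\<close>)

text \<open>The vectors that \<open>h\<close> sends into the span of the image of \<open>S\<close>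
  form a submodule containing \<open>S\<close>, hence are all of \<open>V\<close>.\<close>

lemma spans_image:
  assumes "h \<in> lin V W" "vspace V" "vspace W" "spans V S" "carrier W \<subseteq> h ` carrier V"
  shows "spans W (h ` S)"
  unfolding spans_def
proof
  interpret V: vspace V by fact
  interpret W: vspace W by fact
  show sub: "h ` S \<subseteq> carrier W" using assms(1,4) by (auto simp: spans_def intro: lin_closed)
  note span = W.lin_span_submodule[OF sub]
  have "submodule {x \<in> carrier V. h x \<in> lin_span W (h ` S)} CC V"
  proof (rule V.submoduleI')
    show "\<zero>\<^bsub>V\<^esub> \<in> {x \<in> carrier V. h x \<in> lin_span W (h ` S)}"
      using span by (simp add: lin_zero[OF assms(1-3)] submodule_def subgroup.one_closed[of _ "add_monoid W", simplified])
  qed (use W.submoduleE(4,5)[OF span] assms(1) in \<open>auto simp: lin_add lin_smult\<close>)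
  moreover have "S \<subseteq> {x \<in> carrier V. h x \<in> lin_span W (h ` S)}"
    using assms(4) lin_span_superset[of "h ` S" W] by (auto simp: spans_def)
  ultimately have "carrier V \<subseteq> {x \<in> carrier V. h x \<in> lin_span W (h ` S)}"
    using lin_span_least[of _ V S] assms(4) unfolding spans_def by blast
  with assms(5) show "carrier W \<subseteq> lin_span W (h ` S)" by blast
qed

lemma (in vspace) submodule_iff:
  "submodule H CC V \<longleftrightarrow> H \<subseteq> carrier V \<and> \<zero> \<in> H \<and> (\<forall>x\<in>H. \<forall>y\<in>H. x \<oplus> y \<in> H) \<and>
     (\<forall>c. \<forall>x\<in>H. c \<odot> x \<in> H)"
  using submoduleI'[of H] submoduleE[of H] subgroup.one_closed[OF submodule.axioms(1), of H CC V]
  by auto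

text \<open>Spans, and in the next lemma linear maps, see only the vector space fields. Facts proved
  for a bare quotient thus hold for the bimodule record built on it.\<close>

lemma lin_span_cong:
  assumes "vspace V" "vspace W" "carrier W = carrier V" "add W = add V" "zero W = zero V"
    "module.smult W = module.smult V"
  shows "lin_span W S = lin_span V S"
  unfolding lin_span_def vspace.submodule_iff[OF assms(1)] vspace.submodule_iff[OF assms(2)] assms(3-)
  by (rule refl)

lemma lin_cong:
  assumes "carrier V' = carrier V" "add V' = add V" "module.smult V' = module.smult V"
    "carrier W' = carrier W" "add W' = add W" "module.smult W' = module.smult W"
  shows "lin V' W' = lin V W"
  unfolding lin_def assms by (rule refl)

lemma spans_mono: "spans V S \<Longrightarrow> S \<subseteq> S' \<Longrightarrow> S' \<subseteq> carrier V \<Longrightarrow> spans V S'"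
  unfolding spans_def lin_span_def by blast

lemma spans_carrier: "spans V (carrier V)"
  by (simp add: spans_def lin_span_superset)

lemma lin_image_submodule:
  assumes "h \<in> lin V W" "vspace V" "vspace W"
  shows "submodule (h ` carrier V) CC W"
proof -
  interpret V: vspace V by fact
  interpret W: vspace W by fact
  show ?thesis
    unfolding W.submodule_iff
  proof (intro conjI ballI allI)
    show "h ` carrier V \<subseteq> carrier W" by (auto intro: lin_closed[OF assms(1)])
    show "\<zero>\<^bsub>W\<^esub> \<in> h ` carrier V" using lin_zero[OF assms] by (metis V.M.zero_closed imageI)
    fix x assume x: "x \<in> h ` carrier V"
    show "x \<oplus>\<^bsub>W\<^esub> y \<in> h ` carrier V" if "y \<in> h ` carrier V" for y
      using x that by (auto simp: lin_add[OF assms(1), symmetric])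
    show "c \<odot>\<^bsub>W\<^esub> x \<in> h ` carrier V" for c
      using x by (auto simp: lin_smult[OF assms(1), symmetric])
  qed
qed

text \<open>The only access to the description inside \<open>lin_ext\<close>: a map with the
  prescribed values has to be supplied, and spanning makes it the only one.\<close>

lemma lin_ext_eqI:
  assumes "h \<in> lin V W" "\<And>i. i \<in> I \<Longrightarrow> h (f i) = g i" "vspace V" "vspace W" "spans V (f ` I)"
  shows "lin_ext V W I f g = h"
  unfolding lin_ext_def
proof (rule the_equality)
  fix k assume k: "k \<in> lin V W \<and> (\<forall>i\<in>I. k (f i) = g i)"
  show "k = h"
    by (rule lin_eq_spans[OF _ assms(1,3-5)]) (use k assms(2) in auto)
qed (use assms in auto)


subsection \<open>Quotient spaces\<close>

locale vquotient = vspace V for V (structure) +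
  fixes U
  assumes submodule: "submodule U CC V"
begin

sublocale abelian_subgroup U V
  by (rule abelian_subgroupI3)
    (use submodule in \<open>auto simp: additive_subgroup_def submodule_def M.abelian_group_axioms M.a_comm\<close>)

lemma U_smult: "x \<in> U \<Longrightarrow> c \<odot> x \<in> U"
  using submoduleE(4)[OF submodule] by simp

lemma coset_eq_iff:
  assumes "x \<in> carrier V" "y \<in> carrier V"
  shows "U +> x = U +> y \<longleftrightarrow> x \<ominus> y \<in> U"
proof -
  have "U +> x = U +> y \<longleftrightarrow> x \<in> U +> y"
    using assms a_repr_independence' a_rcos_self by metis
  then show ?thesis using a_rcos_module[of y x] assms by (simp add: a_minus_def)
qed

lemma carrier_quot: "carrier (quot V U) = (\<lambda>x. U +> x) ` carrier V"
  by (auto simp: quot_def A_RCOSETS_def' a_r_coset_def')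

lemma coset_mem: "x \<in> carrier V \<Longrightarrow> U +> x \<in> carrier (quot V U)"
  by (auto simp: carrier_quot)

lemma zero_quot: "\<zero>\<^bsub>quot V U\<^esub> = U +> \<zero>"
  using a_coset_add_zero[OF a_subset] by (simp add: quot_def)

lemma add_quot:
  "x \<in> carrier V \<Longrightarrow> y \<in> carrier V \<Longrightarrow> (U +> x) \<oplus>\<^bsub>quot V U\<^esub> (U +> y) = U +> (x \<oplus> y)"
  using a_rcos_sum by (simp add: quot_def)

lemma coset_smult_eq:
  assumes "x \<in> carrier V" "y \<in> carrier V" "U +> x = U +> y"
  shows "U +> (c \<odot> x) = U +> (c \<odot> y)"
proof -
  have "c \<odot> (x \<ominus> y) \<in> U" using assms U_smult by (simp add: coset_eq_iff)
  moreover have "c \<odot> (x \<ominus> y) = c \<odot> x \<ominus> c \<odot> y"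
    using assms by (simp add: minus_eq_smult smult_add_right smult_smult mult.commute)
  ultimately show ?thesis using assms by (simp add: coset_eq_iff)
qed

text \<open>The definition takes a union over all representatives instead of choosing one. All
  members of the union are the same coset, and the union is not empty.\<close>

lemma smult_quot:
  assumes "x \<in> carrier V"
  shows "c \<odot>\<^bsub>quot V U\<^esub> (U +> x) = U +> (c \<odot> x)"
proof -
  have "U +> (c \<odot> y) = U +> (c \<odot> x)" if "y \<in> U +> x" for y
  proof (rule coset_smult_eq[OF _ assms])
    show y: "y \<in> carrier V" using a_elemrcos_carrier[OF assms that] .
    show "U +> y = U +> x" using a_repr_independence'[OF that assms] by simp
  qed
  then have "(\<Union>y\<in>U +> x. U +> (c \<odot> y)) = (\<Union>y\<in>U +> x. U +> (c \<odot> x))"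
    by (rule SUP_cong[OF refl])
  then show ?thesis using a_rcos_self[OF assms] by (auto simp: quot_def)
qed

lemma vspace_quot: "vspace (quot V U)"
proof (rule vspaceI, unfold carrier_quot zero_quot, goal_cases)
  case (4 x y z)
  then show ?case by (elim imageE) (simp add: add_quot M.a_assoc)
next
  case (5 x y)
  then show ?case by (elim imageE) (simp add: add_quot M.a_comm)
next
  case (6 x)
  then show ?case by (elim imageE) (simp add: add_quot)
qed (auto simp: add_quot smult_quot smult_add_left smult_add_right smult_smult)

lemma proj_lin: "(\<lambda>x\<in>carrier V. U +> x) \<in> lin V (quot V U)"
  by (rule lin_restrictI) (auto simp: coset_mem add_quot smult_quot vspace_axioms)

text \<open>Universal property of the quotient. The value on a coset is \<open>h\<close> at a chosen
  representative; two representatives differ by an element of \<open>U\<close>, where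
  \<open>h\<close> vanishes.\<close>

lemma quot_lift:
  assumes h: "h \<in> lin V W" and W: "vspace W" and van: "\<And>u. u \<in> U \<Longrightarrow> h u = \<zero>\<^bsub>W\<^esub>"
  obtains k where "k \<in> lin (quot V U) W" "\<And>x. x \<in> carrier V \<Longrightarrow> k (U +> x) = h x"
proof -
  interpret W: vspace W by fact
  define k where "k = (\<lambda>T. h (SOME x. x \<in> carrier V \<and> U +> x = T))"
  have k: "k (U +> x) = h x" if x: "x \<in> carrier V" for x
  proof -
    define y where "y = (SOME y. y \<in> carrier V \<and> U +> y = U +> x)"
    have y: "y \<in> carrier V \<and> U +> y = U +> x"
      unfolding y_def by (rule someI[of _ x]) (use x in simp)
    then have "y \<ominus> x \<in> U" using x coset_eq_iff by blast
    then have "h (y \<ominus> x) = \<zero>\<^bsub>W\<^esub>" by (rule van)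
    then have "h y = h x"
      using lin_minus[OF h vspace_axioms W] y x lin_closed[OF h] by (simp add: W.minus_eq_zero_iff)
    then show ?thesis by (simp add: k_def y_def)
  qed
  have "restrict k (carrier (quot V U)) \<in> lin (quot V U) W"
    by (rule lin_restrictI)
      (auto simp: carrier_quot add_quot smult_quot k lin_add[OF h] lin_smult[OF h] lin_closed[OF h] vspace_quot)
  moreover have "restrict k (carrier (quot V U)) (U +> x) = h x" if "x \<in> carrier V" for x
    using that k coset_mem by simp
  ultimately show thesis using that by blast
qed

lemma quot_spans:
  assumes "spans V S"
  shows "spans (quot V U) ((\<lambda>x. U +> x) ` S)"
proof -
  have "(\<lambda>x\<in>carrier V. U +> x) ` S = (\<lambda>x. U +> x) ` S"
    using assms by (intro image_cong) (auto simp: spans_def)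
  then show ?thesis
    using spans_image[OF proj_lin vspace_axioms vspace_quot assms] by (simp add: carrier_quot)
qed

end

lemma vspace_submodule_vquotient: "vspace V \<Longrightarrow> submodule U CC V \<Longrightarrow> vquotient V U"
  by (simp add: vquotient_def vquotient_axioms_def)


subsection \<open>Free spaces\<close>

lemma free_space_simps [simp]:
  "f \<in> carrier (free_space Y) \<longleftrightarrow> finite {x. f x \<noteq> 0} \<and> {x. f x \<noteq> 0} \<subseteq> Y"
  "\<zero>\<^bsub>free_space Y\<^esub> = (\<lambda>_. 0)"
  "f \<oplus>\<^bsub>free_space Y\<^esub> g = (\<lambda>x. f x + g x)"
  "c \<odot>\<^bsub>free_space Y\<^esub> f = (\<lambda>x. c * f x)"
  by (simp_all add: free_space_def)

lemma vspace_free_space: "vspace (free_space Y)"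
proof (rule vspaceI)
  fix f g assume fg: "f \<in> carrier (free_space Y)" "g \<in> carrier (free_space Y)"
  have sub: "{x. f x + g x \<noteq> 0} \<subseteq> {x. f x \<noteq> 0} \<union> {x. g x \<noteq> 0}" by force
  show "f \<oplus>\<^bsub>free_space Y\<^esub> g \<in> carrier (free_space Y)"
    unfolding free_space_simps
  proof
    show "finite {x. f x + g x \<noteq> 0}" by (rule finite_subset[OF sub]) (use fg in simp)
    show "{x. f x + g x \<noteq> 0} \<subseteq> Y" by (rule subset_trans[OF sub]) (use fg in simp)
  qed
qed (auto simp add: fun_eq_iff algebra_simps)

lemma delta_support [simp]: "{x. delta y x \<noteq> 0} = {y}" "delta y x = 0 \<longleftrightarrow> x \<noteq> y"
  by (simp_all add: delta_def)

lemma delta_mem: "delta y \<in> carrier (free_space Y) \<longleftrightarrow> y \<in> Y"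
  by simp

lemma spans_free_space: "spans (free_space Y) (delta ` Y)"
proof -
  interpret F: vspace "free_space Y" by (rule vspace_free_space)
  let ?S = "lin_span (free_space Y) (delta ` Y)"
  have S: "submodule ?S CC (free_space Y)"
    by (rule F.lin_span_submodule) auto
  \<comment> \<open>The induction runs over a finite set that contains the support rather than over
    the support itself, so that \<open>f(x := 0)\<close> falls under the hypothesis even when
    \<open>f x\<close> is already 0.\<close>
  have "f \<in> ?S" if "finite T" "T \<subseteq> Y" "{x. f x \<noteq> 0} \<subseteq> T" for T and f :: "'a \<Rightarrow> complex"
    using that
  proof (induct T arbitrary: f)
    case empty
    then have "f = (\<lambda>_. 0)" by auto
    then show ?case using subgroup.one_closed[OF submodule.axioms(1)[OF S]] by simp
  next
    case (insert x T)
    have "f(x := 0) \<in> ?S" by (rule insert.hyps) (use insert.prems in auto)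
    moreover have "f x \<odot>\<^bsub>free_space Y\<^esub> delta x \<in> ?S"
      using insert.prems lin_span_superset[of "delta ` Y" "free_space Y"] F.submoduleE(4)[OF S]
      by auto
    ultimately have "f(x := 0) \<oplus>\<^bsub>free_space Y\<^esub> f x \<odot>\<^bsub>free_space Y\<^esub> delta x \<in> ?S"
      by (rule F.submoduleE(5)[OF S])
    also have "f(x := 0) \<oplus>\<^bsub>free_space Y\<^esub> f x \<odot>\<^bsub>free_space Y\<^esub> delta x = f"
      by (auto simp: delta_def)
    finally show ?case .
  qed
  then show ?thesis by (auto simp: spans_def)
qed

lemma free_space_lift:
  assumes W: "vspace W" and g: "\<And>y. y \<in> Y \<Longrightarrow> g y \<in> carrier W"
  obtains h where "h \<in> lin (free_space Y) W" "\<And>y. y \<in> Y \<Longrightarrow> h (delta y) = g y"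
proof -
  interpret W: vspace W by fact
  define h where "h f = (\<Oplus>\<^bsub>W\<^esub>x\<in>{x. f x \<noteq> 0}. f x \<odot>\<^bsub>W\<^esub> g x)" for f
  \<comment> \<open>The range of summation in \<open>h\<close> depends on the argument. Enlarging it
    to any finite set above the support lets two arguments share one range, which additivity
    requires.\<close>
  have h_eq: "h f = (\<Oplus>\<^bsub>W\<^esub>x\<in>T. f x \<odot>\<^bsub>W\<^esub> g x)"
    if "finite T" "T \<subseteq> Y" "{x. f x \<noteq> 0} \<subseteq> T" for f T
    unfolding h_def
    by (rule W.M.add.finprod_mono_neutral_cong_left) (use that g in \<open>auto simp: subset_iff\<close>)
  have lin: "restrict h (carrier (free_space Y)) \<in> lin (free_space Y) W"
  proof (rule lin_restrictI)
    fix f assume f: "f \<in> carrier (free_space Y)"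
    then show "h f \<in> carrier W" unfolding h_def using g by (auto intro!: W.finsum_closed)
    fix c
    have "h (c \<odot>\<^bsub>free_space Y\<^esub> f) = (\<Oplus>\<^bsub>W\<^esub>x\<in>{x. f x \<noteq> 0}. c \<odot>\<^bsub>W\<^esub> (f x \<odot>\<^bsub>W\<^esub> g x))"
      using f g by (subst h_eq[of "{x. f x \<noteq> 0}"])
        (auto intro!: W.finsum_cong' simp: W.smult_smult subset_iff)
    also have "\<dots> = c \<odot>\<^bsub>W\<^esub> h f"
      unfolding h_def using f g by (subst W.finsum_smult) auto
    finally show "h (c \<odot>\<^bsub>free_space Y\<^esub> f) = c \<odot>\<^bsub>W\<^esub> h f" .
  next
    fix f k assume fk: "f \<in> carrier (free_space Y)" "k \<in> carrier (free_space Y)"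
    let ?T = "{x. f x \<noteq> 0} \<union> {x. k x \<noteq> 0}"
    have T: "finite ?T" "?T \<subseteq> Y" using fk by auto
    have "h (f \<oplus>\<^bsub>free_space Y\<^esub> k) = (\<Oplus>\<^bsub>W\<^esub>x\<in>?T. (f x + k x) \<odot>\<^bsub>W\<^esub> g x)"
      using T by (subst h_eq[of ?T]) auto
    also have "\<dots> = (\<Oplus>\<^bsub>W\<^esub>x\<in>?T. f x \<odot>\<^bsub>W\<^esub> g x \<oplus>\<^bsub>W\<^esub> k x \<odot>\<^bsub>W\<^esub> g x)"
      by (rule W.finsum_cong') (use T(2) g in \<open>auto simp: W.smult_add_left subset_iff\<close>)
    also have "\<dots> = (\<Oplus>\<^bsub>W\<^esub>x\<in>?T. f x \<odot>\<^bsub>W\<^esub> g x) \<oplus>\<^bsub>W\<^esub> (\<Oplus>\<^bsub>W\<^esub>x\<in>?T. k x \<odot>\<^bsub>W\<^esub> g x)"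
      using T g by (intro W.finsum_addf) auto
    also have "\<dots> = h f \<oplus>\<^bsub>W\<^esub> h k"
      using T by (simp add: h_eq[of ?T])
    finally show "h (f \<oplus>\<^bsub>free_space Y\<^esub> k) = h f \<oplus>\<^bsub>W\<^esub> h k" .
  qed (rule vspace_free_space)
  have "restrict h (carrier (free_space Y)) (delta y) = g y" if "y \<in> Y" for y
  proof -
    have "h (delta y) = g y" using that g by (subst h_eq[of "{y}"]) (auto simp: delta_def)
    with that show ?thesis by (simp only: restrict_apply delta_mem if_True)
  qed
  then show thesis by (rule that[OF lin])
qed

lemma presented_vquotient:
  "R \<subseteq> carrier (free_space Y) \<Longrightarrow> vquotient (free_space Y) (lin_span (free_space Y) R)"
  by (simp add: vspace_submodule_vquotient vspace_free_space vspace.lin_span_submodule)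

lemma presented_spans:
  assumes "R \<subseteq> carrier (free_space Y)"
  shows "spans (quot (free_space Y) (lin_span (free_space Y) R))
    ((\<lambda>y. lin_span (free_space Y) R +>\<^bsub>free_space Y\<^esub> delta y) ` Y)"
  using vquotient.quot_spans[OF presented_vquotient[OF assms] spans_free_space]
  by (simp add: image_image)

text \<open>Universal property of a space given by generators \<open>Y\<close> and relations
  \<open>R\<close>. The hypothesis on relations speaks of every linear extension \<open>h\<close> of
  \<open>g\<close>, because the extension built inside is not visible to the caller, who knows it
  only through its values on generators.\<close>

lemma presented_lift:
  assumes R: "R \<subseteq> carrier (free_space Y)" and W: "vspace W"
    and g: "\<And>y. y \<in> Y \<Longrightarrow> g y \<in> carrier W"
    and rel: "\<And>h r. h \<in> lin (free_space Y) W \<Longrightarrow> (\<And>y. y \<in> Y \<Longrightarrow> h (delta y) = g y) \<Longrightarrow> r \<in> R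
      \<Longrightarrow> h r = \<zero>\<^bsub>W\<^esub>"
  shows "\<exists>k\<in>lin (quot (free_space Y) (lin_span (free_space Y) R)) W.
    \<forall>y\<in>Y. k (lin_span (free_space Y) R +>\<^bsub>free_space Y\<^esub> delta y) = g y"
proof -
  interpret vquotient "free_space Y" "lin_span (free_space Y) R"
    by (rule presented_vquotient[OF R])
  obtain h where h: "h \<in> lin (free_space Y) W" "\<And>y. y \<in> Y \<Longrightarrow> h (delta y) = g y"
    by (rule free_space_lift[OF W, of Y g, OF g]) auto
  have van: "h u = \<zero>\<^bsub>W\<^esub>" if "u \<in> lin_span (free_space Y) R" for u
    by (rule lin_vanish_on_span[OF h(1) vspace_axioms W R _ that], rule rel[OF h(1) h(2)]) auto
  obtain k where k: "k \<in> lin (quot (free_space Y) (lin_span (free_space Y) R)) W"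
    "\<And>x. x \<in> carrier (free_space Y) \<Longrightarrow> k (lin_span (free_space Y) R +>\<^bsub>free_space Y\<^esub> x) = h x"
    using quot_lift[OF h(1) W van] by metis
  then show ?thesis
    by (intro bexI[OF _ k(1)]) (simp add: k(2) h(2) delta_mem del: free_space_simps)
qed

section \<open>Multilinear maps and tensor powers\<close>

lemma tuples_length: "vs \<in> tuples V n \<Longrightarrow> length vs = n"
  by (simp add: tuples_def)

lemma tuples_nth: "vs \<in> tuples V n \<Longrightarrow> k < n \<Longrightarrow> vs ! k \<in> carrier V"
  by (auto simp: tuples_def)

lemma tuplesI: "length vs = n \<Longrightarrow> (\<And>k. k < n \<Longrightarrow> vs ! k \<in> carrier V) \<Longrightarrow> vs \<in> tuples V n"
  by (auto simp: tuples_def in_set_conv_nth)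

lemma tuples_update [intro]: "vs \<in> tuples V n \<Longrightarrow> x \<in> carrier V \<Longrightarrow> vs[k := x] \<in> tuples V n"
  using set_update_subset_insert[of vs k x] by (auto simp: tuples_def)

text \<open>Phrased by updating one entry, whereas \<open>multilinear_rels\<close> splits the list
  around the entry. Faces and rotations turn updates into updates; the rules on
  \<open>multilinear_rels\<close> below translate between the two forms.\<close>

definition multilinear :: "(complex, 'v, 'm) module_scheme \<Rightarrow> (complex, 'w, 'k) module_scheme \<Rightarrow> nat
    \<Rightarrow> ('v list \<Rightarrow> 'w) \<Rightarrow> bool" where
  "multilinear V W n \<phi> \<longleftrightarrow>
     (\<forall>vs\<in>tuples V n. \<phi> vs \<in> carrier W) \<and>
     (\<forall>vs\<in>tuples V n. \<forall>k<n. \<forall>x\<in>carrier V. \<forall>y\<in>carrier V.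
        \<phi> (vs[k := x \<oplus>\<^bsub>V\<^esub> y]) = \<phi> (vs[k := x]) \<oplus>\<^bsub>W\<^esub> \<phi> (vs[k := y])) \<and>
     (\<forall>vs\<in>tuples V n. \<forall>k<n. \<forall>c. \<forall>x\<in>carrier V.
        \<phi> (vs[k := c \<odot>\<^bsub>V\<^esub> x]) = c \<odot>\<^bsub>W\<^esub> \<phi> (vs[k := x]))"

lemma multilinearD:
  assumes "multilinear V W n \<phi>" "vs \<in> tuples V n"
  shows multilinear_mem: "\<phi> vs \<in> carrier W"
    and multilinear_add: "\<And>k x y. k < n \<Longrightarrow> x \<in> carrier V \<Longrightarrow> y \<in> carrier V \<Longrightarrow>
      \<phi> (vs[k := x \<oplus>\<^bsub>V\<^esub> y]) = \<phi> (vs[k := x]) \<oplus>\<^bsub>W\<^esub> \<phi> (vs[k := y])"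
    and multilinear_smult: "\<And>k c x. k < n \<Longrightarrow> x \<in> carrier V \<Longrightarrow>
      \<phi> (vs[k := c \<odot>\<^bsub>V\<^esub> x]) = c \<odot>\<^bsub>W\<^esub> \<phi> (vs[k := x])"
  using assms by (simp_all add: multilinear_def)

lemma multilinear_compose:
  assumes "multilinear V U n \<phi>" "h \<in> lin U W" "vspace V"
  shows "multilinear V W n (\<lambda>vs. h (\<phi> vs))"
proof -
  interpret V: vspace V by fact
  show ?thesis
    unfolding multilinear_def
    by (auto simp: multilinear_mem[OF assms(1)] multilinear_add[OF assms(1)] multilinear_smult[OF assms(1)]
        lin_closed[OF assms(2)] lin_add[OF assms(2)] lin_smult[OF assms(2)] tuples_update)
qed

lemma multilinear_cong:
  assumes "multilinear V W n \<phi>" "\<And>vs. vs \<in> tuples V n \<Longrightarrow> \<psi> vs = \<phi> vs" "vspace V"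
  shows "multilinear V W n \<psi>"
proof -
  interpret V: vspace V by fact
  show ?thesis using assms(1,2) unfolding multilinear_def by (simp add: tuples_update)
qed

lemma multilinear_slot:
  assumes "multilinear V W n \<phi>" "k < n" "\<And>x. x \<in> carrier V \<Longrightarrow> \<psi> x \<in> carrier V"
    "\<And>x y. x \<in> carrier V \<Longrightarrow> y \<in> carrier V \<Longrightarrow> \<psi> (x \<oplus>\<^bsub>V\<^esub> y) = \<psi> x \<oplus>\<^bsub>V\<^esub> \<psi> y"
    "\<And>c x. x \<in> carrier V \<Longrightarrow> \<psi> (c \<odot>\<^bsub>V\<^esub> x) = c \<odot>\<^bsub>V\<^esub> \<psi> x"
  shows "multilinear V W n (\<lambda>vs. \<phi> (vs[k := \<psi> (vs ! k)]))"
  unfolding multilinear_def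
proof (intro conjI ballI allI impI)
  fix vs assume vs: "vs \<in> tuples V n"
  have up: "vs[k := \<psi> (vs ! k)] \<in> tuples V n"
    using tuples_update[OF vs assms(3)[OF tuples_nth[OF vs assms(2)]]] .
  show "\<phi> (vs[k := \<psi> (vs ! k)]) \<in> carrier W"
    by (rule multilinear_mem[OF assms(1) up])
  fix l assume l: "l < n"
  \<comment> \<open>If the varied slot is \<open>k\<close> itself, the outer update overwrites the
    inner one and the variation passes through \<open>\<psi>\<close>; otherwise the two updates
    commute.\<close>
  have *: "vs[l := x, k := \<psi> (vs[l := x] ! k)] = (if l = k then vs[k := \<psi> x] else vs[k := \<psi> (vs ! k), l := x])" for x
    using tuples_length[OF vs] l by (auto simp: list_update_swap)
  fix x assume x: "x \<in> carrier V"
  { fix y assume y: "y \<in> carrier V"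
    show "\<phi> (vs[l := x \<oplus>\<^bsub>V\<^esub> y, k := \<psi> (vs[l := x \<oplus>\<^bsub>V\<^esub> y] ! k)]) =
      \<phi> (vs[l := x, k := \<psi> (vs[l := x] ! k)]) \<oplus>\<^bsub>W\<^esub> \<phi> (vs[l := y, k := \<psi> (vs[l := y] ! k)])"
      unfolding * using l x y vs up assms(2-)
      by (simp add: multilinear_add[OF assms(1)]) }
  fix c
  show "\<phi> (vs[l := c \<odot>\<^bsub>V\<^esub> x, k := \<psi> (vs[l := c \<odot>\<^bsub>V\<^esub> x] ! k)]) =
      c \<odot>\<^bsub>W\<^esub> \<phi> (vs[l := x, k := \<psi> (vs[l := x] ! k)])"
    unfolding * using l x vs up assms(2-)
    by (simp add: multilinear_smult[OF assms(1)])
qed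

lemma multilinear_zero:
  assumes "multilinear V W n \<phi>" "vspace V" "vspace W" "vs \<in> tuples V n" "k < n"
  shows "\<phi> (vs[k := \<zero>\<^bsub>V\<^esub>]) = \<zero>\<^bsub>W\<^esub>"
proof -
  interpret V: vspace V by fact
  interpret W: vspace W by fact
  have "\<phi> (vs[k := \<zero>\<^bsub>V\<^esub>]) \<in> carrier W"
    using assms(4) by (intro multilinear_mem[OF assms(1)] tuples_update) auto
  then show ?thesis
    using multilinear_smult[OF assms(1,4,5) V.M.zero_closed, of 0] by simp
qed

lemma multilinear_scale:
  assumes "multilinear V W n \<phi>" "vspace V" "vspace W"
  shows "multilinear V W n (\<lambda>vs. c \<odot>\<^bsub>W\<^esub> \<phi> vs)"
proof -
  interpret W: vspace W by fact
  have "(\<lambda>x\<in>carrier W. c \<odot>\<^bsub>W\<^esub> x) \<in> lin W W"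
    by (rule lin_restrictI) (auto simp: W.smult_add_right W.smult_smult mult.commute W.vspace_axioms)
  from multilinear_compose[OF assms(1) this assms(2)] show ?thesis
    by (rule multilinear_cong) (use multilinear_mem[OF assms(1)] assms(2) in auto)
qed

lemma multilinear_rels_cases:
  assumes "r \<in> multilinear_rels V n"
  obtains (add) vs k x y where "vs \<in> tuples V n" "k < n" "x \<in> carrier V" "y \<in> carrier V"
      "r = delta (vs[k := x \<oplus>\<^bsub>V\<^esub> y]) \<ominus>\<^bsub>free_space (tuples V n)\<^esub>
        (delta (vs[k := x]) \<oplus>\<^bsub>free_space (tuples V n)\<^esub> delta (vs[k := y]))"
  | (smult) vs k c x where "vs \<in> tuples V n" "k < n" "x \<in> carrier V"
      "r = delta (vs[k := c \<odot>\<^bsub>V\<^esub> x]) \<ominus>\<^bsub>free_space (tuples V n)\<^esub>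
        c \<odot>\<^bsub>free_space (tuples V n)\<^esub> delta (vs[k := x])"
  using assms unfolding multilinear_rels_def
proof (elim UnE CollectE exE conjE)
  fix F us v w vs
  assume "r = delta (us @ (v \<oplus>\<^bsub>V\<^esub> w) # vs) \<ominus>\<^bsub>F\<^esub> (delta (us @ v # vs) \<oplus>\<^bsub>F\<^esub> delta (us @ w # vs))"
    "F = free_space (tuples V n)" "us @ v # vs \<in> tuples V n" "us @ w # vs \<in> tuples V n"
  then show thesis
    by (intro add[of "us @ v # vs" "length us" v w]) (auto simp: tuples_def)
next
  fix F us c v vs
  assume "r = delta (us @ (c \<odot>\<^bsub>V\<^esub> v) # vs) \<ominus>\<^bsub>F\<^esub> c \<odot>\<^bsub>F\<^esub> delta (us @ v # vs)"
    "F = free_space (tuples V n)" "us @ v # vs \<in> tuples V n"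
  then show thesis
    by (intro smult[of "us @ v # vs" "length us" v c]) (auto simp: tuples_def)
qed

lemma multilinear_rels_addI:
  assumes "vs \<in> tuples V n" "k < n" "x \<in> carrier V" "y \<in> carrier V"
  shows "delta (vs[k := x \<oplus>\<^bsub>V\<^esub> y]) \<ominus>\<^bsub>free_space (tuples V n)\<^esub>
    (delta (vs[k := x]) \<oplus>\<^bsub>free_space (tuples V n)\<^esub> delta (vs[k := y])) \<in> multilinear_rels V n"
proof -
  have *: "vs[k := z] = take k vs @ z # drop (Suc k) vs" for z
    using assms by (simp add: upd_conv_take_nth_drop tuples_length)
  have "take k vs @ z # drop (Suc k) vs \<in> tuples V n" if "z \<in> carrier V" for z
    using tuples_update[OF assms(1) that, of k] by (simp add: *)
  with assms(3,4) show ?thesis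
    unfolding multilinear_rels_def *
    by (intro UnI1 CollectI exI[of _ "free_space (tuples V n)"] exI[of _ "take k vs"] exI[of _ x] exI[of _ y]
        exI[of _ "drop (Suc k) vs"]) simp
qed

lemma multilinear_rels_smultI:
  assumes "vs \<in> tuples V n" "k < n" "x \<in> carrier V"
  shows "delta (vs[k := c \<odot>\<^bsub>V\<^esub> x]) \<ominus>\<^bsub>free_space (tuples V n)\<^esub>
    c \<odot>\<^bsub>free_space (tuples V n)\<^esub> delta (vs[k := x]) \<in> multilinear_rels V n"
proof -
  have *: "vs[k := z] = take k vs @ z # drop (Suc k) vs" for z
    using assms by (simp add: upd_conv_take_nth_drop tuples_length)
  have "take k vs @ x # drop (Suc k) vs \<in> tuples V n"
    using tuples_update[OF assms(1,3), of k] by (simp add: *)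
  then show ?thesis
    unfolding multilinear_rels_def *
    by (intro UnI2 CollectI exI[of _ "free_space (tuples V n)"] exI[of _ "take k vs"] exI[of _ c] exI[of _ x]
        exI[of _ "drop (Suc k) vs"]) simp
qed

lemma multilinear_rels_subset:
  assumes "vspace V"
  shows "multilinear_rels V n \<subseteq> carrier (free_space (tuples V n))"
proof
  interpret V: vspace V by fact
  interpret F: vspace "free_space (tuples V n)" by (rule vspace_free_space)
  fix r assume "r \<in> multilinear_rels V n"
  then show "r \<in> carrier (free_space (tuples V n))"
    by (cases rule: multilinear_rels_cases)
      (auto intro!: F.minus_closed F.M.add.m_closed F.smult_mem
        simp: delta_mem tuples_update simp del: free_space_simps)
qed

lemma multilinear_rels_vanish:
  assumes V: "vspace V" and W: "vspace W" and \<phi>: "multilinear V W n \<phi>"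
    and h: "h \<in> lin (free_space (tuples V n)) W" "\<And>vs. vs \<in> tuples V n \<Longrightarrow> h (delta vs) = \<phi> vs"
    and r: "r \<in> multilinear_rels V n"
  shows "h r = \<zero>\<^bsub>W\<^esub>"
proof -
  interpret V: vspace V by fact
  interpret W: vspace W by fact
  interpret F: vspace "free_space (tuples V n)" by (rule vspace_free_space)
  note lin = lin_minus[OF h(1) F.vspace_axioms W] lin_add[OF h(1)] lin_smult[OF h(1)]
  show ?thesis using r
  proof (cases rule: multilinear_rels_cases)
    case (add vs k x y)
    then show ?thesis
      by (simp add: lin delta_mem tuples_update h(2) multilinear_add[OF \<phi>] multilinear_mem[OF \<phi>]
          W.minus_self F.M.add.m_closed del: free_space_simps)
  next
    case (smult vs k c x)
    then show ?thesis
      by (simp add: lin delta_mem tuples_update h(2) multilinear_smult[OF \<phi>] multilinear_mem[OF \<phi>]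
          W.minus_self F.smult_mem del: free_space_simps)
  qed
qed

text \<open>Stated for any set of relations containing the multilinear ones, so that it serves the
  tensor power over the complex numbers and the one over \<open>B\<close> alike.\<close>

lemma multilinear_presented:
  assumes V: "vspace V" and R: "multilinear_rels V n \<subseteq> R" "R \<subseteq> carrier (free_space (tuples V n))"
  defines "N \<equiv> lin_span (free_space (tuples V n)) R"
  shows "multilinear V (quot (free_space (tuples V n)) N) n (\<lambda>vs. N +>\<^bsub>free_space (tuples V n)\<^esub> delta vs)"
proof -
  interpret V: vspace V by fact
  interpret Q: vquotient "free_space (tuples V n)" N
    unfolding N_def by (rule presented_vquotient[OF R(2)])
  have N: "multilinear_rels V n \<subseteq> N" unfolding N_def by (rule subset_trans[OF R(1) lin_span_superset])
  show ?thesis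
    unfolding multilinear_def
  proof (intro conjI ballI allI impI)
    fix vs assume vs: "vs \<in> tuples V n"
    have mem: "delta (vs[k := z]) \<in> carrier (free_space (tuples V n))" if "z \<in> carrier V" for k z
      using vs that by (simp add: delta_mem tuples_update del: free_space_simps)
    show "N +>\<^bsub>free_space (tuples V n)\<^esub> delta vs \<in> carrier (quot (free_space (tuples V n)) N)"
      by (rule Q.coset_mem) (use vs in \<open>simp add: delta_mem del: free_space_simps\<close>)
    fix k assume k: "k < n"
    fix x assume x: "x \<in> carrier V"
    { fix y assume y: "y \<in> carrier V"
      show "N +>\<^bsub>free_space (tuples V n)\<^esub> delta (vs[k := x \<oplus>\<^bsub>V\<^esub> y]) =
        (N +>\<^bsub>free_space (tuples V n)\<^esub> delta (vs[k := x])) \<oplus>\<^bsub>quot (free_space (tuples V n)) N\<^esub>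
        (N +>\<^bsub>free_space (tuples V n)\<^esub> delta (vs[k := y]))"
        unfolding Q.add_quot[OF mem[OF x] mem[OF y]]
        by (rule Q.coset_eq_iff[THEN iffD2, OF mem Q.M.add.m_closed[OF mem[OF x] mem[OF y]]])
          (use multilinear_rels_addI[OF vs k x y] N V.M.add.m_closed[OF x y] in auto) }
    fix c
    show "N +>\<^bsub>free_space (tuples V n)\<^esub> delta (vs[k := c \<odot>\<^bsub>V\<^esub> x]) =
        c \<odot>\<^bsub>quot (free_space (tuples V n)) N\<^esub> (N +>\<^bsub>free_space (tuples V n)\<^esub> delta (vs[k := x]))"
      unfolding Q.smult_quot[OF mem[OF x]]
      by (rule Q.coset_eq_iff[THEN iffD2, OF mem Q.smult_mem[OF mem[OF x]]])
        (use multilinear_rels_smultI[OF vs k x] N V.smult_mem[OF x] in auto)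
  qed
qed

lemma vspace_tensor_power: "vspace V \<Longrightarrow> vspace (tensor_power V n)"
  unfolding tensor_power_def tensor_null_def
  by (intro vquotient.vspace_quot presented_vquotient multilinear_rels_subset)

lemma multilinear_pure: "vspace V \<Longrightarrow> multilinear V (tensor_power V n) n (pure V n)"
  unfolding tensor_power_def tensor_null_def pure_def
  by (intro multilinear_presented multilinear_rels_subset) auto

lemma spans_pure: "vspace V \<Longrightarrow> spans (tensor_power V n) (pure V n ` tuples V n)"
  unfolding tensor_power_def tensor_null_def pure_def
  by (intro presented_spans multilinear_rels_subset)

lemma tensor_power_lift:
  assumes V: "vspace V" and W: "vspace W" and \<phi>: "multilinear V W n \<phi>"
  shows "\<exists>h\<in>lin (tensor_power V n) W. \<forall>vs\<in>tuples V n. h (pure V n vs) = \<phi> vs"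
  unfolding tensor_power_def tensor_null_def pure_def
  by (rule presented_lift[OF multilinear_rels_subset[OF V] W])
    (auto intro: multilinear_mem[OF \<phi>] multilinear_rels_vanish[OF V W \<phi>])

lemma lin_ext_tensor_power:
  assumes V: "vspace V" and W: "vspace W" and \<phi>: "multilinear V W n \<phi>"
  shows "lin_ext (tensor_power V n) W (tuples V n) (pure V n) \<phi> \<in> lin (tensor_power V n) W"
    and "\<And>vs. vs \<in> tuples V n \<Longrightarrow>
      lin_ext (tensor_power V n) W (tuples V n) (pure V n) \<phi> (pure V n vs) = \<phi> vs"
proof -
  obtain h where h: "h \<in> lin (tensor_power V n) W"
    "\<And>vs. vs \<in> tuples V n \<Longrightarrow> h (pure V n vs) = \<phi> vs"
    using tensor_power_lift[OF V W \<phi>] by blast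
  have *: "lin_ext (tensor_power V n) W (tuples V n) (pure V n) \<phi> = h"
    by (rule lin_ext_eqI[OF h vspace_tensor_power[OF V] W spans_pure[OF V]])
  show "lin_ext (tensor_power V n) W (tuples V n) (pure V n) \<phi> \<in> lin (tensor_power V n) W"
    unfolding * by (rule h)
  show "lin_ext (tensor_power V n) W (tuples V n) (pure V n) \<phi> (pure V n vs) = \<phi> vs"
    if "vs \<in> tuples V n" for vs
    unfolding * by (rule h(2)[OF that])
qed


subsection \<open>Tensor powers over a subalgebra\<close>

definition balanced :: "'b set \<Rightarrow> ('v, 'b, 'm) bimodule_scheme \<Rightarrow> nat \<Rightarrow> ('v list \<Rightarrow> 'w) \<Rightarrow> bool" where
  "balanced B V n \<phi> \<longleftrightarrow> (\<forall>vs\<in>tuples V n. \<forall>k. Suc k < n \<longrightarrow> (\<forall>b\<in>B.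
     \<phi> (vs[k := ract V (vs ! k) b]) = \<phi> (vs[Suc k := lact V b (vs ! Suc k)])))"

lemma balanced_rels_cases:
  assumes "r \<in> balanced_rels B V n"
  obtains vs k b where "vs \<in> tuples V n" "Suc k < n" "b \<in> B"
    "r = delta (vs[k := ract V (vs ! k) b]) \<ominus>\<^bsub>free_space (tuples V n)\<^esub>
      delta (vs[Suc k := lact V b (vs ! Suc k)])"
  using assms unfolding balanced_rels_def
proof (elim CollectE exE conjE)
  fix F us v b w vs
  assume *: "r = delta (us @ ract V v b # w # vs) \<ominus>\<^bsub>F\<^esub> delta (us @ v # lact V b w # vs)"
    "F = free_space (tuples V n)" "b \<in> B" "us @ v # w # vs \<in> tuples V n"
  have "(us @ v # w # vs)[Suc (length us) := z] = us @ v # z # vs" for z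
    by (simp add: list_update_append)
  moreover have "(us @ v # w # vs) ! Suc (length us) = w" by (simp add: nth_append)
  ultimately show thesis using *
    by (intro that[of "us @ v # w # vs" "length us" b]) (auto simp: tuples_def)
qed

lemma balanced_relsI:
  assumes "vs \<in> tuples V n" "Suc k < n" "b \<in> B"
  shows "delta (vs[k := ract V (vs ! k) b]) \<ominus>\<^bsub>free_space (tuples V n)\<^esub>
      delta (vs[Suc k := lact V b (vs ! Suc k)]) \<in> balanced_rels B V n"
proof -
  have vs: "vs = take k vs @ vs ! k # vs ! Suc k # drop (Suc (Suc k)) vs"
    using assms by (metis Cons_nth_drop_Suc Suc_lessD id_take_nth_drop tuples_length)
  have "vs[k := z] = take k vs @ z # vs ! Suc k # drop (Suc (Suc k)) vs" for z
    using assms by (simp add: upd_conv_take_nth_drop tuples_length Cons_nth_drop_Suc)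
  moreover have "vs[Suc k := z] = take k vs @ vs ! k # z # drop (Suc (Suc k)) vs" for z
    using assms by (simp add: upd_conv_take_nth_drop tuples_length take_Suc_conv_app_nth)
  ultimately show ?thesis
    unfolding balanced_rels_def using vs assms(1,3)
    by (intro CollectI exI[of _ "free_space (tuples V n)"] exI[of _ "take k vs"] exI[of _ "vs ! k"] exI[of _ b]
        exI[of _ "vs ! Suc k"] exI[of _ "drop (Suc (Suc k)) vs"]) simp
qed

text \<open>Closure of the two actions is what places the balancing relations in the free space on
  tuples.\<close>

locale bimodule_closed =
  fixes B :: "'b set" and V :: "('v, 'b, 'm) bimodule_scheme"
  assumes vspace: "vspace V"
    and lact_mem: "b \<in> B \<Longrightarrow> x \<in> carrier V \<Longrightarrow> lact V b x \<in> carrier V"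
    and ract_mem: "b \<in> B \<Longrightarrow> x \<in> carrier V \<Longrightarrow> ract V x b \<in> carrier V"
begin

lemma rels_subset: "multilinear_rels V n \<union> balanced_rels B V n \<subseteq> carrier (free_space (tuples V n))"
proof (rule Un_least[OF multilinear_rels_subset[OF vspace]], rule subsetI)
  interpret F: vspace "free_space (tuples V n)" by (rule vspace_free_space)
  fix r assume "r \<in> balanced_rels B V n"
  then show "r \<in> carrier (free_space (tuples V n))"
    by (cases rule: balanced_rels_cases)
      (auto intro!: F.minus_closed lact_mem ract_mem tuples_nth tuples_update
        simp: delta_mem simp del: free_space_simps)
qed

text \<open>The vector space underlying \<open>btensor_power\<close>, kept apart from it because the
  actions there are themselves maps out of this space and are evaluated through its universal
  property.\<close>

definition btensor :: "nat \<Rightarrow> (complex, ('v list \<Rightarrow> complex) set) module" where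
  "btensor n = quot (free_space (tuples V n)) (btensor_null B V n)"

lemma vspace_btensor: "vspace (btensor n)"
  unfolding btensor_def btensor_null_def
  by (intro vquotient.vspace_quot presented_vquotient rels_subset)

lemma multilinear_bpure: "multilinear V (btensor n) n (bpure B V n)"
  unfolding btensor_def btensor_null_def bpure_def
  by (intro multilinear_presented vspace rels_subset) auto

lemma spans_bpure: "spans (btensor n) (bpure B V n ` tuples V n)"
  unfolding btensor_def btensor_null_def bpure_def
  by (intro presented_spans rels_subset)

lemma balanced_bpure: "balanced B V n (bpure B V n)"
  unfolding balanced_def
proof (intro ballI allI impI)
  interpret Q: vquotient "free_space (tuples V n)" "btensor_null B V n"
    unfolding btensor_null_def by (rule presented_vquotient[OF rels_subset])
  fix vs k b assume *: "vs \<in> tuples V n" "Suc k < n" "b \<in> B"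
  from * have "delta (vs[k := ract V (vs ! k) b]) \<in> carrier (free_space (tuples V n))"
    "delta (vs[Suc k := lact V b (vs ! Suc k)]) \<in> carrier (free_space (tuples V n))"
    by (auto simp: delta_mem intro!: tuples_update lact_mem ract_mem tuples_nth simp del: free_space_simps)
  then show "bpure B V n (vs[k := ract V (vs ! k) b]) = bpure B V n (vs[Suc k := lact V b (vs ! Suc k)])"
    unfolding bpure_def
    by (rule Q.coset_eq_iff[THEN iffD2])
      (unfold btensor_null_def, rule subsetD[OF lin_span_superset UnI2[OF balanced_relsI[OF *]]])
qed

lemma btensor_lift:
  assumes W: "vspace W" and \<phi>: "multilinear V W n \<phi>" "balanced B V n \<phi>"
  shows "\<exists>h\<in>lin (btensor n) W. \<forall>vs\<in>tuples V n. h (bpure B V n vs) = \<phi> vs"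
proof -
  interpret W: vspace W by fact
  interpret F: vspace "free_space (tuples V n)" by (rule vspace_free_space)
  have van: "h r = \<zero>\<^bsub>W\<^esub>" if h: "h \<in> lin (free_space (tuples V n)) W"
    "\<And>vs. vs \<in> tuples V n \<Longrightarrow> h (delta vs) = \<phi> vs"
    and r: "r \<in> multilinear_rels V n \<union> balanced_rels B V n" for h r
    using r
  proof
    assume "r \<in> balanced_rels B V n"
    then show ?thesis
    proof (cases rule: balanced_rels_cases)
      case (1 vs k b)
      then have "vs[k := ract V (vs ! k) b] \<in> tuples V n" "vs[Suc k := lact V b (vs ! Suc k)] \<in> tuples V n"
        by (auto intro!: tuples_update lact_mem ract_mem tuples_nth)
      with 1 \<phi> show ?thesis
        by (simp add: lin_minus[OF h(1) F.vspace_axioms W] delta_mem h(2) W.minus_self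
            multilinear_mem[OF \<phi>(1)] balanced_def del: free_space_simps)
    qed
  qed (rule multilinear_rels_vanish[OF vspace W \<phi>(1) h])
  show ?thesis
    unfolding btensor_def btensor_null_def bpure_def
    by (rule presented_lift[OF rels_subset W]) (auto intro: multilinear_mem[OF \<phi>(1)] van)
qed

end

section \<open>Twisted cyclic cochains\<close>

context vspace
begin

definition alt_sum :: "nat \<Rightarrow> (nat \<Rightarrow> 'a) \<Rightarrow> 'a" where
  "alt_sum n g = (\<Oplus>i\<in>{..n}. (-1) ^ i \<odot> g i)"

lemma alt_sum_closed: "(\<And>i. i \<le> n \<Longrightarrow> g i \<in> carrier V) \<Longrightarrow> alt_sum n g \<in> carrier V"
  unfolding alt_sum_def by (rule M.finsum_closed) auto

lemma alt_sum_cong: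
  "(\<And>i. i \<le> n \<Longrightarrow> g i = k i) \<Longrightarrow> (\<And>i. i \<le> n \<Longrightarrow> k i \<in> carrier V) \<Longrightarrow> alt_sum n g = alt_sum n k"
  unfolding alt_sum_def by (rule M.finsum_cong') auto

lemma alt_sum_0: "g 0 \<in> carrier V \<Longrightarrow> alt_sum 0 g = g 0"
  unfolding alt_sum_def by simp

lemma alt_sum_Suc:
  "(\<And>i. i \<le> Suc n \<Longrightarrow> g i \<in> carrier V) \<Longrightarrow> alt_sum (Suc n) g = (-1) ^ Suc n \<odot> g (Suc n) \<oplus> alt_sum n g"
  unfolding alt_sum_def by (subst M.finsum_Suc) auto

lemma alt_sum_add:
  assumes "\<And>i. i \<le> n \<Longrightarrow> g i \<in> carrier V" "\<And>i. i \<le> n \<Longrightarrow> k i \<in> carrier V"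
  shows "alt_sum n (\<lambda>i. g i \<oplus> k i) = alt_sum n g \<oplus> alt_sum n k"
proof -
  have "alt_sum n (\<lambda>i. g i \<oplus> k i) = (\<Oplus>i\<in>{..n}. (-1) ^ i \<odot> g i \<oplus> (-1) ^ i \<odot> k i)"
    unfolding alt_sum_def by (rule M.finsum_cong') (use assms in \<open>auto simp: smult_add_right\<close>)
  also have "\<dots> = alt_sum n g \<oplus> alt_sum n k"
    unfolding alt_sum_def by (rule M.finsum_addf) (use assms in auto)
  finally show ?thesis .
qed

lemma alt_sum_smult:
  assumes "\<And>i. i \<le> n \<Longrightarrow> g i \<in> carrier V"
  shows "alt_sum n (\<lambda>i. c \<odot> g i) = c \<odot> alt_sum n g"
proof -
  have "c \<odot> alt_sum n g = (\<Oplus>i\<in>{..n}. c \<odot> ((-1) ^ i \<odot> g i))"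
    unfolding alt_sum_def by (rule finsum_smult) (use assms in auto)
  also have "\<dots> = alt_sum n (\<lambda>i. c \<odot> g i)"
    unfolding alt_sum_def by (rule M.finsum_cong') (use assms in \<open>auto simp: smult_smult mult.commute\<close>)
  finally show ?thesis by simp
qed

lemma alt_sum_zero: "alt_sum n (\<lambda>_. \<zero>) = \<zero>"
  by (simp add: alt_sum_def)

lemma alt_sum_Suc2:
  assumes "\<And>i. i \<le> Suc n \<Longrightarrow> g i \<in> carrier V"
  shows "alt_sum (Suc n) g = g 0 \<oplus> (-1) \<odot> alt_sum n (\<lambda>i. g (Suc i))"
proof -
  have "alt_sum (Suc n) g = (\<Oplus>i\<in>{..n}. (-1) ^ Suc i \<odot> g (Suc i)) \<oplus> g 0"
    unfolding alt_sum_def by (subst M.finsum_Suc2) (use assms in auto)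
  also have "(\<Oplus>i\<in>{..n}. (-1) ^ Suc i \<odot> g (Suc i)) = alt_sum n (\<lambda>i. (-1) \<odot> g (Suc i))"
    unfolding alt_sum_def by (rule M.finsum_cong') (use assms in \<open>auto simp: smult_smult\<close>)
  also have "\<dots> = (-1) \<odot> alt_sum n (\<lambda>i. g (Suc i))"
    by (rule alt_sum_smult) (use assms in auto)
  finally show ?thesis
    using assms alt_sum_closed[of n "\<lambda>i. g (Suc i)"] by (simp add: M.a_comm)
qed

text \<open>This is the shape that arises when an element of \<open>B\<close> stands in the last
  slot: all faces but the last two contribute zero, and these two have opposite signs.\<close>

lemma alt_sum_two:
  assumes "\<And>i. i \<le> Suc n \<Longrightarrow> g i \<in> carrier V" "\<And>i. i < n \<Longrightarrow> g i = \<zero>"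
  shows "alt_sum (Suc n) g = (-1) ^ n \<odot> (g n \<ominus> g (Suc n))"
proof -
  have "alt_sum n g = (-1) ^ n \<odot> g n"
  proof (cases n)
    case (Suc m)
    have "alt_sum m g = \<zero>" using assms(2) Suc by (subst alt_sum_cong[of m g "\<lambda>_. \<zero>"]) (auto simp: alt_sum_zero)
    then show ?thesis using assms(1) Suc by (simp add: alt_sum_Suc)
  qed (simp add: assms(1) alt_sum_0)
  moreover have "alt_sum (Suc n) g = (-1) ^ Suc n \<odot> g (Suc n) \<oplus> alt_sum n g"
    using assms(1) by (rule alt_sum_Suc)
  ultimately show ?thesis
    using assms(1) by (simp add: minus_eq_smult smult_add_right smult_smult M.a_comm)
qed

text \<open>In the induction step, the new row and the new column of the double sum cancel.\<close>

lemma alt_sum_alt_sum: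
  assumes "\<And>i j. i \<le> n \<Longrightarrow> j \<le> Suc n \<Longrightarrow> g j i \<in> carrier V"
    and "\<And>i j. i < j \<Longrightarrow> j \<le> Suc n \<Longrightarrow> g j i = g i (j - 1)"
  shows "alt_sum (Suc n) (\<lambda>j. alt_sum n (g j)) = \<zero>"
  using assms
proof (induct n)
  case 0
  have "alt_sum 0 (g j) = g j 0" if "j \<le> Suc 0" for j using 0(1) that by (simp add: alt_sum_0)
  moreover have "g (Suc 0) 0 = g 0 0" using 0(2)[of 0 "Suc 0"] by simp
  ultimately show ?case using 0(1) by (simp add: alt_sum_two minus_self)
next
  case (Suc n)
  have IH: "alt_sum (Suc n) (\<lambda>j. alt_sum n (g j)) = \<zero>"
    by (rule Suc.hyps) (use Suc.prems in auto)
  have mem: "alt_sum n (g j) \<in> carrier V" "alt_sum (Suc n) (g j) \<in> carrier V" if "j \<le> Suc (Suc n)" for j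
    using that Suc.prems(1) by (auto intro!: alt_sum_closed)
  have col: "(\<lambda>i. g i (Suc n)) i \<in> carrier V" if "i \<le> Suc n" for i
    using Suc.prems(1) that by auto
  have "alt_sum (Suc n) (\<lambda>j. alt_sum (Suc n) (g j)) =
      alt_sum (Suc n) (\<lambda>j. (-1) ^ Suc n \<odot> g j (Suc n) \<oplus> alt_sum n (g j))"
    by (rule alt_sum_cong) (use Suc.prems(1) mem in \<open>auto simp: alt_sum_Suc\<close>)
  also have "\<dots> = (-1) ^ Suc n \<odot> alt_sum (Suc n) (\<lambda>j. g j (Suc n)) \<oplus> \<zero>"
    using Suc.prems(1) mem by (simp add: alt_sum_add alt_sum_smult IH)
  finally have rows: "alt_sum (Suc n) (\<lambda>j. alt_sum (Suc n) (g j)) = (-1) ^ Suc n \<odot> alt_sum (Suc n) (\<lambda>j. g j (Suc n))"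
    using alt_sum_closed[of "Suc n" "\<lambda>j. g j (Suc n)", OF col] by simp
  \<comment> \<open>The symmetry of \<open>g\<close> with second index \<open>Suc (Suc n)\<close>
    identifies the new row with the last column. Their signs differ by one factor -1.\<close>
  have "alt_sum (Suc n) (g (Suc (Suc n))) = alt_sum (Suc n) (\<lambda>i. g i (Suc n))"
    by (rule alt_sum_cong) (use Suc.prems in auto)
  then show ?case
    using mem alt_sum_closed[of "Suc n" "\<lambda>j. g j (Suc n)", OF col]
    by (subst alt_sum_Suc) (auto simp: rows smult_add_left[symmetric])
qed

end

lemma lin_alt_sum:
  assumes "h \<in> lin V W" "vspace V" "vspace W" "\<And>i. i \<le> n \<Longrightarrow> g i \<in> carrier V"
  shows "h (vspace.alt_sum V n g) = vspace.alt_sum W n (\<lambda>i. h (g i))"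
proof -
  interpret V: vspace V by fact
  interpret W: vspace W by fact
  have "h (V.alt_sum n g) = (\<Oplus>\<^bsub>W\<^esub>i\<in>{..n}. h ((-1) ^ i \<odot>\<^bsub>V\<^esub> g i))"
    unfolding V.alt_sum_def by (rule lin_finsum[OF assms(1-3)]) (use assms(4) in auto)
  also have "\<dots> = W.alt_sum n (\<lambda>i. h (g i))"
    unfolding W.alt_sum_def
    by (rule W.finsum_cong') (use assms(4) in \<open>auto simp: lin_smult[OF assms(1)] lin_closed[OF assms(1)]\<close>)
  finally show ?thesis .
qed

section \<open>Faces of tuples in a twisted algebra\<close>

locale twisted_algebra =
  fixes A :: "(complex, 'a, 'm) module_scheme" (structure) and B :: "'a set" and \<sigma> :: "'a \<Rightarrow> 'a"
  assumes complex_algebra: "complex_algebra A"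
    and \<sigma>_aut: "\<sigma> \<in> algebra_aut A"
    and B_subalgebra: "complex_subalgebra B A"
    and \<sigma>_B: "bij_betw \<sigma> B B"
begin

sublocale complex_algebra A by (rule complex_algebra)

sublocale vspace A by unfold_locales

lemma \<sigma>_mem: "x \<in> carrier A \<Longrightarrow> \<sigma> x \<in> carrier A"
  using \<sigma>_aut by (auto simp: algebra_aut_def ring_iso_def ring_hom_def)

lemma \<sigma>_add: "x \<in> carrier A \<Longrightarrow> y \<in> carrier A \<Longrightarrow> \<sigma> (x \<oplus> y) = \<sigma> x \<oplus> \<sigma> y"
  using \<sigma>_aut by (auto simp: algebra_aut_def ring_iso_def ring_hom_def)

lemma \<sigma>_mult: "x \<in> carrier A \<Longrightarrow> y \<in> carrier A \<Longrightarrow> \<sigma> (x \<otimes> y) = \<sigma> x \<otimes> \<sigma> y"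
  using \<sigma>_aut by (auto simp: algebra_aut_def ring_iso_def ring_hom_def)

lemma \<sigma>_smult: "x \<in> carrier A \<Longrightarrow> \<sigma> (c \<odot> x) = c \<odot> \<sigma> x"
  using \<sigma>_aut by (auto simp: algebra_aut_def)

lemma \<sigma>_B_mem: "b \<in> B \<Longrightarrow> \<sigma> b \<in> B"
  using \<sigma>_B by (auto simp: bij_betw_def)

lemma B_submodule: "submodule B CC A"
  using B_subalgebra by (simp add: complex_subalgebra_def)

lemma B_mult: "b \<in> B \<Longrightarrow> b' \<in> B \<Longrightarrow> b \<otimes> b' \<in> B"
  using B_subalgebra by (simp add: complex_subalgebra_def)

lemma B_carrier: "b \<in> B \<Longrightarrow> b \<in> carrier A"
  using submoduleE(1)[OF B_submodule] by blast

text \<open>The summands of the Hochschild boundary on tuples; \<open>i = n\<close> is the twisted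
  one. Giving the list entry by entry reduces identities between faces to case distinctions on one
  index. The list expressions in \<open>hochschild\<close> are matched with it by
  \<open>face_eq_take_drop\<close> and \<open>face_eq_twisted\<close>.\<close>

definition face :: "nat \<Rightarrow> nat \<Rightarrow> 'a list \<Rightarrow> 'a list" where
  "face n i as = map (\<lambda>k.
     if i < n then (if k < i then as ! k else if k = i then as ! k \<otimes> as ! Suc k else as ! Suc k)
     else (if k = 0 then \<sigma> (as ! n) \<otimes> as ! 0 else as ! k)) [0..<n]"

lemma length_face [simp]: "length (face n i as) = n"
  by (simp add: face_def)

lemma nth_face:
  "k < n \<Longrightarrow> face n i as ! k =
    (if i < n then (if k < i then as ! k else if k = i then as ! k \<otimes> as ! Suc k else as ! Suc k)
     else (if k = 0 then \<sigma> (as ! n) \<otimes> as ! 0 else as ! k))"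
  by (simp add: face_def)

lemma face_mem:
  assumes "as \<in> tuples A (Suc n)"
  shows "face n i as \<in> tuples A n"
  by (rule tuplesI) (auto simp: nth_face intro!: m_closed \<sigma>_mem tuples_nth[OF assms])

text \<open>The presimplicial identity behind the vanishing of the squared boundary. Distant
  products do not interact, overlapping ones agree by associativity.\<close>

lemma face_face:
  assumes as: "as \<in> tuples A (Suc (Suc n))" and n: "0 < n" and ij: "i < j" "j \<le> Suc n"
  shows "face n i (face (Suc n) j as) = face n (j - 1) (face (Suc n) i as)"
proof (rule nth_equalityI)
  have [simp]: "as ! k \<in> carrier A" if "k < Suc (Suc n)" for k using tuples_nth[OF as that] .
  fix k assume "k < length (face n i (face (Suc n) j as))"
  then have k: "k < n" by simp
  obtain j' where j: "j = Suc j'" using ij by (cases j) auto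
  note [simp] = nth_face m_assoc \<sigma>_mult \<sigma>_mem
  \<comment> \<open>The cases record which faces are twisted: none, only the one with index
    \<open>j\<close>, or both on the left-hand side.\<close>
  consider "j' < n" | "j' = n" "i < n" | "j' = n" "i = n" using ij j by linarith
  then show "face n i (face (Suc n) j as) ! k = face n (j - 1) (face (Suc n) i as) ! k"
  proof cases
    case 1
    with ij j have i: "i < n" "i \<le> j'" by auto
    consider "k < i" | "k = i" "i < j'" | "k = i" "i = j'" | "i < k" "k < j'" | "i < k" "k = j'" | "j' < k"
      using i by linarith
    then show ?thesis using k i 1 by cases (simp_all add: j)
  next
    case 2
    consider "k = 0" "i = 0" | "k = 0" "0 < i" | "0 < k" "k < i" | "0 < k" "k = i" | "0 < k" "i < k" by linarith
    then show ?thesis using k n 2 by cases (simp_all add: j)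
  next
    \<comment> \<open>Two twisted faces in a row multiply by the images of the last two entries
      separately; the other side applies \<open>\<sigma>\<close> to their product. This is where
      \<open>\<sigma>\<close> has to be multiplicative.\<close>
    case 3
    consider "k = 0" | "0 < k" by linarith
    then show ?thesis using k n 3 by cases (simp_all add: j)
  qed
qed simp

text \<open>A change of one entry reaches exactly one entry of the face, through a linear map
  \<open>\<psi>\<close>: the identity, multiplication by a fixed factor, or \<open>\<sigma>\<close>
  followed by such a multiplication. Multilinearity of \<phi> thus passes to its composition with a
  face.\<close>

lemma face_update:
  assumes as: "as \<in> tuples A (Suc n)" and n: "0 < n" and i: "i \<le> n" and k: "k \<le> n"
  obtains k' \<psi> where "k' < n" "\<And>x. x \<in> carrier A \<Longrightarrow> \<psi> x \<in> carrier A"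
    "\<And>x y. x \<in> carrier A \<Longrightarrow> y \<in> carrier A \<Longrightarrow> \<psi> (x \<oplus> y) = \<psi> x \<oplus> \<psi> y"
    "\<And>c x. x \<in> carrier A \<Longrightarrow> \<psi> (c \<odot> x) = c \<odot> \<psi> x"
    "\<And>x. x \<in> carrier A \<Longrightarrow> face n i (as[k := x]) = (face n i as)[k' := \<psi> x]"
proof -
  have mem: "as ! l \<in> carrier A" if "l \<le> n" for l using tuples_nth[OF as] that by simp
  have len: "length as = Suc n" using as by (rule tuples_length)
  note [simp] = len nth_face nth_list_update
  consider (lt) "i < n" "k < i" | (eq) "i < n" "k = i" | (suc) "i < n" "k = Suc i" | (gt) "i < n" "Suc i < k"
    | (n0) "i = n" "k = 0" | (nn) "i = n" "k = n" | (nk) "i = n" "0 < k" "k < n"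
    using i k by linarith
  then show thesis
  proof cases
    case lt
    then show thesis by (intro that[of k "\<lambda>x. x"]) (auto intro!: nth_equalityI)
  next
    case eq
    then show thesis
      by (intro that[of k "\<lambda>x. x \<otimes> as ! Suc i"])
        (auto intro!: nth_equalityI simp: mem l_distr smult_mult_left)
  next
    case suc
    then show thesis
      by (intro that[of i "\<lambda>x. as ! i \<otimes> x"])
        (auto intro!: nth_equalityI simp: mem r_distr smult_mult_right)
  next
    case gt
    then obtain l where "k = Suc l" by (cases k) auto
    with gt k show thesis
      by (intro that[of l "\<lambda>x. x"]) (auto intro!: nth_equalityI)
  next
    case n0
    then show thesis using n
      by (intro that[of 0 "\<lambda>x. \<sigma> (as ! n) \<otimes> x"])
        (auto intro!: nth_equalityI simp: mem \<sigma>_mem r_distr smult_mult_right)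
  next
    case nn
    then show thesis using n
      by (intro that[of 0 "\<lambda>x. \<sigma> x \<otimes> as ! 0"])
        (auto intro!: nth_equalityI simp: mem \<sigma>_mem \<sigma>_add \<sigma>_smult l_distr smult_mult_left)
  next
    case nk
    then show thesis by (intro that[of k "\<lambda>x. x"]) (auto intro!: nth_equalityI)
  qed
qed

lemma multilinear_face:
  assumes "multilinear A W n \<phi>" "0 < n" "i \<le> n"
  shows "multilinear A W (Suc n) (\<lambda>as. \<phi> (face n i as))"
  unfolding multilinear_def
proof (intro conjI ballI allI impI)
  fix as assume as: "as \<in> tuples A (Suc n)"
  show "\<phi> (face n i as) \<in> carrier W"
    by (rule multilinear_mem[OF assms(1) face_mem[OF as]])
  fix k assume "k < Suc n"
  then have k: "k \<le> n" by simp
  obtain k' \<psi> where *: "k' < n" "\<And>x. x \<in> carrier A \<Longrightarrow> \<psi> x \<in> carrier A"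
    "\<And>x y. x \<in> carrier A \<Longrightarrow> y \<in> carrier A \<Longrightarrow> \<psi> (x \<oplus> y) = \<psi> x \<oplus> \<psi> y"
    "\<And>c x. x \<in> carrier A \<Longrightarrow> \<psi> (c \<odot> x) = c \<odot> \<psi> x"
    "\<And>x. x \<in> carrier A \<Longrightarrow> face n i (as[k := x]) = (face n i as)[k' := \<psi> x]"
    by (rule face_update[OF as assms(2,3) k], rule that)
  fix x assume x: "x \<in> carrier A"
  { fix y assume y: "y \<in> carrier A"
    show "\<phi> (face n i (as[k := x \<oplus> y])) = \<phi> (face n i (as[k := x])) \<oplus>\<^bsub>W\<^esub> \<phi> (face n i (as[k := y]))"
      using x y by (simp add: * multilinear_add[OF assms(1) face_mem[OF as]]) }
  fix c
  show "\<phi> (face n i (as[k := c \<odot> x])) = c \<odot>\<^bsub>W\<^esub> \<phi> (face n i (as[k := x]))"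
    using x by (simp add: * multilinear_smult[OF assms(1) face_mem[OF as]])
qed

text \<open>The transpose of \<open>hochschild\<close> on maps with values in \<open>W\<close>. Here
  \<open>n\<close> counts the arguments of \<open>\<phi>\<close>, so the result takes one argument
  more and has n+1 faces.\<close>

definition cobd :: "(complex, 'w, 'k) module_scheme \<Rightarrow> nat \<Rightarrow> ('a list \<Rightarrow> 'w) \<Rightarrow> 'a list \<Rightarrow> 'w" where
  "cobd W n \<phi> as = vspace.alt_sum W n (\<lambda>i. \<phi> (face n i as))"

lemma multilinear_cobd:
  assumes W: "vspace W" and \<phi>: "multilinear A W n \<phi>" and n: "0 < n"
  shows "multilinear A W (Suc n) (cobd W n \<phi>)"
proof -
  interpret W: vspace W by fact
  note f = multilinear_face[OF \<phi> n]
  have mem: "\<phi> (face n i (as[k := x])) \<in> carrier W"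
    if "as \<in> tuples A (Suc n)" "x \<in> carrier A" for i as k x
    using that by (intro multilinear_mem[OF \<phi>] face_mem tuples_update)
  show ?thesis
    unfolding multilinear_def cobd_def
  proof (intro conjI ballI allI impI)
    fix as assume as: "as \<in> tuples A (Suc n)"
    show "W.alt_sum n (\<lambda>i. \<phi> (face n i as)) \<in> carrier W"
      by (rule W.alt_sum_closed) (rule multilinear_mem[OF f as])
    fix k assume k: "k < Suc n"
    fix x assume x: "x \<in> carrier A"
    { fix y assume y: "y \<in> carrier A"
      have "W.alt_sum n (\<lambda>i. \<phi> (face n i (as[k := x \<oplus> y]))) =
          W.alt_sum n (\<lambda>i. \<phi> (face n i (as[k := x])) \<oplus>\<^bsub>W\<^esub> \<phi> (face n i (as[k := y])))"
        by (rule W.alt_sum_cong) (use mem[OF as] x y multilinear_add[OF f as k] in auto)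
      also have "\<dots> = W.alt_sum n (\<lambda>i. \<phi> (face n i (as[k := x]))) \<oplus>\<^bsub>W\<^esub> W.alt_sum n (\<lambda>i. \<phi> (face n i (as[k := y])))"
        by (rule W.alt_sum_add) (use mem[OF as] x y in auto)
      finally show "W.alt_sum n (\<lambda>i. \<phi> (face n i (as[k := x \<oplus> y]))) =
          W.alt_sum n (\<lambda>i. \<phi> (face n i (as[k := x]))) \<oplus>\<^bsub>W\<^esub> W.alt_sum n (\<lambda>i. \<phi> (face n i (as[k := y])))" . }
    fix c
    have "W.alt_sum n (\<lambda>i. \<phi> (face n i (as[k := c \<odot> x]))) = W.alt_sum n (\<lambda>i. c \<odot>\<^bsub>W\<^esub> \<phi> (face n i (as[k := x])))"
      by (rule W.alt_sum_cong) (use mem[OF as] x multilinear_smult[OF f as k] in auto)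
    also have "\<dots> = c \<odot>\<^bsub>W\<^esub> W.alt_sum n (\<lambda>i. \<phi> (face n i (as[k := x])))"
      by (rule W.alt_sum_smult) (use mem[OF as] x in auto)
    finally show "W.alt_sum n (\<lambda>i. \<phi> (face n i (as[k := c \<odot> x]))) =
        c \<odot>\<^bsub>W\<^esub> W.alt_sum n (\<lambda>i. \<phi> (face n i (as[k := x])))" .
  qed
qed

text \<open>By \<open>face_face\<close> the double array of values on iterated faces has the
  symmetry that \<open>alt_sum_alt_sum\<close> asks for.\<close>

lemma cobd_cobd:
  assumes W: "vspace W" and \<phi>: "\<And>as. as \<in> tuples A n \<Longrightarrow> \<phi> as \<in> carrier W" and n: "0 < n"
    and as: "as \<in> tuples A (Suc (Suc n))"
  shows "cobd W (Suc n) (cobd W n \<phi>) as = \<zero>\<^bsub>W\<^esub>"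
proof -
  interpret W: vspace W by fact
  show ?thesis
    unfolding cobd_def
    by (rule W.alt_sum_alt_sum) (use as n \<phi> in \<open>auto intro!: face_mem simp: face_face\<close>)
qed


subsection \<open>Cyclic invariance\<close>

text \<open>The cyclic operator on tuples without its sign, which a tuple cannot carry; the sign
  reappears in \<open>cyclic\<close>.\<close>

definition rot :: "'a list \<Rightarrow> 'a list" where
  "rot as = \<sigma> (last as) # butlast as"

lemma length_rot: "as \<in> tuples A (Suc m) \<Longrightarrow> length (rot as) = Suc m"
  by (simp add: rot_def tuples_length)

lemma nth_rot:
  assumes "as \<in> tuples A (Suc m)" "k \<le> m"
  shows "rot as ! k = (if k = 0 then \<sigma> (as ! m) else as ! (k - 1))"
proof -
  have "as \<noteq> []" using tuples_length[OF assms(1)] by auto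
  then show ?thesis
    using assms tuples_length[OF assms(1)]
    by (auto simp: rot_def last_conv_nth nth_butlast nth_Cons split: nat.splits)
qed

lemma rot_mem:
  assumes "as \<in> tuples A (Suc m)"
  shows "rot as \<in> tuples A (Suc m)"
  by (rule tuplesI)
    (auto simp: length_rot[OF assms] nth_rot[OF assms] less_Suc_eq_le intro!: \<sigma>_mem tuples_nth[OF assms])

text \<open>Rotation moves slot \<open>k\<close> to \<open>Suc k\<close>, and the last slot to slot
  0 through \<open>\<sigma>\<close>. This lemma and the next are what all later arguments about the
  position of an entry of \<open>B\<close> use.\<close>

lemma rot_update_last:
  assumes "as \<in> tuples A (Suc m)" "x \<in> carrier A"
  shows "rot (as[m := x]) = (rot as)[0 := \<sigma> x]"
proof (rule nth_equalityI)
  note mem = tuples_update[OF assms]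
  show "length (rot (as[m := x])) = length ((rot as)[0 := \<sigma> x])"
    by (simp add: length_rot[OF assms(1)] length_rot[OF mem])
  fix k assume "k < length (rot (as[m := x]))"
  then have "k \<le> m" by (simp add: length_rot[OF mem])
  then show "rot (as[m := x]) ! k = (rot as)[0 := \<sigma> x] ! k"
    using tuples_length[OF assms(1)]
    by (auto simp: nth_rot[OF assms(1)] nth_rot[OF mem] length_rot[OF assms(1)] nth_list_update)
qed

lemma rot_update:
  assumes "as \<in> tuples A (Suc m)" "x \<in> carrier A" "k < m"
  shows "rot (as[k := x]) = (rot as)[Suc k := x]"
proof (rule nth_equalityI)
  note mem = tuples_update[OF assms(1,2)]
  show "length (rot (as[k := x])) = length ((rot as)[Suc k := x])"
    by (simp add: length_rot[OF assms(1)] length_rot[OF mem])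
  fix l assume "l < length (rot (as[k := x]))"
  then have "l \<le> m" by (simp add: length_rot[OF mem])
  then show "rot (as[k := x]) ! l = (rot as)[Suc k := x] ! l"
    using tuples_length[OF assms(1)] assms(3)
    by (cases l)
      (auto simp: nth_rot[OF assms(1)] nth_rot[OF mem] length_rot[OF assms(1)] nth_list_update)
qed

lemma face_rot_0:
  assumes "as \<in> tuples A (Suc (Suc m))"
  shows "face (Suc m) 0 (rot as) = face (Suc m) (Suc m) as"
  by (rule nth_equalityI) (auto simp: nth_face nth_rot[OF assms])

text \<open>With \<open>face_rot_0\<close> these are the relations between faces and rotation in a
  paracyclic module: going once around applies \<open>\<sigma>\<close> to every entry instead of
  giving the identity. For \<open>i = m\<close> the left face is the twisted one and
  multiplicativity of \<open>\<sigma>\<close> enters.\<close>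

lemma face_rot_Suc:
  assumes as: "as \<in> tuples A (Suc (Suc m))" and i: "i \<le> m"
  shows "face (Suc m) (Suc i) (rot as) = rot (face (Suc m) i as)"
proof (rule nth_equalityI)
  note f = face_mem[OF as, of i]
  have [simp]: "as ! k \<in> carrier A" if "k < Suc (Suc m)" for k using tuples_nth[OF as that] .
  show "length (face (Suc m) (Suc i) (rot as)) = length (rot (face (Suc m) i as))"
    by (simp add: length_rot[OF f])
  fix k assume "k < length (face (Suc m) (Suc i) (rot as))"
  then show "face (Suc m) (Suc i) (rot as) ! k = rot (face (Suc m) i as) ! k"
    using i by (cases k) (auto simp: nth_face nth_rot[OF as] nth_rot[OF f] \<sigma>_mult)
qed

text \<open>The sign is its own inverse, so this is invariance under the cyclic operator. For a
  multilinear map, vanishing and balancing (the next two definitions) say that it factors through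
  the tensor power of the quotient over \<open>B\<close>, the twisted relation that it factors
  further through \<open>reduced_chains\<close>, and cyclicity that it factors through
  \<open>cyclic_chains\<close>.\<close>

definition cyclic :: "(complex, 'w, 'k) module_scheme \<Rightarrow> nat \<Rightarrow> ('a list \<Rightarrow> 'w) \<Rightarrow> bool" where
  "cyclic W m \<phi> \<longleftrightarrow> (\<forall>as\<in>tuples A (Suc m). \<phi> (rot as) = (-1) ^ m \<odot>\<^bsub>W\<^esub> \<phi> as)"

definition B_vanishing :: "(complex, 'w, 'k) module_scheme \<Rightarrow> nat \<Rightarrow> ('a list \<Rightarrow> 'w) \<Rightarrow> bool" where
  "B_vanishing W m \<phi> \<longleftrightarrow> (\<forall>as\<in>tuples A (Suc m). \<forall>k\<le>m. \<forall>b\<in>B. \<phi> (as[k := b]) = \<zero>\<^bsub>W\<^esub>)"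

definition B_balanced :: "nat \<Rightarrow> ('a list \<Rightarrow> 'w) \<Rightarrow> bool" where
  "B_balanced m \<phi> \<longleftrightarrow> (\<forall>as\<in>tuples A (Suc m). \<forall>k<m. \<forall>b\<in>B.
     \<phi> (as[k := as ! k \<otimes> b]) = \<phi> (as[Suc k := b \<otimes> as ! Suc k]))"

definition B_twisted :: "nat \<Rightarrow> ('a list \<Rightarrow> 'w) \<Rightarrow> bool" where
  "B_twisted m \<phi> \<longleftrightarrow> (\<forall>as\<in>tuples A (Suc m). \<forall>b\<in>B.
     \<phi> (as[m := as ! m \<otimes> b]) = \<phi> (as[0 := \<sigma> b \<otimes> as ! 0]))"

lemma smult_sign_cancel:
  assumes "vspace W" "x \<in> carrier W" "y \<in> carrier W" "(-1) ^ m \<odot>\<^bsub>W\<^esub> x = (-1) ^ m \<odot>\<^bsub>W\<^esub> y"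
  shows "x = y"
proof -
  interpret W: vspace W by fact
  have "(-1) ^ m \<odot>\<^bsub>W\<^esub> ((-1) ^ m \<odot>\<^bsub>W\<^esub> x) = (-1) ^ m \<odot>\<^bsub>W\<^esub> ((-1) ^ m \<odot>\<^bsub>W\<^esub> y)"
    using assms(4) by simp
  then show ?thesis using assms(2,3) by (simp add: W.smult_smult power_mult_distrib[symmetric])
qed

text \<open>For a cyclic map an equation between two values may be checked after rotating both
  tuples, since the common sign cancels.\<close>

lemma cyclic_cancel:
  assumes "vspace W" "cyclic W m \<phi>" "\<And>as. as \<in> tuples A (Suc m) \<Longrightarrow> \<phi> as \<in> carrier W"
    "as \<in> tuples A (Suc m)" "as' \<in> tuples A (Suc m)" "\<phi> (rot as) = \<phi> (rot as')"
  shows "\<phi> as = \<phi> as'"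
  by (rule smult_sign_cancel[OF assms(1), of _ _ m]) (use assms(2-) in \<open>auto simp: cyclic_def\<close>)

text \<open>Each rotation carries the entry of \<open>B\<close> one slot to the right and changes
  the value only by a sign, so the last slot decides.\<close>

lemma cyclic_B_vanishingI:
  assumes W: "vspace W" and cyc: "cyclic W m \<phi>"
    and mem: "\<And>as. as \<in> tuples A (Suc m) \<Longrightarrow> \<phi> as \<in> carrier W"
    and last: "\<And>as b. as \<in> tuples A (Suc m) \<Longrightarrow> b \<in> B \<Longrightarrow> \<phi> (as[m := b]) = \<zero>\<^bsub>W\<^esub>"
  shows "B_vanishing W m \<phi>"
  unfolding B_vanishing_def
proof (intro ballI allI impI)
  interpret W: vspace W by fact
  fix as k b assume "as \<in> tuples A (Suc m)" "k \<le> m" and b: "b \<in> B"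
  from this(2,1) show "\<phi> (as[k := b]) = \<zero>\<^bsub>W\<^esub>"
  \<comment> \<open>The induction descends from \<open>m\<close>. The tuple stays arbitrary because
    the hypothesis is applied to the rotated tuple.\<close>
  proof (induct k arbitrary: as rule: inc_induct)
    case base
    then show ?case using last b by simp
  next
    case (step k)
    have up: "as[k := b] \<in> tuples A (Suc m)" using step.prems B_carrier[OF b] by (rule tuples_update)
    have "rot (as[k := b]) = (rot as)[Suc k := b]"
      using step by (intro rot_update B_carrier b)
    then have "\<phi> (rot (as[k := b])) = \<zero>\<^bsub>W\<^esub>"
      using step.hyps(3)[OF rot_mem[OF step.prems]] by simp
    then have "(-1) ^ m \<odot>\<^bsub>W\<^esub> \<phi> (as[k := b]) = \<zero>\<^bsub>W\<^esub>"
      using cyc up by (simp add: cyclic_def)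
    then show ?case
      using smult_sign_cancel[OF W mem[OF up] W.M.zero_closed, of m] by simp
  qed
qed

text \<open>Rotation carries a pair of neighbouring slots to the right until it becomes the pair of
  last and first slot, where balancing turns into the twisted relation.\<close>

lemma cyclic_B_balancedI:
  assumes W: "vspace W" and cyc: "cyclic W m \<phi>" and tw: "B_twisted m \<phi>"
    and mem: "\<And>as. as \<in> tuples A (Suc m) \<Longrightarrow> \<phi> as \<in> carrier W"
  shows "B_balanced m \<phi>"
proof (cases m)
  case 0
  then show ?thesis by (simp add: B_balanced_def)
next
  case (Suc l)
  have "\<phi> (as[k := as ! k \<otimes> b]) = \<phi> (as[Suc k := b \<otimes> as ! Suc k])"
    if "k \<le> l" "as \<in> tuples A (Suc m)" "b \<in> B" for k as b
    using that(1,2)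
  proof (induct k arbitrary: as rule: inc_induct)
    case base
    have ab: "as ! l \<in> carrier A" "as ! Suc l \<in> carrier A" "b \<in> carrier A"
      using tuples_nth[OF base] B_carrier that(3) Suc by auto
    \<comment> \<open>Here \<open>l\<close> and \<open>Suc l\<close> are the last two slots. After
      one rotation the first of them is last and the second is first, under \<open>\<sigma>\<close>,
      so that b on its left becomes \<open>\<sigma> b\<close>.\<close>
    have "\<phi> ((rot as)[Suc l := rot as ! Suc l \<otimes> b]) = \<phi> ((rot as)[0 := \<sigma> b \<otimes> rot as ! 0])"
      using tw rot_mem[OF base] that(3) Suc unfolding B_twisted_def by blast
    moreover have "rot (as[l := as ! l \<otimes> b]) = (rot as)[Suc l := rot as ! Suc l \<otimes> b]"
      using ab Suc by (simp add: rot_update[OF base] nth_rot[OF base])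
    moreover have "rot (as[Suc l := b \<otimes> as ! Suc l]) = (rot as)[0 := \<sigma> b \<otimes> rot as ! 0]"
      using ab by (simp add: rot_update_last[OF base[unfolded Suc]] nth_rot[OF base[unfolded Suc]] \<sigma>_mult)
    ultimately have eq: "\<phi> (rot (as[l := as ! l \<otimes> b])) = \<phi> (rot (as[Suc l := b \<otimes> as ! Suc l]))"
      by simp
    show ?case
      by (rule cyclic_cancel[OF W cyc, OF _ _ _ eq])
        (use base ab in \<open>auto intro!: tuples_update mem\<close>)
  next
    case (step k)
    have ab: "as ! k \<in> carrier A" "as ! Suc k \<in> carrier A" "b \<in> carrier A"
      using tuples_nth[OF step.prems] B_carrier that(3) Suc step.hyps by auto
    have "rot as ! Suc k = as ! k" "rot as ! Suc (Suc k) = as ! Suc k"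
      using Suc step.hyps by (auto simp: nth_rot[OF step.prems])
    with step.hyps(3)[OF rot_mem[OF step.prems]]
    have "\<phi> ((rot as)[Suc k := as ! k \<otimes> b]) = \<phi> ((rot as)[Suc (Suc k) := b \<otimes> as ! Suc k])"
      by simp
    then have eq: "\<phi> (rot (as[k := as ! k \<otimes> b])) = \<phi> (rot (as[Suc k := b \<otimes> as ! Suc k]))"
      using ab Suc step.hyps by (simp add: rot_update[OF step.prems])
    show ?case
      by (rule cyclic_cancel[OF W cyc, OF _ _ _ eq])
        (use step.prems ab in \<open>auto intro!: tuples_update mem\<close>)
  qed
  then show ?thesis unfolding B_balanced_def Suc by (simp add: less_Suc_eq_le)
qed

text \<open>The zeroth face of the rotated tuple is the last face of the tuple, and face i+1 is the
  rotation of face i. Splitting off the first term of one sum and the last term of the other leaves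
  two sums that differ by the required sign.\<close>

lemma cyclic_cobd:
  assumes W: "vspace W" and cyc: "cyclic W m \<phi>"
    and mem: "\<And>as. as \<in> tuples A (Suc m) \<Longrightarrow> \<phi> as \<in> carrier W"
  shows "cyclic W (Suc m) (cobd W (Suc m) \<phi>)"
  unfolding cyclic_def
proof
  interpret W: vspace W by fact
  fix as assume as: "as \<in> tuples A (Suc (Suc m))"
  note f = mem[OF face_mem[OF as]]
  have "cobd W (Suc m) \<phi> (rot as) =
      \<phi> (face (Suc m) 0 (rot as)) \<oplus>\<^bsub>W\<^esub> (-1) \<odot>\<^bsub>W\<^esub> W.alt_sum m (\<lambda>i. \<phi> (face (Suc m) (Suc i) (rot as)))"
    unfolding cobd_def by (rule W.alt_sum_Suc2) (intro mem face_mem rot_mem as)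
  also have "W.alt_sum m (\<lambda>i. \<phi> (face (Suc m) (Suc i) (rot as))) =
      W.alt_sum m (\<lambda>i. (-1) ^ m \<odot>\<^bsub>W\<^esub> \<phi> (face (Suc m) i as))"
    by (rule W.alt_sum_cong) (use cyc f face_mem[OF as] in \<open>auto simp: face_rot_Suc[OF as] cyclic_def\<close>)
  also have "\<dots> = (-1) ^ m \<odot>\<^bsub>W\<^esub> W.alt_sum m (\<lambda>i. \<phi> (face (Suc m) i as))"
    by (rule W.alt_sum_smult) (rule f)
  finally have "cobd W (Suc m) \<phi> (rot as) = \<phi> (face (Suc m) (Suc m) as) \<oplus>\<^bsub>W\<^esub>
      (-1) ^ Suc m \<odot>\<^bsub>W\<^esub> W.alt_sum m (\<lambda>i. \<phi> (face (Suc m) i as))"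
    using f by (simp add: face_rot_0[OF as] W.smult_smult W.alt_sum_closed)
  also have "\<dots> = (-1) ^ Suc m \<odot>\<^bsub>W\<^esub> cobd W (Suc m) \<phi> as"
    using f unfolding cobd_def
    by (subst W.alt_sum_Suc)
      (auto simp: W.smult_add_right W.smult_smult W.alt_sum_closed power_mult_distrib[symmetric])
  finally show "cobd W (Suc m) \<phi> (rot as) = (-1) ^ Suc m \<odot>\<^bsub>W\<^esub> cobd W (Suc m) \<phi> as" .
qed

lemma B_vanishing_nth:
  assumes "B_vanishing W m \<phi>" "as \<in> tuples A (Suc m)" "k \<le> m" "as ! k \<in> B"
  shows "\<phi> as = \<zero>\<^bsub>W\<^esub>"
  using assms by (metis B_vanishing_def list_update_id)

lemma B_vanishing_cobd:
  assumes W: "vspace W" and \<phi>: "cyclic W m \<phi>" "B_vanishing W m \<phi>" "B_twisted m \<phi>"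
    and mem: "\<And>as. as \<in> tuples A (Suc m) \<Longrightarrow> \<phi> as \<in> carrier W"
  shows "B_vanishing W (Suc m) (cobd W (Suc m) \<phi>)"
proof (rule cyclic_B_vanishingI[OF W cyclic_cobd[OF W \<phi>(1) mem]])
  interpret W: vspace W by fact
  show "cobd W (Suc m) \<phi> as \<in> carrier W" if "as \<in> tuples A (Suc (Suc m))" for as
    unfolding cobd_def using that by (intro W.alt_sum_closed mem face_mem)
  fix as b assume as: "as \<in> tuples A (Suc (Suc m))" and b: "b \<in> B"
  define bs where "bs = as[Suc m := b]"
  have bs: "bs \<in> tuples A (Suc (Suc m))" unfolding bs_def by (rule tuples_update[OF as B_carrier[OF b]])
  have bs_last: "bs ! Suc m = b" unfolding bs_def using tuples_length[OF as] by simp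
  \<comment> \<open>The two surviving faces arise from the tuple without b: its last entry is
    multiplied by b on the right, or its first by \<open>\<sigma> b\<close> on the left.\<close>
  have bl: "butlast bs \<in> tuples A (Suc m)"
    using bs by (auto simp: tuples_def dest: in_set_butlastD)
  have nth_bl: "butlast bs ! k = bs ! k" if "k \<le> m" for k
    using that tuples_length[OF bs] by (simp add: nth_butlast)
  \<comment> \<open>For these \<open>i\<close> the product is taken further left, and b survives
    untouched in the last slot \<open>m\<close> of the face.\<close>
  have "\<phi> (face (Suc m) i bs) = \<zero>\<^bsub>W\<^esub>" if "i < m" for i
    by (rule B_vanishing_nth[OF \<phi>(2) face_mem[OF bs], of m]) (use that b bs_last in \<open>auto simp: nth_face\<close>)
  moreover have "face (Suc m) m bs = (butlast bs)[m := butlast bs ! m \<otimes> b]"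
    using tuples_length[OF bl] bs_last
    by (intro nth_equalityI) (auto simp: nth_face nth_bl nth_list_update)
  moreover have "face (Suc m) (Suc m) bs = (butlast bs)[0 := \<sigma> b \<otimes> butlast bs ! 0]"
    using tuples_length[OF bl] bs_last
    by (intro nth_equalityI) (auto simp: nth_face nth_bl nth_list_update)
  ultimately have "cobd W (Suc m) \<phi> bs = (-1) ^ m \<odot>\<^bsub>W\<^esub>
      (\<phi> ((butlast bs)[m := butlast bs ! m \<otimes> b]) \<ominus>\<^bsub>W\<^esub> \<phi> ((butlast bs)[0 := \<sigma> b \<otimes> butlast bs ! 0]))"
    unfolding cobd_def by (subst W.alt_sum_two) (auto intro!: mem face_mem bs)
  also have "\<phi> ((butlast bs)[m := butlast bs ! m \<otimes> b]) = \<phi> ((butlast bs)[0 := \<sigma> b \<otimes> butlast bs ! 0])"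
    using \<phi>(3) bl b by (simp add: B_twisted_def)
  also have "(butlast bs)[0 := \<sigma> b \<otimes> butlast bs ! 0] \<in> tuples A (Suc m)"
    using bl b by (intro tuples_update m_closed \<sigma>_mem B_carrier tuples_nth[OF bl]) auto
  note W.minus_self[OF mem[OF this]]
  finally show "cobd W (Suc m) \<phi> (as[Suc m := b]) = \<zero>\<^bsub>W\<^esub>" by (simp add: bs_def)
qed

text \<open>
  Appending \<open>b \<in> B\<close> to a tuple and evaluating \<open>cobd (cobd \<phi>) = 0\<close> there, only the last two faces
  contribute, and they are the two sides of the twisted commutator relation.
\<close>

lemma B_twisted_cobd:
  assumes W: "vspace W" and van: "B_vanishing W (Suc m) (cobd W (Suc m) \<phi>)"
    and mem: "\<And>as. as \<in> tuples A (Suc m) \<Longrightarrow> \<phi> as \<in> carrier W"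
  shows "B_twisted (Suc m) (cobd W (Suc m) \<phi>)"
  unfolding B_twisted_def
proof (intro ballI)
  interpret W: vspace W by fact
  let ?G = "cobd W (Suc m) \<phi>"
  have G: "?G as \<in> carrier W" if "as \<in> tuples A (Suc (Suc m))" for as
    unfolding cobd_def using that by (intro W.alt_sum_closed mem face_mem)
  fix as b assume as: "as \<in> tuples A (Suc (Suc m))" and b: "b \<in> B"
  define bs where "bs = as @ [b]"
  have bs: "bs \<in> tuples A (Suc (Suc (Suc m)))"
    using as B_carrier[OF b] by (auto simp: bs_def tuples_def)
  have nth: "bs ! k = (if k \<le> Suc m then as ! k else b)" if "k \<le> Suc (Suc m)" for k
    using that tuples_length[OF as] by (auto simp: bs_def nth_append)
  have Gs: "?G (as[Suc m := as ! Suc m \<otimes> b]) \<in> carrier W" "?G (as[0 := \<sigma> b \<otimes> as ! 0]) \<in> carrier W"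
    using B_carrier[OF b] by (auto intro!: G tuples_update as m_closed \<sigma>_mem tuples_nth[OF as])
  have "?G (face (Suc (Suc m)) i bs) = \<zero>\<^bsub>W\<^esub>" if "i < Suc m" for i
    by (rule B_vanishing_nth[OF van face_mem[OF bs], of "Suc m"]) (use that b in \<open>auto simp: nth_face nth\<close>)
  moreover have "face (Suc (Suc m)) (Suc m) bs = as[Suc m := as ! Suc m \<otimes> b]"
    using tuples_length[OF as] by (intro nth_equalityI) (auto simp: nth_face nth nth_list_update)
  moreover have "face (Suc (Suc m)) (Suc (Suc m)) bs = as[0 := \<sigma> b \<otimes> as ! 0]"
    using tuples_length[OF as] by (intro nth_equalityI) (auto simp: nth_face nth nth_list_update)
  ultimately have e1: "cobd W (Suc (Suc m)) ?G bs = (-1) ^ Suc m \<odot>\<^bsub>W\<^esub>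
      (?G (as[Suc m := as ! Suc m \<otimes> b]) \<ominus>\<^bsub>W\<^esub> ?G (as[0 := \<sigma> b \<otimes> as ! 0]))"
    unfolding cobd_def[of W "Suc (Suc m)"] by (subst W.alt_sum_two) (auto intro!: G face_mem bs simp del: power_Suc)
  have e2: "cobd W (Suc (Suc m)) ?G bs = \<zero>\<^bsub>W\<^esub>"
    by (rule cobd_cobd[OF W mem _ bs]) auto
  have "?G (as[Suc m := as ! Suc m \<otimes> b]) \<ominus>\<^bsub>W\<^esub> ?G (as[0 := \<sigma> b \<otimes> as ! 0]) = \<zero>\<^bsub>W\<^esub>"
    by (rule smult_sign_cancel[OF W W.M.minus_closed[OF Gs] W.M.zero_closed, of "Suc m"])
      (simp only: trans[OF e1[symmetric] e2] W.smult_zero)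
  then show "?G (as[Suc m := as ! Suc m \<otimes> b]) = ?G (as[0 := \<sigma> b \<otimes> as ! 0])"
    using Gs by (simp add: W.minus_eq_zero_iff)
qed


section \<open>Stability of the relations under rotation\<close>

lemma vspace_A: "vspace A" by (rule vspace_axioms)

text \<open>This and the next three lemmas make the cyclic operator well defined on
  \<open>reduced_chains\<close>.\<close>

lemma multilinear_rot:
  assumes "multilinear A W (Suc m) \<phi>"
  shows "multilinear A W (Suc m) (\<lambda>as. \<phi> (rot as))"
  unfolding multilinear_def
proof (intro conjI ballI allI impI)
  fix as assume as: "as \<in> tuples A (Suc m)"
  note r = rot_mem[OF as]
  show "\<phi> (rot as) \<in> carrier W" by (rule multilinear_mem[OF assms r])
  fix k assume "k < Suc m"
  then consider "k < m" | "k = m" by linarith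
  note k = this
  fix x assume x: "x \<in> carrier A"
  { fix y assume y: "y \<in> carrier A"
    show "\<phi> (rot (as[k := x \<oplus> y])) = \<phi> (rot (as[k := x])) \<oplus>\<^bsub>W\<^esub> \<phi> (rot (as[k := y]))"
      using k x y
      by cases (simp_all add: rot_update[OF as] rot_update_last[OF as] \<sigma>_add \<sigma>_mem multilinear_add[OF assms r]) }
  fix c
  show "\<phi> (rot (as[k := c \<odot> x])) = c \<odot>\<^bsub>W\<^esub> \<phi> (rot (as[k := x]))"
    using k x
    by cases (simp_all add: rot_update[OF as] rot_update_last[OF as] \<sigma>_smult \<sigma>_mem multilinear_smult[OF assms r])
qed

lemma B_vanishing_rot:
  assumes "B_vanishing W m \<phi>"
  shows "B_vanishing W m (\<lambda>as. \<phi> (rot as))"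
  unfolding B_vanishing_def
proof (intro ballI allI impI)
  fix as k b assume as: "as \<in> tuples A (Suc m)" and "k \<le> m" and b: "b \<in> B"
  then consider "k < m" | "k = m" by linarith
  then show "\<phi> (rot (as[k := b])) = \<zero>\<^bsub>W\<^esub>"
    using assms rot_mem[OF as] b \<sigma>_B_mem[OF b]
    by cases (simp_all add: rot_update[OF as] rot_update_last[OF as] B_carrier B_vanishing_def)
qed

text \<open>A pair of neighbouring slots moves one place to the right. The last pair moves to the
  last and first slot, where the twisted relation takes over; hence both relations are assumed
  together.\<close>

lemma B_balanced_rot:
  assumes "B_balanced m \<phi>" "B_twisted m \<phi>"
  shows "B_balanced m (\<lambda>as. \<phi> (rot as))"
  unfolding B_balanced_def
proof (intro ballI allI impI)
  fix as k b assume as: "as \<in> tuples A (Suc m)" and k: "k < m" and b: "b \<in> B"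
  note r = rot_mem[OF as]
  have ab: "as ! k \<in> carrier A" "as ! Suc k \<in> carrier A" "b \<in> carrier A"
    using tuples_nth[OF as] k B_carrier[OF b] by auto
  from k consider "Suc k < m" | "m = Suc k" by linarith
  then show "\<phi> (rot (as[k := as ! k \<otimes> b])) = \<phi> (rot (as[Suc k := b \<otimes> as ! Suc k]))"
  proof cases
    case 1
    have "\<phi> ((rot as)[Suc k := rot as ! Suc k \<otimes> b]) = \<phi> ((rot as)[Suc (Suc k) := b \<otimes> rot as ! Suc (Suc k)])"
      using assms(1) r 1 b by (simp add: B_balanced_def)
    then show ?thesis using 1 ab by (simp add: rot_update[OF as] nth_rot[OF as])
  next
    case 2
    have "\<phi> ((rot as)[m := rot as ! m \<otimes> b]) = \<phi> ((rot as)[0 := \<sigma> b \<otimes> rot as ! 0])"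
      using assms(2) r b by (simp add: B_twisted_def)
    moreover have "rot (as[Suc k := b \<otimes> as ! Suc k]) = (rot as)[0 := \<sigma> b \<otimes> rot as ! 0]"
      using ab 2 rot_update_last[OF as, of "b \<otimes> as ! Suc k"] by (simp add: nth_rot[OF as] \<sigma>_mult)
    moreover have "rot (as[k := as ! k \<otimes> b]) = (rot as)[m := rot as ! m \<otimes> b]"
      using ab 2 by (simp add: rot_update[OF as] nth_rot[OF as])
    ultimately show ?thesis by simp
  qed
qed

text \<open>The pair of last and first slot moves to slots 0 and 1, and the relation becomes
  balancing by \<open>\<sigma> b\<close>, which lies in \<open>B\<close> again.\<close>

lemma B_twisted_rot:
  assumes "B_balanced m \<phi>" "B_twisted m \<phi>"
  shows "B_twisted m (\<lambda>as. \<phi> (rot as))"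
  unfolding B_twisted_def
proof (intro ballI)
  fix as b assume as: "as \<in> tuples A (Suc m)" and b: "b \<in> B"
  note r = rot_mem[OF as]
  have ab: "as ! m \<in> carrier A" "as ! 0 \<in> carrier A" "b \<in> carrier A"
    using tuples_nth[OF as] B_carrier[OF b] by auto
  have rot0: "rot as ! 0 = \<sigma> (as ! m)" by (simp add: nth_rot[OF as])
  have lhs: "rot (as[m := as ! m \<otimes> b]) = (rot as)[0 := rot as ! 0 \<otimes> \<sigma> b]"
    using ab by (simp add: rot_update_last[OF as] rot0 \<sigma>_mult)
  show "\<phi> (rot (as[m := as ! m \<otimes> b])) = \<phi> (rot (as[0 := \<sigma> b \<otimes> as ! 0]))"
  proof (cases m)
    \<comment> \<open>With a single entry the first slot is also the last, and the rotated relation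
      is once more the twisted one, now for \<open>\<sigma> b\<close>.\<close>
    case 0
    have "rot (as[0 := \<sigma> b \<otimes> as ! 0]) = (rot as)[0 := \<sigma> (\<sigma> b) \<otimes> rot as ! 0]"
      using ab rot_update_last[OF as, of "\<sigma> b \<otimes> as ! 0"] 0 by (simp add: rot0 \<sigma>_mult \<sigma>_mem)
    moreover have "\<phi> ((rot as)[0 := rot as ! 0 \<otimes> \<sigma> b]) = \<phi> ((rot as)[0 := \<sigma> (\<sigma> b) \<otimes> rot as ! 0])"
      using assms(2) r \<sigma>_B_mem[OF b] 0 by (simp add: B_twisted_def)
    ultimately show ?thesis unfolding lhs by simp
  next
    case (Suc l)
    have "rot (as[0 := \<sigma> b \<otimes> as ! 0]) = (rot as)[Suc 0 := \<sigma> b \<otimes> rot as ! Suc 0]"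
      using ab Suc by (simp add: rot_update[OF as] nth_rot[OF as] \<sigma>_mem)
    moreover have "\<phi> ((rot as)[0 := rot as ! 0 \<otimes> \<sigma> b]) = \<phi> ((rot as)[Suc 0 := \<sigma> b \<otimes> rot as ! Suc 0])"
      using assms(1) r \<sigma>_B_mem[OF b] Suc by (simp add: B_balanced_def)
    ultimately show ?thesis unfolding lhs by simp
  qed
qed


subsection \<open>The quotient bimodule\<close>

sublocale quo: vquotient A B
  by (rule vspace_submodule_vquotient[OF vspace_A B_submodule])

abbreviation q :: "'a \<Rightarrow> 'a set" where "q a \<equiv> B +> a"

abbreviation AB :: "('a set, 'a) bimodule" where "AB \<equiv> quot_bimodule A B"

lemma AB_simps:
  "carrier AB = carrier (quot A B)" "add AB = add (quot A B)" "zero AB = zero (quot A B)"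
  "module.smult AB = module.smult (quot A B)"
  by (simp_all add: quot_bimodule_def module.defs bimodule.defs)

lemma carrier_AB: "carrier AB = q ` carrier A"
  by (simp add: AB_simps quo.carrier_quot)

lemma AB_q:
  "a \<in> carrier A \<Longrightarrow> a' \<in> carrier A \<Longrightarrow> q a \<oplus>\<^bsub>AB\<^esub> q a' = q (a \<oplus> a')"
  "a \<in> carrier A \<Longrightarrow> c \<odot>\<^bsub>AB\<^esub> q a = q (c \<odot> a)"
  "\<zero>\<^bsub>AB\<^esub> = q \<zero>"
  by (simp_all add: AB_simps quo.add_quot quo.smult_quot quo.zero_quot)

lemma vspace_AB: "vspace AB"
  by (rule vspace_cong[OF quo.vspace_quot AB_simps])

lemma q_B: "b \<in> B \<Longrightarrow> q b = q \<zero>"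
  by (subst quo.coset_eq_iff) (auto simp: B_carrier minus_eq_smult)

lemma spans_q: "spans (quot A B) (q ` carrier A)"
  by (rule quo.quot_spans[OF spans_carrier])

text \<open>A linear map of \<open>A\<close> that preserves \<open>B\<close> descends to the
  quotient. It is applied to multiplication by an element of \<open>B\<close>, which preserves
  \<open>B\<close> because \<open>B\<close> is closed under products.\<close>

lemma quot_endo:
  assumes "\<And>x. x \<in> carrier A \<Longrightarrow> \<psi> x \<in> carrier A" "\<And>x. x \<in> B \<Longrightarrow> \<psi> x \<in> B"
    "\<And>x y. x \<in> carrier A \<Longrightarrow> y \<in> carrier A \<Longrightarrow> \<psi> (x \<oplus> y) = \<psi> x \<oplus> \<psi> y"
    "\<And>c x. x \<in> carrier A \<Longrightarrow> \<psi> (c \<odot> x) = c \<odot> \<psi> x" "a \<in> carrier A"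
  shows "lin_ext (quot A B) (quot A B) (carrier A) q (\<lambda>a. q (\<psi> a)) (q a) = q (\<psi> a)"
proof -
  have lin: "(\<lambda>a\<in>carrier A. q (\<psi> a)) \<in> lin A (quot A B)"
    by (rule lin_restrictI) (auto simp: assms quo.coset_mem quo.add_quot quo.smult_quot vspace_A)
  have van: "(\<lambda>a\<in>carrier A. q (\<psi> a)) b = \<zero>\<^bsub>quot A B\<^esub>" if "b \<in> B" for b
    using B_carrier[OF that] q_B[OF assms(2)[OF that]] by (simp add: quo.zero_quot)
  obtain h where h: "h \<in> lin (quot A B) (quot A B)"
    "\<And>x. x \<in> carrier A \<Longrightarrow> h (q x) = (\<lambda>a\<in>carrier A. q (\<psi> a)) x"
    by (rule quo.quot_lift[OF lin quo.vspace_quot van], assumption, rule that)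
  have "lin_ext (quot A B) (quot A B) (carrier A) q (\<lambda>a. q (\<psi> a)) = h"
    by (rule lin_ext_eqI[OF h(1) _ quo.vspace_quot quo.vspace_quot spans_q]) (use h(2) in simp)
  then show ?thesis using h(2) assms(5) by simp
qed

lemma lact_AB:
  assumes "b \<in> B" "a \<in> carrier A"
  shows "lact AB b (q a) = q (b \<otimes> a)"
proof -
  have "lact AB b (q a) = lin_ext (quot A B) (quot A B) (carrier A) q (\<lambda>a. q (b \<otimes> a)) (q a)"
    by (simp add: quot_bimodule_def module.defs bimodule.defs)
  also have "\<dots> = q (b \<otimes> a)"
    by (rule quot_endo) (use assms in \<open>auto simp: B_mult B_carrier r_distr smult_mult_right\<close>)
  finally show ?thesis .
qed

lemma ract_AB:
  assumes "b \<in> B" "a \<in> carrier A"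
  shows "ract AB (q a) b = q (a \<otimes> b)"
proof -
  have "ract AB (q a) b = lin_ext (quot A B) (quot A B) (carrier A) q (\<lambda>a. q (a \<otimes> b)) (q a)"
    by (simp add: quot_bimodule_def module.defs bimodule.defs)
  also have "\<dots> = q (a \<otimes> b)"
    by (rule quot_endo) (use assms in \<open>auto simp: B_mult B_carrier l_distr smult_mult_left\<close>)
  finally show ?thesis .
qed

sublocale bim: bimodule_closed B AB
proof (rule bimodule_closed.intro)
  fix b x assume b: "b \<in> B" and "x \<in> carrier AB"
  then obtain a where a: "a \<in> carrier A" "x = q a" by (auto simp: carrier_AB)
  show "lact AB b x \<in> carrier AB" "ract AB x b \<in> carrier AB"
    using b a(1) unfolding a(2) by (simp_all add: carrier_AB lact_AB ract_AB B_carrier)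
qed (rule vspace_AB)


subsection \<open>Tensor powers of the quotient bimodule\<close>

text \<open>Choosing a representative in each slot lifts a tuple of cosets. From here on maps on
  tuples of cosets are described by maps on tuples of \<open>A\<close>.\<close>

lemma tuples_AB: "tuples AB n = map q ` tuples A n"
proof
  show "map q ` tuples A n \<subseteq> tuples AB n"
    by (auto simp: tuples_def carrier_AB intro!: imageI)
  show "tuples AB n \<subseteq> map q ` tuples A n"
  proof
    fix vs assume vs: "vs \<in> tuples AB n"
    define r where "r v = (SOME a. a \<in> carrier A \<and> q a = v)" for v
    have r: "r v \<in> carrier A \<and> q (r v) = v" if v: "v \<in> carrier AB" for v
    proof -
      from v obtain a where "a \<in> carrier A \<and> q a = v" by (auto simp: carrier_AB)
      then show ?thesis unfolding r_def by (rule someI)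
    qed
    have "map r vs \<in> tuples A n" using vs r by (auto simp: tuples_def)
    moreover have "map q (map r vs) = vs"
      using vs r by (auto simp: tuples_def intro!: map_idI)
    ultimately show "vs \<in> map q ` tuples A n" by (metis imageI)
  qed
qed

section \<open>Factoring multilinear maps through the tensor power of the quotient over the
  subalgebra\<close>

definition compat :: "(complex, 'w, 'k) module_scheme \<Rightarrow> nat \<Rightarrow> ('a list \<Rightarrow> 'w) \<Rightarrow> bool" where
  "compat W m \<phi> \<longleftrightarrow> multilinear A W (Suc m) \<phi> \<and> B_vanishing W m \<phi> \<and> B_balanced m \<phi>"

lemma compat_cong:
  assumes "compat W m \<phi>" "\<And>as. as \<in> tuples A (Suc m) \<Longrightarrow> \<psi> as = \<phi> as"
  shows "compat W m \<psi>"
proof -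
  have up: "as[k := b] \<in> tuples A (Suc m)" if "as \<in> tuples A (Suc m)" "b \<in> carrier A" for as k b
    using that by (rule tuples_update)
  show ?thesis
    using assms(1) unfolding compat_def
  proof (intro conjI; elim conjE)
    assume "multilinear A W (Suc m) \<phi>"
    then show "multilinear A W (Suc m) \<psi>" using assms(2) vspace_A by (rule multilinear_cong)
  next
    assume "B_vanishing W m \<phi>"
    then show "B_vanishing W m \<psi>"
      unfolding B_vanishing_def by (simp add: assms(2) up B_carrier)
  next
    assume "B_balanced m \<phi>"
    then show "B_balanced m \<psi>"
      unfolding B_balanced_def by (simp add: assms(2) up B_carrier tuples_nth)
  qed
qed

text \<open>Slot 0 has no left neighbour and slot \<open>m\<close> no right one, so the
  corresponding condition on \<open>\<psi>\<close> is dropped there. Left multiplication in slot 0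
  and right multiplication in slot \<open>m\<close> therefore qualify by associativity, which yields
  the two actions.\<close>

lemma compat_slot:
  assumes \<phi>: "compat W m \<phi>" and k: "k \<le> m" and \<psi>: "\<And>x. x \<in> carrier A \<Longrightarrow> \<psi> x \<in> carrier A"
    "\<And>x. x \<in> B \<Longrightarrow> \<psi> x \<in> B"
    "\<And>x y. x \<in> carrier A \<Longrightarrow> y \<in> carrier A \<Longrightarrow> \<psi> (x \<oplus> y) = \<psi> x \<oplus> \<psi> y"
    "\<And>c x. x \<in> carrier A \<Longrightarrow> \<psi> (c \<odot> x) = c \<odot> \<psi> x"
    and left: "\<And>x b. 0 < k \<Longrightarrow> x \<in> carrier A \<Longrightarrow> b \<in> B \<Longrightarrow> \<psi> (b \<otimes> x) = b \<otimes> \<psi> x"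
    and right: "\<And>x b. k < m \<Longrightarrow> x \<in> carrier A \<Longrightarrow> b \<in> B \<Longrightarrow> \<psi> (x \<otimes> b) = \<psi> x \<otimes> b"
  shows "compat W m (\<lambda>as. \<phi> (as[k := \<psi> (as ! k)]))"
  unfolding compat_def
proof (intro conjI)
  have mult: "multilinear A W (Suc m) \<phi>" and van: "B_vanishing W m \<phi>" and bal: "B_balanced m \<phi>"
    using \<phi> by (auto simp: compat_def)
  show "multilinear A W (Suc m) (\<lambda>as. \<phi> (as[k := \<psi> (as ! k)]))"
    by (rule multilinear_slot[OF mult]) (use k \<psi> in auto)
  have up: "as[k := \<psi> (as ! k)] \<in> tuples A (Suc m)" if "as \<in> tuples A (Suc m)" for as
    using that k by (intro tuples_update \<psi>(1) tuples_nth[OF that]) auto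
  show "B_vanishing W m (\<lambda>as. \<phi> (as[k := \<psi> (as ! k)]))"
    unfolding B_vanishing_def
  proof (intro ballI allI impI)
    fix as l b assume as: "as \<in> tuples A (Suc m)" and l: "l \<le> m" and b: "b \<in> B"
    show "\<phi> (as[l := b, k := \<psi> (as[l := b] ! k)]) = \<zero>\<^bsub>W\<^esub>"
    proof (cases "l = k")
      case True
      then show ?thesis using van as l \<psi>(2)[OF b] tuples_length[OF as] by (simp add: B_vanishing_def)
    next
      case False
      then have "as[l := b, k := \<psi> (as[l := b] ! k)] = as[k := \<psi> (as ! k), l := b]"
        by (simp add: list_update_swap)
      then show ?thesis using van up[OF as] l b by (simp add: B_vanishing_def)
    qed
  qed
  show "B_balanced m (\<lambda>as. \<phi> (as[k := \<psi> (as ! k)]))"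
    unfolding B_balanced_def
  proof (intro ballI allI impI)
    fix as l b assume as: "as \<in> tuples A (Suc m)" and l: "l < m" and b: "b \<in> B"
    let ?bs = "as[k := \<psi> (as ! k)]"
    have len: "length as = Suc m" by (rule tuples_length[OF as])
    have mem: "as ! l \<in> carrier A" "as ! Suc l \<in> carrier A" using tuples_nth[OF as] l by auto
    have "as[l := as ! l \<otimes> b, k := \<psi> (as[l := as ! l \<otimes> b] ! k)] = ?bs[l := ?bs ! l \<otimes> b]"
      using right[OF _ mem(1) b] l len by (cases "l = k") (auto simp: list_update_swap)
    moreover have "as[Suc l := b \<otimes> as ! Suc l, k := \<psi> (as[Suc l := b \<otimes> as ! Suc l] ! k)] =
        ?bs[Suc l := b \<otimes> ?bs ! Suc l]"
      using left[OF _ mem(2) b] l len by (cases "Suc l = k") (auto simp: list_update_swap)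
    moreover have "\<phi> (?bs[l := ?bs ! l \<otimes> b]) = \<phi> (?bs[Suc l := b \<otimes> ?bs ! Suc l])"
      using bal up[OF as] l b by (simp add: B_balanced_def)
    ultimately show "\<phi> (as[l := as ! l \<otimes> b, k := \<psi> (as[l := as ! l \<otimes> b] ! k)]) =
        \<phi> (as[Suc l := b \<otimes> as ! Suc l, k := \<psi> (as[Suc l := b \<otimes> as ! Suc l] ! k)])"
      by simp
  qed
qed

lemma compat_rot:
  "compat W m \<phi> \<Longrightarrow> B_twisted m \<phi> \<Longrightarrow> compat W m (\<lambda>as. \<phi> (rot as))"
  by (simp add: compat_def multilinear_rot B_vanishing_rot B_balanced_rot)

lemma compat_compose:
  assumes "compat V m \<phi>" "h \<in> lin V W" "vspace V" "vspace W"
  shows "compat W m (\<lambda>as. h (\<phi> as))"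
  unfolding compat_def
proof (intro conjI)
  show "multilinear A W (Suc m) (\<lambda>as. h (\<phi> as))"
    using assms vspace_A by (auto simp: compat_def intro: multilinear_compose)
  show "B_vanishing W m (\<lambda>as. h (\<phi> as))" "B_balanced m (\<lambda>as. h (\<phi> as))"
    using assms by (simp_all add: compat_def B_vanishing_def B_balanced_def lin_zero[OF assms(2-4)])
qed

text \<open>
  A multilinear map vanishing on tuples with an entry in \<open>B\<close> depends only on the cosets of the
  entries; the entries are exchanged one at a time.
\<close>

lemma compat_coset_eq:
  assumes W: "vspace W" and \<phi>: "compat W m \<phi>" and as: "as \<in> tuples A (Suc m)" "as' \<in> tuples A (Suc m)"
    and eq: "map q as = map q as'"
  shows "\<phi> as = \<phi> as'"
proof -
  interpret W: vspace W by fact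
  have mult: "multilinear A W (Suc m) \<phi>" and van: "B_vanishing W m \<phi>" using \<phi> by (auto simp: compat_def)
  have len: "length as = Suc m" "length as' = Suc m" using as by (auto dest: tuples_length)
  define mix where "mix k = take k as' @ drop k as" for k
  have mix: "mix k \<in> tuples A (Suc m)" if "k \<le> Suc m" for k
    using as that len by (auto simp: mix_def tuples_def dest: in_set_takeD in_set_dropD)
  have step: "\<phi> (mix (Suc k)) = \<phi> (mix k)" if k: "k \<le> m" for k
  proof -
    have mem: "as ! k \<in> carrier A" "as' ! k \<in> carrier A" using as k by (auto intro: tuples_nth)
    have "q (as' ! k) = q (as ! k)" using eq k len by (metis le_imp_less_Suc nth_map)
    then have B: "as' ! k \<ominus> as ! k \<in> B" using mem by (simp add: quo.coset_eq_iff)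
    have k': "k < Suc m" "k \<le> Suc m" using k by auto
    have "mix (Suc k) = (mix k)[k := as' ! k]" "mix k = (mix k)[k := as ! k]"
      using k len by (auto simp: mix_def list_update_append take_Suc_conv_app_nth Cons_nth_drop_Suc[symmetric])
    moreover have "as' ! k = (as' ! k \<ominus> as ! k) \<oplus> as ! k"
      using mem by (simp add: a_minus_def M.a_assoc M.l_neg)
    ultimately have "\<phi> (mix (Suc k)) = \<phi> ((mix k)[k := as' ! k \<ominus> as ! k]) \<oplus>\<^bsub>W\<^esub> \<phi> (mix k)"
      using multilinear_add[OF mult mix[OF k'(2)] k'(1) M.minus_closed[OF mem(2,1)] mem(1)] by metis
    then show ?thesis
      using van mix[OF k'(2)] k B multilinear_mem[OF mult mix[OF k'(2)]] by (simp add: B_vanishing_def)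
  qed
  have "\<phi> (mix k) = \<phi> (mix 0)" if "k \<le> Suc m" for k
    using that by (induct k) (simp_all add: step)
  from this[of "Suc m"] show ?thesis by (simp add: mix_def len)
qed

definition quot_pure :: "nat \<Rightarrow> 'a list \<Rightarrow> ('a set list \<Rightarrow> complex) set" where
  "quot_pure m as = bpure B AB (Suc m) (map q as)"

lemma map_q_update: "map q (as[k := x]) = (map q as)[k := q x]"
  by (rule map_update)

lemma compat_quot_pure: "compat (bim.btensor (Suc m)) m (quot_pure m)"
proof -
  have q_tuple: "map q as \<in> tuples AB (Suc m)" if "as \<in> tuples A (Suc m)" for as
    using that by (auto simp: tuples_AB)
  have q_mem: "q a \<in> carrier AB" if "a \<in> carrier A" for a using that by (simp add: carrier_AB)
  note mult = bim.multilinear_bpure[of "Suc m"]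
  show ?thesis
    unfolding compat_def
  proof (intro conjI)
    show "multilinear A (bim.btensor (Suc m)) (Suc m) (quot_pure m)"
      unfolding multilinear_def quot_pure_def
      by (auto simp: map_q_update AB_q[symmetric] q_tuple q_mem multilinear_mem[OF mult]
          multilinear_add[OF mult] multilinear_smult[OF mult])
    show "B_vanishing (bim.btensor (Suc m)) m (quot_pure m)"
      unfolding B_vanishing_def quot_pure_def
    proof (intro ballI allI impI)
      fix as k b assume as: "as \<in> tuples A (Suc m)" and k: "k \<le> m" and b: "b \<in> B"
      have "q b = \<zero>\<^bsub>AB\<^esub>" unfolding AB_q(3) by (rule q_B[OF b])
      then show "bpure B AB (Suc m) (map q (as[k := b])) = \<zero>\<^bsub>bim.btensor (Suc m)\<^esub>"
        unfolding map_q_update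
        using multilinear_zero[OF mult vspace_AB bim.vspace_btensor q_tuple[OF as], of k] k by simp
    qed
    show "B_balanced m (quot_pure m)"
      unfolding B_balanced_def quot_pure_def
    proof (intro ballI allI impI)
      fix as k b assume *: "as \<in> tuples A (Suc m)" "k < m" "b \<in> B"
      have "as ! k \<in> carrier A" "as ! Suc k \<in> carrier A" using *(1,2) by (auto intro: tuples_nth)
      then have "q (as ! k \<otimes> b) = ract AB (map q as ! k) b" "q (b \<otimes> as ! Suc k) = lact AB b (map q as ! Suc k)"
        using * tuples_length[OF *(1)] by (simp_all add: ract_AB lact_AB)
      then show "bpure B AB (Suc m) (map q (as[k := as ! k \<otimes> b])) =
          bpure B AB (Suc m) (map q (as[Suc k := b \<otimes> as ! Suc k]))"
        unfolding map_q_update using bim.balanced_bpure[of "Suc m"] q_tuple[OF *(1)] *(2,3)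
        by (simp add: balanced_def)
    qed
  qed
qed

lemma quot_pure_mem: "as \<in> tuples A (Suc m) \<Longrightarrow> quot_pure m as \<in> carrier (bim.btensor (Suc m))"
  using compat_quot_pure by (auto simp: compat_def intro: multilinear_mem)

lemma spans_quot_pure: "spans (bim.btensor (Suc m)) (quot_pure m ` tuples A (Suc m))"
  using bim.spans_bpure[of "Suc m"] by (simp add: tuples_AB quot_pure_def[abs_def] image_image)

text \<open>\<open>quot_pure m\<close> is the universal map with the property \<open>compat\<close>.
  The map on tuples of cosets evaluates \<open>\<phi>\<close> at chosen representatives, and
  \<open>compat_coset_eq\<close> removes the dependence on the choice.\<close>

lemma quot_pure_lift:
  assumes W: "vspace W" and \<phi>: "compat W m \<phi>"
  shows "\<exists>h\<in>lin (bim.btensor (Suc m)) W. \<forall>as\<in>tuples A (Suc m). h (quot_pure m as) = \<phi> as"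
proof -
  have mult: "multilinear A W (Suc m) \<phi>" and bal: "B_balanced m \<phi>" using \<phi> by (auto simp: compat_def)
  define \<psi> where "\<psi> vs = \<phi> (SOME as. as \<in> tuples A (Suc m) \<and> map q as = vs)" for vs
  have \<psi>: "\<psi> (map q as) = \<phi> as" if as: "as \<in> tuples A (Suc m)" for as
  proof -
    have "(SOME as'. as' \<in> tuples A (Suc m) \<and> map q as' = map q as) \<in> tuples A (Suc m) \<and>
        map q (SOME as'. as' \<in> tuples A (Suc m) \<and> map q as' = map q as) = map q as"
      by (rule someI[of _ as]) (use as in simp)
    then show ?thesis unfolding \<psi>_def using as by (intro compat_coset_eq[OF W \<phi>]) auto
  qed
  have upd: "\<psi> ((map q as)[k := q x]) = \<phi> (as[k := x])" if "as \<in> tuples A (Suc m)" "x \<in> carrier A" for as k x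
    unfolding map_q_update[symmetric] by (rule \<psi>) (use that in auto)
  have "multilinear AB W (Suc m) \<psi>"
    unfolding multilinear_def tuples_AB carrier_AB
    by (auto simp: AB_q upd \<psi> multilinear_mem[OF mult] multilinear_add[OF mult] multilinear_smult[OF mult])
  moreover have "balanced B AB (Suc m) \<psi>"
    unfolding balanced_def tuples_AB
  proof (intro ballI allI impI, elim imageE)
    fix vs k b as assume *: "as \<in> tuples A (Suc m)" "Suc k < Suc m" "b \<in> B" "vs = map q as"
    have mem: "as ! k \<in> carrier A" "as ! Suc k \<in> carrier A" using *(1,2) by (auto intro: tuples_nth)
    then have "ract AB (vs ! k) b = q (as ! k \<otimes> b)" "lact AB b (vs ! Suc k) = q (b \<otimes> as ! Suc k)"
      using * tuples_length[OF *(1)] by (simp_all add: ract_AB lact_AB)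
    then show "\<psi> (vs[k := ract AB (vs ! k) b]) = \<psi> (vs[Suc k := lact AB b (vs ! Suc k)])"
      using * mem bal by (simp add: upd B_carrier B_balanced_def)
  qed
  ultimately obtain h where h: "h \<in> lin (bim.btensor (Suc m)) W"
    "\<forall>vs\<in>tuples AB (Suc m). h (bpure B AB (Suc m) vs) = \<psi> vs"
    using bim.btensor_lift[OF W] by blast
  then show ?thesis
    by (intro bexI[OF _ h(1)]) (simp add: quot_pure_def tuples_AB \<psi>)
qed

text \<open>Evaluates the \<open>lin_ext\<close> in the definition of the actions. Its prescription
  \<open>g\<close> lives on tuples of cosets, but every such tuple is of the form
  \<open>map q as\<close>.\<close>

lemma quot_pure_endo:
  assumes "compat (bim.btensor (Suc m)) m \<phi>" "\<And>as. as \<in> tuples A (Suc m) \<Longrightarrow> g (map q as) = \<phi> as"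
  shows "lin_ext (bim.btensor (Suc m)) (bim.btensor (Suc m)) (tuples AB (Suc m)) (bpure B AB (Suc m)) g
      \<in> lin (bim.btensor (Suc m)) (bim.btensor (Suc m))"
    and "\<And>as. as \<in> tuples A (Suc m) \<Longrightarrow>
      lin_ext (bim.btensor (Suc m)) (bim.btensor (Suc m)) (tuples AB (Suc m)) (bpure B AB (Suc m)) g (quot_pure m as) = \<phi> as"
proof -
  obtain h where h: "h \<in> lin (bim.btensor (Suc m)) (bim.btensor (Suc m))"
    "\<forall>as\<in>tuples A (Suc m). h (quot_pure m as) = \<phi> as"
    using quot_pure_lift[OF bim.vspace_btensor assms(1)] by blast
  have *: "lin_ext (bim.btensor (Suc m)) (bim.btensor (Suc m)) (tuples AB (Suc m)) (bpure B AB (Suc m)) g = h"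
    by (rule lin_ext_eqI[OF h(1) _ bim.vspace_btensor bim.vspace_btensor bim.spans_bpure])
      (use h(2) assms(2) in \<open>auto simp: tuples_AB quot_pure_def\<close>)
  show "lin_ext (bim.btensor (Suc m)) (bim.btensor (Suc m)) (tuples AB (Suc m)) (bpure B AB (Suc m)) g
      \<in> lin (bim.btensor (Suc m)) (bim.btensor (Suc m))"
    unfolding * by (rule h(1))
  show "lin_ext (bim.btensor (Suc m)) (bim.btensor (Suc m)) (tuples AB (Suc m)) (bpure B AB (Suc m)) g (quot_pure m as) = \<phi> as"
    if "as \<in> tuples A (Suc m)" for as
    unfolding * using h(2) that by blast
qed

abbreviation RT :: "nat \<Rightarrow> (('a set list \<Rightarrow> complex) set, 'a) bimodule" where
  "RT m \<equiv> reduced_tensors A B m"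

text \<open>Chains of degree \<open>m\<close> have m+1 tensor factors. Up to the attached actions
  \<open>RT m\<close> is that tensor power.\<close>

lemma RT_simps:
  "carrier (RT m) = carrier (bim.btensor (Suc m))" "add (RT m) = add (bim.btensor (Suc m))"
  "zero (RT m) = zero (bim.btensor (Suc m))" "module.smult (RT m) = module.smult (bim.btensor (Suc m))"
  by (simp_all add: reduced_tensors_def btensor_power_def bim.btensor_def Let_def module.defs bimodule.defs)

lemma vspace_RT: "vspace (RT m)"
  by (rule vspace_cong[OF bim.vspace_btensor RT_simps])

lemma lin_RT: "lin (RT m) W = lin (bim.btensor (Suc m)) W"
  by (rule lin_cong) (simp_all add: RT_simps)

lemma lin_RT_RT: "lin (RT m) (RT m) = lin (bim.btensor (Suc m)) (bim.btensor (Suc m))"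
  by (rule lin_cong) (simp_all add: RT_simps)

lemma spans_RT: "spans (RT m) (quot_pure m ` tuples A (Suc m))"
  using spans_quot_pure[of m] lin_span_cong[OF bim.vspace_btensor vspace_RT RT_simps]
  by (simp add: spans_def RT_simps)

lemma compat_RT: "compat (RT m) m (quot_pure m)"
  using compat_quot_pure[of m] by (simp add: compat_def multilinear_def B_vanishing_def RT_simps)

lemma lact_RT:
  assumes "b \<in> B"
  shows "lact (RT m) b \<in> lin (RT m) (RT m)"
    and "\<And>as. as \<in> tuples A (Suc m) \<Longrightarrow> lact (RT m) b (quot_pure m as) = quot_pure m (as[0 := b \<otimes> as ! 0])"
proof -
  have eq: "lact (RT m) b = lin_ext (bim.btensor (Suc m)) (bim.btensor (Suc m)) (tuples AB (Suc m))
      (bpure B AB (Suc m)) (\<lambda>vs. bpure B AB (Suc m) (lact AB b (hd vs) # tl vs))"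
    by (simp add: reduced_tensors_def btensor_power_def bim.btensor_def Let_def module.defs bimodule.defs)
  have c: "compat (bim.btensor (Suc m)) m (\<lambda>as. quot_pure m (as[0 := b \<otimes> as ! 0]))"
    by (rule compat_slot[OF compat_quot_pure])
      (use assms in \<open>auto simp: B_carrier B_mult r_distr smult_mult_right m_assoc\<close>)
  have g: "bpure B AB (Suc m) (lact AB b (hd (map q as)) # tl (map q as)) = quot_pure m (as[0 := b \<otimes> as ! 0])"
    if "as \<in> tuples A (Suc m)" for as
  proof -
    have "length as = Suc m" using that by (rule tuples_length)
    then obtain a as' where "as = a # as'" by (cases as) auto
    with that show ?thesis using assms by (simp add: quot_pure_def lact_AB tuples_def)
  qed
  show "lact (RT m) b \<in> lin (RT m) (RT m)"
    unfolding eq lin_RT_RT by (rule quot_pure_endo(1)[OF c g])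
  show "lact (RT m) b (quot_pure m as) = quot_pure m (as[0 := b \<otimes> as ! 0])" if "as \<in> tuples A (Suc m)" for as
    unfolding eq by (rule quot_pure_endo(2)[OF c g that])
qed

lemma ract_RT:
  assumes "b \<in> B"
  shows "(\<lambda>\<omega>. ract (RT m) \<omega> b) \<in> lin (RT m) (RT m)"
    and "\<And>as. as \<in> tuples A (Suc m) \<Longrightarrow> ract (RT m) (quot_pure m as) b = quot_pure m (as[m := as ! m \<otimes> b])"
proof -
  have eq: "(\<lambda>\<omega>. ract (RT m) \<omega> b) = lin_ext (bim.btensor (Suc m)) (bim.btensor (Suc m)) (tuples AB (Suc m))
      (bpure B AB (Suc m)) (\<lambda>vs. bpure B AB (Suc m) (butlast vs @ [ract AB (last vs) b]))"
    by (simp add: reduced_tensors_def btensor_power_def bim.btensor_def Let_def module.defs bimodule.defs)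
  have c: "compat (bim.btensor (Suc m)) m (\<lambda>as. quot_pure m (as[m := as ! m \<otimes> b]))"
    by (rule compat_slot[OF compat_quot_pure])
      (use assms in \<open>auto simp: B_carrier B_mult l_distr smult_mult_left m_assoc\<close>)
  have g: "bpure B AB (Suc m) (butlast (map q as) @ [ract AB (last (map q as)) b]) = quot_pure m (as[m := as ! m \<otimes> b])"
    if "as \<in> tuples A (Suc m)" for as
  proof -
    have len: "length as = Suc m" using that by (rule tuples_length)
    then obtain as' a where as: "as = as' @ [a]" by (cases as rule: rev_cases) auto
    with len have "length as' = m" by simp
    with as that show ?thesis using assms
      by (simp add: quot_pure_def ract_AB tuples_def nth_append list_update_append map_butlast)
  qed
  show "(\<lambda>\<omega>. ract (RT m) \<omega> b) \<in> lin (RT m) (RT m)"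
    unfolding eq lin_RT_RT by (rule quot_pure_endo(1)[OF c g])
  show "ract (RT m) (quot_pure m as) b = quot_pure m (as[m := as ! m \<otimes> b])" if "as \<in> tuples A (Suc m)" for as
    using quot_pure_endo(2)[OF c g that] fun_cong[OF eq, of "quot_pure m as"] by simp
qed


subsection \<open>Reduced chains\<close>

lemma commutators_subset:
  "{ract (RT m) \<omega> b \<ominus>\<^bsub>RT m\<^esub> lact (RT m) (\<sigma> b) \<omega> | \<omega> b. \<omega> \<in> carrier (RT m) \<and> b \<in> B} \<subseteq> carrier (RT m)"
proof -
  interpret T: vspace "RT m" by (rule vspace_RT)
  show ?thesis
    using lin_closed[OF ract_RT(1)] lin_closed[OF lact_RT(1)] \<sigma>_B_mem
    by (auto intro!: T.M.minus_closed)
qed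

lemma vquotient_RT: "vquotient (RT m) (twisted_commutators A B \<sigma> m)"
  unfolding twisted_commutators_def
  by (intro vspace_submodule_vquotient vspace_RT vspace.lin_span_submodule commutators_subset)

abbreviation C :: "nat \<Rightarrow> (complex, ('a set list \<Rightarrow> complex) set set) module" where
  "C m \<equiv> reduced_chains A B \<sigma> m"

lemma vspace_C: "vspace (C m)"
  unfolding reduced_chains_def by (rule vquotient.vspace_quot[OF vquotient_RT])

definition reduced_pure :: "nat \<Rightarrow> 'a list \<Rightarrow> ('a set list \<Rightarrow> complex) set set" where
  "reduced_pure m as = twisted_commutators A B \<sigma> m +>\<^bsub>RT m\<^esub> quot_pure m as"

lemma quot_pure_RT: "as \<in> tuples A (Suc m) \<Longrightarrow> quot_pure m as \<in> carrier (RT m)"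
  by (simp add: RT_simps quot_pure_mem)

lemma compat_reduced_pure: "compat (C m) m (reduced_pure m)"
proof -
  interpret T: vquotient "RT m" "twisted_commutators A B \<sigma> m" by (rule vquotient_RT)
  have "compat (C m) m (\<lambda>as. (\<lambda>x\<in>carrier (RT m). twisted_commutators A B \<sigma> m +>\<^bsub>RT m\<^esub> x) (quot_pure m as))"
    by (rule compat_compose[OF compat_RT _ vspace_RT vspace_C])
      (unfold reduced_chains_def, rule T.proj_lin)
  then show ?thesis by (rule compat_cong) (simp add: reduced_pure_def quot_pure_RT)
qed

lemma reduced_pure_mem: "as \<in> tuples A (Suc m) \<Longrightarrow> reduced_pure m as \<in> carrier (C m)"
  using compat_reduced_pure by (auto simp: compat_def intro: multilinear_mem)

text \<open>The two sides differ by the twisted commutator of an elementary tensor, with the actions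
  evaluated in its outer slots.\<close>

lemma B_twisted_reduced_pure: "B_twisted m (reduced_pure m)"
  unfolding B_twisted_def
proof (intro ballI)
  interpret T: vquotient "RT m" "twisted_commutators A B \<sigma> m" by (rule vquotient_RT)
  fix as b assume as: "as \<in> tuples A (Suc m)" and b: "b \<in> B"
  have "ract (RT m) (quot_pure m as) b \<ominus>\<^bsub>RT m\<^esub> lact (RT m) (\<sigma> b) (quot_pure m as) \<in> twisted_commutators A B \<sigma> m"
    unfolding twisted_commutators_def
    by (rule subsetD[OF lin_span_superset]) (use quot_pure_RT[OF as] b in blast)
  moreover have "ract (RT m) (quot_pure m as) b \<in> carrier (RT m)" "lact (RT m) (\<sigma> b) (quot_pure m as) \<in> carrier (RT m)"
    using lin_closed[OF ract_RT(1)[OF b] quot_pure_RT[OF as]] lin_closed[OF lact_RT(1)[OF \<sigma>_B_mem[OF b]] quot_pure_RT[OF as]]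
    by simp_all
  ultimately show "reduced_pure m (as[m := as ! m \<otimes> b]) = reduced_pure m (as[0 := \<sigma> b \<otimes> as ! 0])"
    unfolding reduced_pure_def ract_RT(2)[OF b as, symmetric] lact_RT(2)[OF \<sigma>_B_mem[OF b] as, symmetric]
    by (simp only: T.coset_eq_iff)
qed

lemma spans_reduced_pure: "spans (C m) (reduced_pure m ` tuples A (Suc m))"
  using vquotient.quot_spans[OF vquotient_RT spans_RT]
  by (simp add: reduced_chains_def reduced_pure_def[abs_def] image_image)

lemma C_lift:
  assumes W: "vspace W" and \<phi>: "compat W m \<phi>" "B_twisted m \<phi>"
  shows "\<exists>h\<in>lin (C m) W. \<forall>as\<in>tuples A (Suc m). h (reduced_pure m as) = \<phi> as"
proof -
  interpret W: vspace W by fact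
  interpret T: vquotient "RT m" "twisted_commutators A B \<sigma> m" by (rule vquotient_RT)
  obtain k where k: "k \<in> lin (RT m) W" "\<forall>as\<in>tuples A (Suc m). k (quot_pure m as) = \<phi> as"
    using quot_pure_lift[OF W \<phi>(1)] unfolding lin_RT by blast
  have eq: "k (ract (RT m) \<omega> b) = k (lact (RT m) (\<sigma> b) \<omega>)" if \<omega>: "\<omega> \<in> carrier (RT m)" and b: "b \<in> B" for \<omega> b
  proof -
    note r = ract_RT[OF b, where m = m] and l = lact_RT[OF \<sigma>_B_mem[OF b], where m = m]
    \<comment> \<open>The twisted relation for \<open>\<phi>\<close> covers elementary tensors only,
      while commutators are formed with every \<omega>. Both sides are linear in \<omega>, so
      agreement on the spanning elementary tensors suffices.\<close>
    have "compose (carrier (RT m)) k (\<lambda>\<omega>. ract (RT m) \<omega> b) = compose (carrier (RT m)) k (lact (RT m) (\<sigma> b))"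
    proof (rule lin_eq_spans[OF _ _ vspace_RT W spans_RT])
      fix x assume "x \<in> quot_pure m ` tuples A (Suc m)"
      then obtain as where as: "as \<in> tuples A (Suc m)" "x = quot_pure m as" by blast
      have "as[m := as ! m \<otimes> b] \<in> tuples A (Suc m)" "as[0 := \<sigma> b \<otimes> as ! 0] \<in> tuples A (Suc m)"
        using as(1) b by (auto intro!: tuples_update m_closed \<sigma>_mem B_carrier[OF b] tuples_nth[OF as(1)])
      moreover have "\<phi> (as[m := as ! m \<otimes> b]) = \<phi> (as[0 := \<sigma> b \<otimes> as ! 0])"
        using \<phi>(2) as(1) b by (simp add: B_twisted_def)
      ultimately show "compose (carrier (RT m)) k (\<lambda>\<omega>. ract (RT m) \<omega> b) x =
          compose (carrier (RT m)) k (lact (RT m) (\<sigma> b)) x"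
        using as k(2) by (simp add: compose_eq quot_pure_RT r(2) l(2))
    qed (rule lin_compose[OF r(1) k(1) vspace_RT], rule lin_compose[OF l(1) k(1) vspace_RT])
    from fun_cong[OF this, of \<omega>] \<omega> show ?thesis by (simp add: compose_eq)
  qed
  have van: "k u = \<zero>\<^bsub>W\<^esub>" if u: "u \<in> twisted_commutators A B \<sigma> m" for u
  proof (rule lin_vanish_on_span[OF k(1) vspace_RT W commutators_subset])
    show "u \<in> lin_span (RT m) {ract (RT m) \<omega> b \<ominus>\<^bsub>RT m\<^esub> lact (RT m) (\<sigma> b) \<omega> | \<omega> b. \<omega> \<in> carrier (RT m) \<and> b \<in> B}"
      using u by (simp add: twisted_commutators_def)
    fix x assume "x \<in> {ract (RT m) \<omega> b \<ominus>\<^bsub>RT m\<^esub> lact (RT m) (\<sigma> b) \<omega> | \<omega> b. \<omega> \<in> carrier (RT m) \<and> b \<in> B}"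
    then obtain \<omega> b where x: "x = ract (RT m) \<omega> b \<ominus>\<^bsub>RT m\<^esub> lact (RT m) (\<sigma> b) \<omega>" "\<omega> \<in> carrier (RT m)" "b \<in> B"
      by blast
    have mem: "ract (RT m) \<omega> b \<in> carrier (RT m)" "lact (RT m) (\<sigma> b) \<omega> \<in> carrier (RT m)"
      using lin_closed[OF ract_RT(1)[OF x(3)] x(2)] lin_closed[OF lact_RT(1)[OF \<sigma>_B_mem[OF x(3)]] x(2)]
      by simp_all
    show "k x = \<zero>\<^bsub>W\<^esub>"
      unfolding x(1) lin_minus[OF k(1) vspace_RT W mem] eq[OF x(2,3)]
      by (rule W.minus_self) (rule lin_closed[OF k(1) mem(2)])
  qed
  obtain h where h: "h \<in> lin (quot (RT m) (twisted_commutators A B \<sigma> m)) W"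
    "\<And>x. x \<in> carrier (RT m) \<Longrightarrow> h (twisted_commutators A B \<sigma> m +>\<^bsub>RT m\<^esub> x) = k x"
    by (rule T.quot_lift[OF k(1) W van], assumption, rule that)
  show ?thesis
    unfolding reduced_chains_def
    by (intro bexI[OF _ h(1)]) (simp add: reduced_pure_def h(2) quot_pure_RT k(2))
qed

lemma reduced_proj:
  shows reduced_proj_lin: "reduced_proj A B \<sigma> m \<in> lin (tensor_power A (Suc m)) (C m)"
    and reduced_proj_pure: "\<And>as. as \<in> tuples A (Suc m) \<Longrightarrow> reduced_proj A B \<sigma> m (pure A (Suc m) as) = reduced_pure m as"
proof -
  have eq: "reduced_proj A B \<sigma> m = lin_ext (tensor_power A (Suc m)) (C m) (tuples A (Suc m)) (pure A (Suc m)) (reduced_pure m)"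
    by (simp add: reduced_proj_def reduced_pure_def[abs_def] quot_pure_def[abs_def])
  have mult: "multilinear A (C m) (Suc m) (reduced_pure m)" using compat_reduced_pure by (simp add: compat_def)
  show "reduced_proj A B \<sigma> m \<in> lin (tensor_power A (Suc m)) (C m)"
    unfolding eq by (rule lin_ext_tensor_power(1)[OF vspace_A vspace_C mult])
  show "reduced_proj A B \<sigma> m (pure A (Suc m) as) = reduced_pure m as" if "as \<in> tuples A (Suc m)" for as
    unfolding eq by (rule lin_ext_tensor_power(2)[OF vspace_A vspace_C mult that])
qed

lemma pure_mem: "as \<in> tuples A n \<Longrightarrow> pure A n as \<in> carrier (tensor_power A n)"
  using multilinear_pure[OF vspace_A] by (rule multilinear_mem)

lemma cyclic_op:
  shows cyclic_op_lin: "cyclic_op A \<sigma> m \<in> lin (tensor_power A (Suc m)) (tensor_power A (Suc m))"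
    and cyclic_op_pure: "\<And>as. as \<in> tuples A (Suc m) \<Longrightarrow>
      cyclic_op A \<sigma> m (pure A (Suc m) as) = (-1) ^ m \<odot>\<^bsub>tensor_power A (Suc m)\<^esub> pure A (Suc m) (rot as)"
proof -
  have eq: "cyclic_op A \<sigma> m = lin_ext (tensor_power A (Suc m)) (tensor_power A (Suc m)) (tuples A (Suc m))
      (pure A (Suc m)) (\<lambda>as. (-1) ^ m \<odot>\<^bsub>tensor_power A (Suc m)\<^esub> pure A (Suc m) (rot as))"
    by (simp add: cyclic_op_def rot_def)
  have mult: "multilinear A (tensor_power A (Suc m)) (Suc m)
      (\<lambda>as. (-1) ^ m \<odot>\<^bsub>tensor_power A (Suc m)\<^esub> pure A (Suc m) (rot as))"
    by (intro multilinear_scale multilinear_rot multilinear_pure vspace_A vspace_tensor_power)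
  show "cyclic_op A \<sigma> m \<in> lin (tensor_power A (Suc m)) (tensor_power A (Suc m))"
    unfolding eq by (rule lin_ext_tensor_power(1)[OF vspace_A vspace_tensor_power[OF vspace_A] mult])
  show "cyclic_op A \<sigma> m (pure A (Suc m) as) = (-1) ^ m \<odot>\<^bsub>tensor_power A (Suc m)\<^esub> pure A (Suc m) (rot as)"
    if "as \<in> tuples A (Suc m)" for as
    unfolding eq by (rule lin_ext_tensor_power(2)[OF vspace_A vspace_tensor_power[OF vspace_A] mult that])
qed

lemma lin_tensor_power_eq:
  assumes "h \<in> lin (tensor_power A n) W" "k \<in> lin (tensor_power A n) W" "vspace W"
    "\<And>as. as \<in> tuples A n \<Longrightarrow> h (pure A n as) = k (pure A n as)"
  shows "h = k"
  by (rule lin_eq_spans[OF assms(1,2) vspace_tensor_power[OF vspace_A] assms(3) spans_pure[OF vspace_A]])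
    (use assms(4) in auto)

text \<open>The definition presupposes that the cyclic operator descends. The candidate comes from
  \<open>C_lift\<close>, applied to the signed class of the rotated tuple, and is then shown to
  intertwine the projection with \<open>cyclic_op\<close>.\<close>

lemma reduced_cyclic_op:
  shows reduced_cyclic_op_lin: "reduced_cyclic_op A B \<sigma> m \<in> lin (C m) (C m)"
    and reduced_cyclic_op_reduced_pure: "\<And>as. as \<in> tuples A (Suc m) \<Longrightarrow>
      reduced_cyclic_op A B \<sigma> m (reduced_pure m as) = (-1) ^ m \<odot>\<^bsub>C m\<^esub> reduced_pure m (rot as)"
proof -
  interpret C: vspace "C m" by (rule vspace_C)
  let ?tp = "tensor_power A (Suc m)"
  have scale: "(\<lambda>x\<in>carrier (C m). (-1) ^ m \<odot>\<^bsub>C m\<^esub> x) \<in> lin (C m) (C m)"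
    by (rule lin_restrictI) (simp_all add: C.smult_add_right C.smult_smult mult.commute vspace_C)
  have compat: "compat (C m) m (\<lambda>as. (-1) ^ m \<odot>\<^bsub>C m\<^esub> reduced_pure m (rot as))"
    by (rule compat_cong[OF compat_compose[OF compat_rot[OF compat_reduced_pure B_twisted_reduced_pure] scale vspace_C vspace_C]])
      (simp add: reduced_pure_mem rot_mem)
  have twisted: "B_twisted m (\<lambda>as. (-1) ^ m \<odot>\<^bsub>C m\<^esub> reduced_pure m (rot as))"
    using B_twisted_rot[of m "reduced_pure m"] compat_reduced_pure[of m] B_twisted_reduced_pure[of m]
    by (simp add: B_twisted_def compat_def)
  obtain h where h: "h \<in> lin (C m) (C m)"
    "\<forall>as\<in>tuples A (Suc m). h (reduced_pure m as) = (-1) ^ m \<odot>\<^bsub>C m\<^esub> reduced_pure m (rot as)"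
    using C_lift[OF vspace_C compat twisted] by blast
  have eq: "compose (carrier ?tp) h (reduced_proj A B \<sigma> m) = compose (carrier ?tp) (reduced_proj A B \<sigma> m) (cyclic_op A \<sigma> m)"
  proof (rule lin_tensor_power_eq[OF lin_compose[OF reduced_proj_lin h(1)]
        lin_compose[OF cyclic_op_lin reduced_proj_lin] vspace_C])
    fix as assume as: "as \<in> tuples A (Suc m)"
    show "compose (carrier ?tp) h (reduced_proj A B \<sigma> m) (pure A (Suc m) as) =
        compose (carrier ?tp) (reduced_proj A B \<sigma> m) (cyclic_op A \<sigma> m) (pure A (Suc m) as)"
      using as h(2) by (simp add: compose_eq pure_mem reduced_proj_pure cyclic_op_pure rot_mem
          lin_smult[OF reduced_proj_lin])
  qed (rule vspace_tensor_power[OF vspace_A])+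
  have hr: "h (reduced_proj A B \<sigma> m \<omega>) = reduced_proj A B \<sigma> m (cyclic_op A \<sigma> m \<omega>)" if "\<omega> \<in> carrier ?tp" for \<omega>
    using fun_cong[OF eq, of \<omega>] that by (simp add: compose_eq)
  \<comment> \<open>\<open>lin_ext\<close> is indexed here by the whole tensor power, so the
    spanning family has to be the image of the projection and not just the classes of elementary
    tensors.\<close>
  have span: "spans (C m) (reduced_proj A B \<sigma> m ` carrier ?tp)"
  proof (rule spans_mono[OF spans_reduced_pure])
    show "reduced_pure m ` tuples A (Suc m) \<subseteq> reduced_proj A B \<sigma> m ` carrier ?tp"
    proof
      fix x assume "x \<in> reduced_pure m ` tuples A (Suc m)"
      then obtain as where "as \<in> tuples A (Suc m)" "x = reduced_pure m as" by blast
      then show "x \<in> reduced_proj A B \<sigma> m ` carrier ?tp"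
        by (intro image_eqI[of _ _ "pure A (Suc m) as"]) (simp_all add: reduced_proj_pure pure_mem)
    qed
  qed (auto intro: lin_closed[OF reduced_proj_lin])
  have eq: "reduced_cyclic_op A B \<sigma> m = h"
    unfolding reduced_cyclic_op_def
    by (rule lin_ext_eqI[OF h(1) _ vspace_C vspace_C]) (use hr span in simp_all)
  show "reduced_cyclic_op A B \<sigma> m \<in> lin (C m) (C m)"
    unfolding eq by (rule h(1))
  show "reduced_cyclic_op A B \<sigma> m (reduced_pure m as) = (-1) ^ m \<odot>\<^bsub>C m\<^esub> reduced_pure m (rot as)" if "as \<in> tuples A (Suc m)" for as
    unfolding eq using h(2) that by blast
qed


subsection \<open>Reduced cyclic chains\<close>

text \<open>\<open>cyclic_coboundaries\<close> is an image and not a span; being the image of this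
  linear map makes it a submodule.\<close>

lemma coboundary_lin:
  "(\<lambda>x\<in>carrier (C m). x \<ominus>\<^bsub>C m\<^esub> reduced_cyclic_op A B \<sigma> m x) \<in> lin (C m) (C m)"
proof -
  interpret C: vspace "C m" by (rule vspace_C)
  note l = reduced_cyclic_op_lin[of m]
  show ?thesis
  proof (rule lin_restrictI)
    fix x assume x: "x \<in> carrier (C m)"
    note lx = lin_closed[OF l x]
    show "x \<ominus>\<^bsub>C m\<^esub> reduced_cyclic_op A B \<sigma> m x \<in> carrier (C m)" by (rule C.M.minus_closed[OF x lx])
    show "c \<odot>\<^bsub>C m\<^esub> x \<ominus>\<^bsub>C m\<^esub> reduced_cyclic_op A B \<sigma> m (c \<odot>\<^bsub>C m\<^esub> x) =
        c \<odot>\<^bsub>C m\<^esub> (x \<ominus>\<^bsub>C m\<^esub> reduced_cyclic_op A B \<sigma> m x)" for c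
      using x lx by (simp add: lin_smult[OF l] C.minus_eq_smult C.smult_add_right C.smult_smult)
    fix y assume y: "y \<in> carrier (C m)"
    note ly = lin_closed[OF l y]
    show "x \<oplus>\<^bsub>C m\<^esub> y \<ominus>\<^bsub>C m\<^esub> reduced_cyclic_op A B \<sigma> m (x \<oplus>\<^bsub>C m\<^esub> y) =
        (x \<ominus>\<^bsub>C m\<^esub> reduced_cyclic_op A B \<sigma> m x) \<oplus>\<^bsub>C m\<^esub> (y \<ominus>\<^bsub>C m\<^esub> reduced_cyclic_op A B \<sigma> m y)"
      using x y lx ly by (simp add: lin_add[OF l] C.minus_eq_smult C.smult_add_right C.M.a_ac)
  qed (rule vspace_C)
qed

lemma vquotient_C: "vquotient (C m) (cyclic_coboundaries A B \<sigma> m)"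
proof -
  have "cyclic_coboundaries A B \<sigma> m =
      (\<lambda>x\<in>carrier (C m). x \<ominus>\<^bsub>C m\<^esub> reduced_cyclic_op A B \<sigma> m x) ` carrier (C m)"
    unfolding cyclic_coboundaries_def by (rule image_cong) auto
  then show ?thesis
    using vspace_submodule_vquotient[OF vspace_C lin_image_submodule[OF coboundary_lin vspace_C vspace_C]]
    by simp
qed

abbreviation CL :: "nat \<Rightarrow> (complex, ('a set list \<Rightarrow> complex) set set set) module" where
  "CL m \<equiv> cyclic_chains A B \<sigma> m"

lemma vspace_CL: "vspace (CL m)"
  unfolding cyclic_chains_def by (rule vquotient.vspace_quot[OF vquotient_C])

definition cyclic_pure :: "nat \<Rightarrow> 'a list \<Rightarrow> ('a set list \<Rightarrow> complex) set set set" where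
  "cyclic_pure m as = cyclic_coboundaries A B \<sigma> m +>\<^bsub>C m\<^esub> reduced_pure m as"

lemma coset_lin: "(\<lambda>x\<in>carrier (C m). cyclic_coboundaries A B \<sigma> m +>\<^bsub>C m\<^esub> x) \<in> lin (C m) (CL m)"
  unfolding cyclic_chains_def by (rule vquotient.proj_lin[OF vquotient_C])

lemma compat_cyclic_pure: "compat (CL m) m (cyclic_pure m)"
  by (rule compat_cong[OF compat_compose[OF compat_reduced_pure coset_lin vspace_C vspace_CL]])
    (simp add: cyclic_pure_def reduced_pure_mem)

lemma cyclic_pure_mem: "as \<in> tuples A (Suc m) \<Longrightarrow> cyclic_pure m as \<in> carrier (CL m)"
  using compat_cyclic_pure by (auto simp: compat_def intro: multilinear_mem)

lemma B_twisted_cyclic_pure: "B_twisted m (cyclic_pure m)"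
  using B_twisted_reduced_pure[of m] by (simp add: B_twisted_def cyclic_pure_def)

text \<open>The class of a tuple minus that of its signed rotation is of the form x - \<lambda> x,
  hence dies in the quotient.\<close>

lemma cyclic_cyclic_pure: "cyclic (CL m) m (cyclic_pure m)"
  unfolding cyclic_def
proof
  interpret C: vquotient "C m" "cyclic_coboundaries A B \<sigma> m" by (rule vquotient_C)
  interpret L: vspace "CL m" by (rule vspace_CL)
  fix as assume as: "as \<in> tuples A (Suc m)"
  note mem = reduced_pure_mem[OF as] reduced_pure_mem[OF rot_mem[OF as]]
  have "reduced_pure m as \<ominus>\<^bsub>C m\<^esub> reduced_cyclic_op A B \<sigma> m (reduced_pure m as) \<in> cyclic_coboundaries A B \<sigma> m"
    unfolding cyclic_coboundaries_def using mem(1) by (rule imageI)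
  then have "cyclic_pure m as = cyclic_coboundaries A B \<sigma> m +>\<^bsub>C m\<^esub> ((-1) ^ m \<odot>\<^bsub>C m\<^esub> reduced_pure m (rot as))"
    unfolding cyclic_pure_def reduced_cyclic_op_reduced_pure[OF as]
    by (subst C.coset_eq_iff) (auto intro: mem)
  also have "\<dots> = (-1) ^ m \<odot>\<^bsub>CL m\<^esub> cyclic_pure m (rot as)"
    unfolding cyclic_pure_def cyclic_chains_def by (rule C.smult_quot[OF mem(2), symmetric])
  finally show "cyclic_pure m (rot as) = (-1) ^ m \<odot>\<^bsub>CL m\<^esub> cyclic_pure m as"
    using cyclic_pure_mem[OF rot_mem[OF as]] by (simp add: L.smult_smult power_mult_distrib[symmetric])
qed

lemma spans_cyclic_pure: "spans (CL m) (cyclic_pure m ` tuples A (Suc m))"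
  using vquotient.quot_spans[OF vquotient_C spans_reduced_pure]
  by (simp add: cyclic_chains_def cyclic_pure_def[abs_def] image_image)

text \<open>Last of the universal properties: a linear map on \<open>C m\<close> kills the image of
  1 - \<lambda> once composing it with the cyclic operator gives it back, and this can be tested on
  classes of tuples.\<close>

lemma CL_lift:
  assumes W: "vspace W" and \<phi>: "compat W m \<phi>" "B_twisted m \<phi>" "cyclic W m \<phi>"
  shows "\<exists>h\<in>lin (CL m) W. \<forall>as\<in>tuples A (Suc m). h (cyclic_pure m as) = \<phi> as"
proof -
  interpret W: vspace W by fact
  interpret C: vquotient "C m" "cyclic_coboundaries A B \<sigma> m" by (rule vquotient_C)
  have mem: "\<phi> as \<in> carrier W" if "as \<in> tuples A (Suc m)" for as
    using \<phi>(1) that by (auto simp: compat_def intro: multilinear_mem)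
  obtain k where k: "k \<in> lin (C m) W" "\<forall>as\<in>tuples A (Suc m). k (reduced_pure m as) = \<phi> as"
    using C_lift[OF W \<phi>(1,2)] by blast
  note l = reduced_cyclic_op_lin[of m]
  have eq: "compose (carrier (C m)) k (reduced_cyclic_op A B \<sigma> m) = k"
  proof (rule lin_eq_spans[OF lin_compose[OF l k(1) vspace_C] k(1) vspace_C W spans_reduced_pure])
    fix x assume "x \<in> reduced_pure m ` tuples A (Suc m)"
    then obtain as where as: "as \<in> tuples A (Suc m)" "x = reduced_pure m as" by blast
    have "k (reduced_cyclic_op A B \<sigma> m (reduced_pure m as)) = (-1) ^ m \<odot>\<^bsub>W\<^esub> \<phi> (rot as)"
      using as(1) k(2) by (simp add: reduced_cyclic_op_reduced_pure lin_smult[OF k(1)] reduced_pure_mem rot_mem)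
    also have "\<dots> = \<phi> as"
      using \<phi>(3) as(1) mem[OF as(1)] by (simp add: cyclic_def W.smult_smult power_mult_distrib[symmetric])
    finally show "compose (carrier (C m)) k (reduced_cyclic_op A B \<sigma> m) x = k x"
      using as k(2) by (simp add: compose_eq reduced_pure_mem)
  qed
  have van: "k u = \<zero>\<^bsub>W\<^esub>" if "u \<in> cyclic_coboundaries A B \<sigma> m" for u
  proof -
    from that obtain x where x: "x \<in> carrier (C m)" "u = x \<ominus>\<^bsub>C m\<^esub> reduced_cyclic_op A B \<sigma> m x"
      unfolding cyclic_coboundaries_def by blast
    have "k (reduced_cyclic_op A B \<sigma> m x) = k x" using fun_cong[OF eq, of x] x(1) by (simp add: compose_eq)
    then show ?thesis
      unfolding x(2) using lin_minus[OF k(1) vspace_C W x(1) lin_closed[OF l x(1)]] lin_closed[OF k(1) x(1)]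
      by (simp add: W.minus_self)
  qed
  obtain h where h: "h \<in> lin (quot (C m) (cyclic_coboundaries A B \<sigma> m)) W"
    "\<And>x. x \<in> carrier (C m) \<Longrightarrow> h (cyclic_coboundaries A B \<sigma> m +>\<^bsub>C m\<^esub> x) = k x"
    by (rule C.quot_lift[OF k(1) W van], assumption, rule that)
  show ?thesis
    unfolding cyclic_chains_def
    by (intro bexI[OF _ h(1)]) (simp add: cyclic_pure_def h(2) reduced_pure_mem k(2))
qed

lemma cyclic_proj_pure: "as \<in> tuples A (Suc m) \<Longrightarrow> cyclic_proj A B \<sigma> m (pure A (Suc m) as) = cyclic_pure m as"
  by (simp add: cyclic_proj_def cyclic_pure_def reduced_proj_pure)

lemma cyclic_proj_lin:
  "restrict (cyclic_proj A B \<sigma> m) (carrier (tensor_power A (Suc m))) \<in> lin (tensor_power A (Suc m)) (CL m)"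
proof -
  have eq: "compose (carrier (tensor_power A (Suc m)))
      (\<lambda>x\<in>carrier (C m). cyclic_coboundaries A B \<sigma> m +>\<^bsub>C m\<^esub> x) (reduced_proj A B \<sigma> m) =
      restrict (cyclic_proj A B \<sigma> m) (carrier (tensor_power A (Suc m)))"
    unfolding compose_def cyclic_proj_def
    by (rule restrict_ext) (simp add: lin_closed[OF reduced_proj_lin])
  show ?thesis
    unfolding eq[symmetric]
    by (rule lin_compose[OF reduced_proj_lin coset_lin vspace_tensor_power[OF vspace_A]])
qed


subsection \<open>The boundary map\<close>

lemma face_eq_take_drop:
  assumes "as \<in> tuples A (Suc n)" "i < n"
  shows "take i as @ (as ! i \<otimes> as ! (i + 1)) # drop (i + 2) as = face n i as"
proof (rule nth_equalityI)
  have len: "length as = Suc n" by (rule tuples_length[OF assms(1)])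
  then show "length (take i as @ (as ! i \<otimes> as ! (i + 1)) # drop (i + 2) as) = length (face n i as)"
    using assms(2) by simp
  fix k assume "k < length (take i as @ (as ! i \<otimes> as ! (i + 1)) # drop (i + 2) as)"
  with len assms(2) have "k < n" by simp
  moreover consider "k < i" | "k = i" | l where "k = Suc (i + l)"
    using less_imp_Suc_add[of i k] by (metis linorder_neqE_nat)
  ultimately show "(take i as @ (as ! i \<otimes> as ! (i + 1)) # drop (i + 2) as) ! k = face n i as ! k"
    using len assms(2) by cases (simp_all add: nth_face nth_append)
qed

lemma face_eq_twisted:
  assumes "as \<in> tuples A (Suc (Suc m))"
  shows "(\<sigma> (last as) \<otimes> hd as) # butlast (tl as) = face (Suc m) (Suc m) as"
proof -
  obtain a as' where as: "as = a # as'" "length as' = Suc m"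
    using tuples_length[OF assms] by (cases as) auto
  \<comment> \<open>At least two entries are present, so the last entry of the tuple is the last
    entry of its tail.\<close>
  then have "as' \<noteq> []" by auto
  with as show ?thesis
    by (intro nth_equalityI) (auto simp: nth_face nth_Cons nth_butlast last_conv_nth split: nat.splits)
qed

lemma hochschild:
  shows hochschild_lin: "hochschild A \<sigma> (Suc m) \<in> lin (tensor_power A (Suc (Suc m))) (tensor_power A (Suc m))"
    and hochschild_pure: "\<And>as. as \<in> tuples A (Suc (Suc m)) \<Longrightarrow>
      hochschild A \<sigma> (Suc m) (pure A (Suc (Suc m)) as) =
        cobd (tensor_power A (Suc m)) (Suc m) (pure A (Suc m)) as"
proof -
  let ?W = "tensor_power A (Suc m)"
  interpret W: vspace ?W by (rule vspace_tensor_power[OF vspace_A])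
  \<comment> \<open>The prescription in \<open>hochschild\<close>, with the twisted term apart from
    the sum. It is compared with \<open>cobd\<close> on tuples only, which is all that
    \<open>lin_ext\<close> looks at.\<close>
  define g where "g as = (\<Oplus>\<^bsub>?W\<^esub> i\<in>{..<Suc m}. (-1) ^ i \<odot>\<^bsub>?W\<^esub>
      pure A (Suc m) (take i as @ (as ! i \<otimes> as ! (i + 1)) # drop (i + 2) as))
      \<oplus>\<^bsub>?W\<^esub> (-1) ^ Suc m \<odot>\<^bsub>?W\<^esub> pure A (Suc m) ((\<sigma> (last as) \<otimes> hd as) # butlast (tl as))" for as
  have g: "g as = cobd ?W (Suc m) (pure A (Suc m)) as" if as: "as \<in> tuples A (Suc (Suc m))" for as
  proof -
    have mem: "pure A (Suc m) (face (Suc m) i as) \<in> carrier ?W" for i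
      by (rule pure_mem[OF face_mem[OF as]])
    have "g as = W.alt_sum m (\<lambda>i. pure A (Suc m) (face (Suc m) i as)) \<oplus>\<^bsub>?W\<^esub>
        (-1) ^ Suc m \<odot>\<^bsub>?W\<^esub> pure A (Suc m) (face (Suc m) (Suc m) as)"
      unfolding g_def face_eq_twisted[OF as] W.alt_sum_def lessThan_Suc_atMost
      by (intro arg_cong2[of _ _ _ _ "add ?W"] W.M.finsum_cong' refl) (use mem face_eq_take_drop[OF as] in auto)
    then show ?thesis
      using mem unfolding cobd_def by (simp add: W.alt_sum_Suc W.alt_sum_closed W.M.a_comm del: power_Suc)
  qed
  obtain h where h: "h \<in> lin (tensor_power A (Suc (Suc m))) ?W"
    "\<forall>as\<in>tuples A (Suc (Suc m)). h (pure A (Suc (Suc m)) as) = cobd ?W (Suc m) (pure A (Suc m)) as"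
    using tensor_power_lift[OF vspace_A W.vspace_axioms
        multilinear_cobd[OF W.vspace_axioms multilinear_pure[OF vspace_A]]] by blast
  have "hochschild A \<sigma> (Suc m) = lin_ext (tensor_power A (Suc (Suc m))) ?W (tuples A (Suc (Suc m)))
      (pure A (Suc (Suc m))) g"
    unfolding hochschild_def g_def[abs_def] by simp
  also have "\<dots> = h"
    by (rule lin_ext_eqI[OF h(1) _ vspace_tensor_power[OF vspace_A] W.vspace_axioms spans_pure[OF vspace_A]])
      (use h(2) g in simp)
  finally have eq: "hochschild A \<sigma> (Suc m) = h" .
  show "hochschild A \<sigma> (Suc m) \<in> lin (tensor_power A (Suc (Suc m))) (tensor_power A (Suc m))"
    unfolding eq by (rule h(1))
  show "hochschild A \<sigma> (Suc m) (pure A (Suc (Suc m)) as) = cobd ?W (Suc m) (pure A (Suc m)) as"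
    if "as \<in> tuples A (Suc (Suc m))" for as
    unfolding eq using h(2) that by blast
qed

text \<open>The core of the proof, and free of circularity in this order: cyclicity of the
  coboundary comes first, its vanishing uses cyclicity, its twisted relation uses vanishing, and its
  balancing uses cyclicity and the twisted relation.\<close>

lemma compat_cobd:
  assumes W: "vspace W" and \<phi>: "compat W m \<phi>" "B_twisted m \<phi>" "cyclic W m \<phi>"
  shows "compat W (Suc m) (cobd W (Suc m) \<phi>)" "B_twisted (Suc m) (cobd W (Suc m) \<phi>)"
    "cyclic W (Suc m) (cobd W (Suc m) \<phi>)"
proof -
  have mult: "multilinear A W (Suc m) \<phi>" and van: "B_vanishing W m \<phi>" using \<phi>(1) by (auto simp: compat_def)
  note mem = multilinear_mem[OF mult]
  have m: "multilinear A W (Suc (Suc m)) (cobd W (Suc m) \<phi>)"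
    by (rule multilinear_cobd[OF W mult]) simp
  show c: "cyclic W (Suc m) (cobd W (Suc m) \<phi>)" by (rule cyclic_cobd[OF W \<phi>(3) mem])
  have v: "B_vanishing W (Suc m) (cobd W (Suc m) \<phi>)" by (rule B_vanishing_cobd[OF W \<phi>(3) van \<phi>(2) mem])
  show t: "B_twisted (Suc m) (cobd W (Suc m) \<phi>)" by (rule B_twisted_cobd[OF W v mem])
  have "B_balanced (Suc m) (cobd W (Suc m) \<phi>)"
    by (rule cyclic_B_balancedI[OF W c t multilinear_mem[OF m]])
  with m v show "compat W (Suc m) (cobd W (Suc m) \<phi>)" by (simp add: compat_def)
qed

lemma cyclic_boundary:
  defines "d \<equiv> cyclic_boundary A B \<sigma>"
  shows cyclic_boundary_lin: "d (Suc m) \<in> lin (CL (Suc m)) (CL m)"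
    and cyclic_boundary_cyclic_pure: "\<And>as. as \<in> tuples A (Suc (Suc m)) \<Longrightarrow>
      d (Suc m) (cyclic_pure (Suc m) as) = cobd (CL m) (Suc m) (cyclic_pure m) as"
    and cyclic_boundary_proj: "\<And>\<omega>. \<omega> \<in> carrier (tensor_power A (Suc (Suc m))) \<Longrightarrow>
      d (Suc m) (cyclic_proj A B \<sigma> (Suc m) \<omega>) = cyclic_proj A B \<sigma> m (hochschild A \<sigma> (Suc m) \<omega>)"
    and cyclic_boundary_unique: "\<And>k. k \<in> lin (CL (Suc m)) (CL m) \<Longrightarrow>
      \<forall>\<omega>\<in>carrier (tensor_power A (Suc (Suc m))).
        k (cyclic_proj A B \<sigma> (Suc m) \<omega>) = cyclic_proj A B \<sigma> m (hochschild A \<sigma> (Suc m) \<omega>) \<Longrightarrow> k = d (Suc m)"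
proof -
  let ?tp = "\<lambda>n. tensor_power A n"
  note vtp = vspace_tensor_power[OF vspace_A]
  \<comment> \<open>The boundary itself: \<open>compat_cobd\<close> is applied to the universal map
    \<open>cyclic_pure m\<close>, and its coboundary factors through the chains one degree
    higher.\<close>
  obtain h where h: "h \<in> lin (CL (Suc m)) (CL m)"
    "\<forall>as\<in>tuples A (Suc (Suc m)). h (cyclic_pure (Suc m) as) = cobd (CL m) (Suc m) (cyclic_pure m) as"
    using CL_lift[OF vspace_CL compat_cobd[OF vspace_CL compat_cyclic_pure B_twisted_cyclic_pure cyclic_cyclic_pure]] by blast
  let ?p = "\<lambda>n. restrict (cyclic_proj A B \<sigma> n) (carrier (?tp (Suc n)))"
  have eq: "compose (carrier (?tp (Suc (Suc m)))) h (?p (Suc m)) =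
      compose (carrier (?tp (Suc (Suc m)))) (?p m) (hochschild A \<sigma> (Suc m))"
  proof (rule lin_tensor_power_eq[OF lin_compose[OF cyclic_proj_lin h(1) vtp]
        lin_compose[OF hochschild_lin cyclic_proj_lin vtp] vspace_CL])
    fix as assume as: "as \<in> tuples A (Suc (Suc m))"
    \<comment> \<open>The projection is linear, so it can be moved inside the alternating sum of
      faces; this turns the Hochschild boundary into the coboundary of the projected map.\<close>
    have "?p m (cobd (?tp (Suc m)) (Suc m) (pure A (Suc m)) as) = cobd (CL m) (Suc m) (\<lambda>as. ?p m (pure A (Suc m) as)) as"
      unfolding cobd_def by (rule lin_alt_sum[OF cyclic_proj_lin vtp vspace_CL]) (rule pure_mem[OF face_mem[OF as]])
    also have "\<dots> = cobd (CL m) (Suc m) (cyclic_pure m) as"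
      unfolding cobd_def
      by (rule vspace.alt_sum_cong[OF vspace_CL]) (simp_all add: pure_mem cyclic_proj_pure cyclic_pure_mem face_mem[OF as])
    finally show "compose (carrier (?tp (Suc (Suc m)))) h (?p (Suc m)) (pure A (Suc (Suc m)) as) =
        compose (carrier (?tp (Suc (Suc m)))) (?p m) (hochschild A \<sigma> (Suc m)) (pure A (Suc (Suc m)) as)"
      using as h(2) by (simp add: compose_eq pure_mem cyclic_proj_pure hochschild_pure)
  qed
  have hp: "h (cyclic_proj A B \<sigma> (Suc m) \<omega>) = cyclic_proj A B \<sigma> m (hochschild A \<sigma> (Suc m) \<omega>)"
    if "\<omega> \<in> carrier (?tp (Suc (Suc m)))" for \<omega>
    using fun_cong[OF eq, of \<omega>] that lin_closed[OF hochschild_lin that] by (simp add: compose_eq)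
  have span: "spans (CL (Suc m)) (cyclic_proj A B \<sigma> (Suc m) ` carrier (?tp (Suc (Suc m))))"
  proof (rule spans_mono[OF spans_cyclic_pure])
    show "cyclic_pure (Suc m) ` tuples A (Suc (Suc m)) \<subseteq> cyclic_proj A B \<sigma> (Suc m) ` carrier (?tp (Suc (Suc m)))"
    proof
      fix x assume "x \<in> cyclic_pure (Suc m) ` tuples A (Suc (Suc m))"
      then obtain as where "as \<in> tuples A (Suc (Suc m))" "x = cyclic_pure (Suc m) as" by blast
      then show "x \<in> cyclic_proj A B \<sigma> (Suc m) ` carrier (?tp (Suc (Suc m)))"
        by (intro image_eqI[of _ _ "pure A (Suc (Suc m)) as"]) (simp_all add: cyclic_proj_pure pure_mem)
    qed
    show "cyclic_proj A B \<sigma> (Suc m) ` carrier (?tp (Suc (Suc m))) \<subseteq> carrier (CL (Suc m))"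
      using lin_closed[OF cyclic_proj_lin[of "Suc m"]] by auto
  qed
  have d: "d (Suc m) = h"
    unfolding d_def cyclic_boundary_def
    by (rule lin_ext_eqI) (use h(1) hp span vspace_CL in simp_all)
  show "d (Suc m) \<in> lin (CL (Suc m)) (CL m)" unfolding d by (rule h(1))
  show "d (Suc m) (cyclic_pure (Suc m) as) = cobd (CL m) (Suc m) (cyclic_pure m) as" if "as \<in> tuples A (Suc (Suc m))" for as
    unfolding d using h(2) that by blast
  show "d (Suc m) (cyclic_proj A B \<sigma> (Suc m) \<omega>) = cyclic_proj A B \<sigma> m (hochschild A \<sigma> (Suc m) \<omega>)"
    if "\<omega> \<in> carrier (?tp (Suc (Suc m)))" for \<omega>
    unfolding d by (rule hp[OF that])
  show "k = d (Suc m)" if k: "k \<in> lin (CL (Suc m)) (CL m)"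
    "\<forall>\<omega>\<in>carrier (?tp (Suc (Suc m))).
        k (cyclic_proj A B \<sigma> (Suc m) \<omega>) = cyclic_proj A B \<sigma> m (hochschild A \<sigma> (Suc m) \<omega>)" for k
    unfolding d by (rule lin_eq_spans[OF k(1) h(1) vspace_CL vspace_CL span]) (use k(2) hp in auto)
qed

text \<open>On the class of a tuple the composite is the double coboundary of
  \<open>cyclic_pure m\<close>, so \<open>cobd_cobd\<close> applies; linearity and spanning do the
  rest.\<close>

lemma cyclic_boundary_boundary:
  assumes "x \<in> carrier (CL (Suc (Suc m)))"
  shows "cyclic_boundary A B \<sigma> (Suc m) (cyclic_boundary A B \<sigma> (Suc (Suc m)) x) = \<zero>\<^bsub>CL m\<^esub>"
proof -
  let ?d = "cyclic_boundary A B \<sigma>"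
  have "compose (carrier (CL (Suc (Suc m)))) (?d (Suc m)) (?d (Suc (Suc m))) x = \<zero>\<^bsub>CL m\<^esub>"
  proof (rule lin_vanish_on_span[OF lin_compose[OF cyclic_boundary_lin cyclic_boundary_lin vspace_CL] vspace_CL vspace_CL])
    show "cyclic_pure (Suc (Suc m)) ` tuples A (Suc (Suc (Suc m))) \<subseteq> carrier (CL (Suc (Suc m)))"
      "x \<in> lin_span (CL (Suc (Suc m))) (cyclic_pure (Suc (Suc m)) ` tuples A (Suc (Suc (Suc m))))"
      using spans_cyclic_pure[of "Suc (Suc m)"] assms by (auto simp: spans_def)
    fix y assume "y \<in> cyclic_pure (Suc (Suc m)) ` tuples A (Suc (Suc (Suc m)))"
    then obtain as where as: "as \<in> tuples A (Suc (Suc (Suc m)))" "y = cyclic_pure (Suc (Suc m)) as" by blast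
    have f: "face (Suc (Suc m)) i as \<in> tuples A (Suc (Suc m))" for i by (rule face_mem[OF as(1)])
    have mem: "cobd (CL m) (Suc m) (cyclic_pure m) bs \<in> carrier (CL m)" if "bs \<in> tuples A (Suc (Suc m))" for bs
      unfolding cobd_def using that by (intro vspace.alt_sum_closed[OF vspace_CL] cyclic_pure_mem face_mem)
    have "?d (Suc m) (cobd (CL (Suc m)) (Suc (Suc m)) (cyclic_pure (Suc m)) as) =
        cobd (CL m) (Suc (Suc m)) (\<lambda>bs. ?d (Suc m) (cyclic_pure (Suc m) bs)) as"
      unfolding cobd_def by (rule lin_alt_sum[OF cyclic_boundary_lin vspace_CL vspace_CL]) (rule cyclic_pure_mem[OF f])
    also have "\<dots> = cobd (CL m) (Suc (Suc m)) (cobd (CL m) (Suc m) (cyclic_pure m)) as"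
      unfolding cobd_def[of "CL m" "Suc (Suc m)"]
      by (rule vspace.alt_sum_cong[OF vspace_CL]) (simp_all add: cyclic_boundary_cyclic_pure f mem)
    also have "\<dots> = \<zero>\<^bsub>CL m\<^esub>"
      by (rule cobd_cobd[OF vspace_CL cyclic_pure_mem _ as(1)]) auto
    finally show "compose (carrier (CL (Suc (Suc m)))) (?d (Suc m)) (?d (Suc (Suc m))) y = \<zero>\<^bsub>CL m\<^esub>"
      using as by (simp add: compose_eq cyclic_pure_mem cyclic_boundary_cyclic_pure)
  qed
  then show ?thesis using assms by (simp add: compose_eq)
qed

end

theorem proposition3p2:
  fixes A :: "(complex, 'a, 'm) module_scheme" and B :: "'a set" and \<sigma> :: "'a \<Rightarrow> 'a"
  assumes "complex_algebra A"
    and "\<sigma> \<in> algebra_aut A"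
    and "complex_subalgebra B A"
    and "bij_betw \<sigma> B B"
  shows "(\<forall>n\<ge>1. \<exists>!\<beta>. \<beta> \<in> lin (cyclic_chains A B \<sigma> n) (cyclic_chains A B \<sigma> (n - 1)) \<and>
            (\<forall>\<omega>\<in>carrier (tensor_power A (n + 1)).
               \<beta> (cyclic_proj A B \<sigma> n \<omega>) = cyclic_proj A B \<sigma> (n - 1) (hochschild A \<sigma> n \<omega>))) \<and>
         chain_complex (cyclic_chains A B \<sigma>) (cyclic_boundary A B \<sigma>)"
proof (intro conjI allI impI)
  interpret twisted_algebra A B \<sigma> by (rule twisted_algebra.intro[OF assms])
  fix n :: nat assume "n \<ge> 1"
  \<comment> \<open>Writing n as a successor turns the truncated difference \<open>n - 1\<close>
    into \<open>m\<close>, the form in which the boundary lemmas are stated.\<close>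
  then obtain m where n: "n = Suc m" by (cases n) auto
  show "\<exists>!\<beta>. \<beta> \<in> lin (cyclic_chains A B \<sigma> n) (cyclic_chains A B \<sigma> (n - 1)) \<and>
            (\<forall>\<omega>\<in>carrier (tensor_power A (n + 1)).
               \<beta> (cyclic_proj A B \<sigma> n \<omega>) = cyclic_proj A B \<sigma> (n - 1) (hochschild A \<sigma> n \<omega>))"
  proof (rule ex1I[of _ "cyclic_boundary A B \<sigma> n"])
    show "cyclic_boundary A B \<sigma> n \<in> lin (cyclic_chains A B \<sigma> n) (cyclic_chains A B \<sigma> (n - 1)) \<and>
        (\<forall>\<omega>\<in>carrier (tensor_power A (n + 1)). cyclic_boundary A B \<sigma> n (cyclic_proj A B \<sigma> n \<omega>) =
          cyclic_proj A B \<sigma> (n - 1) (hochschild A \<sigma> n \<omega>))"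
      by (simp add: n cyclic_boundary_lin cyclic_boundary_proj)
  qed (simp add: n cyclic_boundary_unique)
next
  interpret twisted_algebra A B \<sigma> by (rule twisted_algebra.intro[OF assms])
  show "chain_complex (cyclic_chains A B \<sigma>) (cyclic_boundary A B \<sigma>)"
    unfolding chain_complex_def
  proof (intro conjI allI impI ballI)
    show "module CC (cyclic_chains A B \<sigma> n)" for n
      using vspace_CL by (simp add: vspace_iff)
  next
    fix n :: nat assume "n \<ge> 1"
    then obtain m where n: "n = Suc m" by (cases n) auto
    show "cyclic_boundary A B \<sigma> n \<in> lin (cyclic_chains A B \<sigma> n) (cyclic_chains A B \<sigma> (n - 1))"
      using cyclic_boundary_lin[of m] by (simp add: n)
    fix x assume "x \<in> carrier (cyclic_chains A B \<sigma> (n + 1))"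
    then show "cyclic_boundary A B \<sigma> n (cyclic_boundary A B \<sigma> (n + 1) x) = \<zero>\<^bsub>cyclic_chains A B \<sigma> (n - 1)\<^esub>"
      using cyclic_boundary_boundary[of x m] by (simp add: n)
  qed
qed

end
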